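(* Let $H(X,Y,q)$ be the mirror curve polynomial described in the context. There is $\epsilon>0$ such that for every $q\in(\mathbb{R}^* )^p$ with $|q_k|<\epsilon$ for all $k$, $a_i(q)<0$ whenever $m_i,n_i$ are both odd, and $a_i(q)>0$ whenever $m_i$ or $n_i$ is even, the following holds: if $l_i$ and $l_{i+1}$ are the axes of $\mathbb{R}X_P$ corresponding to two adjacent sides $r_i,r_{i+1}$ of $P$, then there exists an arc of the unbounded component $W$ which intersects only these two axes $l_i$ and $l_{i+1}$ (and no other axis).
   Context: Let $P\subset\mathbb{R}^2$ be a convex lattice polygon with a unimodular triangulation $T_\Sigma$ (triangles with lattice vertices and area $1/2$; vertex set $P\cap\mathbb{Z}^2$), encoding a smooth toric Calabi–Yau 3-fold. Write $P\cap\mathbb{Z}^2=\{b_1,\dots,b_{p+3}\}$, $b_i=(m_i,n_i)$, with $b_1=(1,0)$, $b_2=(0,1)$, $b_3=(0,0)$ and $\sigma_1=\{b_1,b_2,b_3\}$ a triangle of $T_\Sigma$. Let $L=\ker(\mathbb{Z}^{p+3}\to\mathbb{Z}^3,\ e_i\mapsto(m_i,n_i,1))$, $D_i\in L^\vee$ the restriction of the $i$-th coordinate functional; for a triangle $\sigma$ with vertex index set $I'_\sigma$, $\{D_j:j\notin I'_\sigma\}$ is a basis of $L^\vee\otimes\mathbb{Q}$. Fix $H_1,\dots,H_p\in L^\vee\otimes\mathbb{Q}$ with $H_k=\sum_{j\notin I'_\sigma}s^\sigma_{k,j}D_j$, $s^\sigma_{k,j}\in\mathbb{Z}_{\ge0}$,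 $(s^\sigma_{k,j})$ nondegenerate, for every triangle $\sigma$. Set $a_i(q)=1$ ($i=1,2,3$), $a_i(q)=\prod_k q_k^{s^{\sigma_1}_{k,i}}$ ($i\ge4$), and $H(X,Y,q)=\sum_{i=1}^{p+3}a_i(q)X^{m_i}Y^{n_i}$. Let $X_P$ be the projective toric surface of $P$, $\mathbb{R}X_P$ the closure of $(\mathbb{R}^* )^2$ in $X_P$; for each side $r_i$ of $P$ the axis $l_i$ is the real part of the torus-invariant boundary divisor of $X_P$ corresponding to $r_i$. The real mirror curve is $\{(x,y)\in(\mathbb{R}^* )^2:H(x,y,q)=0\}$; the unbounded component $W$ is the connected component of its closure in $\mathbb{R}X_P$ that meets the union of the axes (in this setting there is exactly one such component). *)

theory Defs
  imports "HOL-Analysis.Analysis"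
begin

definition lattice_pt :: "int \<times> int \<Rightarrow> real \<times> real" where
  "lattice_pt v = (of_int (fst v), of_int (snd v))"

definition convex_lattice_polygon :: "(real \<times> real) set \<Rightarrow> bool" where
  "convex_lattice_polygon P \<longleftrightarrow>
     (\<exists>S. finite S \<and> P = convex hull (lattice_pt ` S)) \<and> interior P \<noteq> {}"

definition idx_hull :: "(nat \<Rightarrow> int \<times> int) \<Rightarrow> nat set \<Rightarrow> (real \<times> real) set" where
  "idx_hull b I = convex hull (lattice_pt ` b ` I)"

definition unimodular_triangulation ::
  "(real \<times> real) set \<Rightarrow> (nat \<Rightarrow> int \<times> int) \<Rightarrow> nat \<Rightarrow> nat set set \<Rightarrow> bool" where
  "unimodular_triangulation P b N T \<longleftrightarrow>
     finite T \<and>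
     (\<forall>\<sigma>\<in>T. \<sigma> \<subseteq> {1..N} \<and>
        (\<exists>i j k. \<sigma> = {i, j, k} \<and>
           \<bar>(fst (b j) - fst (b i)) * (snd (b k) - snd (b i))
             - (fst (b k) - fst (b i)) * (snd (b j) - snd (b i))\<bar> = 1)) \<and>
     (\<Union>\<sigma>\<in>T. idx_hull b \<sigma>) = P \<and>
     (\<forall>\<sigma>\<in>T. \<forall>\<tau>\<in>T. idx_hull b \<sigma> \<inter> idx_hull b \<tau> = idx_hull b (\<sigma> \<inter> \<tau>)) \<and>
     (\<Union>T) = {1..N}"

text \<open>The lattice L = ker(Z^N -> Z^3, e_i -> (m_i, n_i, 1)), as integer vectors supported on {1..N}.\<close>
definition charge_lattice :: "(nat \<Rightarrow> int \<times> int) \<Rightarrow> nat \<Rightarrow> (nat \<Rightarrow> int) set" where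
  "charge_lattice b N = {l. (\<forall>i. i \<notin> {1..N} \<longrightarrow> l i = 0) \<and>
      (\<Sum>i\<in>{1..N}. l i * fst (b i)) = 0 \<and>
      (\<Sum>i\<in>{1..N}. l i * snd (b i)) = 0 \<and>
      (\<Sum>i\<in>{1..N}. l i) = 0}"

text \<open>a_i(q) = 1 for i = 1,2,3 and prod_k q_k^(s_{k,i}) for i >= 4, with s the matrix for sigma_1.\<close>
definition mirror_coeff :: "nat \<Rightarrow> (nat \<Rightarrow> nat \<Rightarrow> nat) \<Rightarrow> (nat \<Rightarrow> real) \<Rightarrow> nat \<Rightarrow> real" where
  "mirror_coeff p s1 q i = (if i \<le> 3 then 1 else (\<Prod>k\<in>{1..p}. q k ^ s1 k i))"

definition mirror_poly ::
  "(nat \<Rightarrow> int \<times> int) \<Rightarrow> nat \<Rightarrow> (nat \<Rightarrow> real) \<Rightarrow> real \<Rightarrow> real \<Rightarrow> real" where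
  "mirror_poly b N a x y = (\<Sum>i\<in>{1..N}. a i * x powi fst (b i) * y powi snd (b i))"

definition quotient_topology :: "'a topology \<Rightarrow> ('a \<Rightarrow> 'b) \<Rightarrow> 'b topology" where
  "quotient_topology X f =
     topology (\<lambda>U. U \<subseteq> f ` topspace X \<and> openin X {x \<in> topspace X. f x \<in> U})"

definition proj_class :: "(nat \<Rightarrow> real) \<Rightarrow> (nat \<Rightarrow> real) set" where
  "proj_class x = {(\<lambda>i. t * x i) | t. t \<noteq> (0::real)}"

definition coord_space :: "nat \<Rightarrow> (nat \<Rightarrow> real) set" where
  "coord_space N = {x. \<forall>i. i \<notin> {1..N} \<longrightarrow> x i = 0}"

definition real_proj_space :: "nat \<Rightarrow> (nat \<Rightarrow> real) set topology" where
  "real_proj_space N =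
     quotient_topology (top_of_set (coord_space N - {\<lambda>i. 0})) proj_class"

definition monomial_map :: "(nat \<Rightarrow> int \<times> int) \<Rightarrow> nat \<Rightarrow> real \<times> real \<Rightarrow> (nat \<Rightarrow> real)" where
  "monomial_map b N z =
     (\<lambda>i. if i \<in> {1..N} then fst z powi fst (b i) * snd z powi snd (b i) else 0)"

definition real_torus :: "(real \<times> real) set" where
  "real_torus = {z. fst z \<noteq> 0 \<and> snd z \<noteq> 0}"

definition real_toric_surface :: "(nat \<Rightarrow> int \<times> int) \<Rightarrow> nat \<Rightarrow> (nat \<Rightarrow> real) set set" where
  "real_toric_surface b N =
     real_proj_space N closure_of (proj_class ` monomial_map b N ` real_torus)"

definition polygon_sides :: "(real \<times> real) set \<Rightarrow> (real \<times> real) set set" where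
  "polygon_sides P = {E. E face_of P \<and> aff_dim E = 1}"

text \<open>Axis of a side E: real part of the torus-invariant divisor of E, i.e. the points of
  R X_P whose homogeneous coordinates vanish outside the lattice points of E.\<close>
definition toric_axis ::
  "(nat \<Rightarrow> int \<times> int) \<Rightarrow> nat \<Rightarrow> (real \<times> real) set \<Rightarrow> (nat \<Rightarrow> real) set set" where
  "toric_axis b N E = {z \<in> real_toric_surface b N.
      \<forall>v\<in>z. \<forall>i\<in>{1..N}. lattice_pt (b i) \<notin> E \<longrightarrow> v i = 0}"

definition real_mirror_curve_closure ::
  "(nat \<Rightarrow> int \<times> int) \<Rightarrow> nat \<Rightarrow> (nat \<Rightarrow> real) \<Rightarrow> (nat \<Rightarrow> real) set set" where
  "real_mirror_curve_closure b N a =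
     real_proj_space N closure_of
       (proj_class ` monomial_map b N ` {z \<in> real_torus. mirror_poly b N a (fst z) (snd z) = 0})"

definition arc_in :: "'a topology \<Rightarrow> 'a set \<Rightarrow> bool" where
  "arc_in X A \<longleftrightarrow> (\<exists>g. pathin X g \<and> inj_on g {0..1} \<and> A = g ` {0..1})"

end

theory Submission
  imports Defs
begin

text \<open>At a boundary lattice point \<open>v\<close> of \<open>P\<close> there is a quadrant of the torus in which the term of \<open>v\<close>
  has the sign opposite to the terms of all its neighbours in the triangulation. Dividing the
  equation by the term of \<open>v\<close> gives \<open>1 - S + R = 0\<close>, where \<open>S\<close> is the sum of the neighbouring
  monomials and \<open>R\<close> collects the others, which are products of powers of neighbouring monomials
  with small coefficients. Hence \<open>R\<close> varies much less than \<open>S\<close> while \<open>S\<close> stays bounded, the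
  equation is strictly monotone in the direction normal to a side through \<open>v\<close>, and the curve is
  a graph over an interval. If \<open>v\<close> is a corner, the graph joins the two axes; if \<open>v\<close> is interior
  to a side, it joins the two roots next to \<open>v\<close> on one axis. Every point of the curve on an axis is
  one of these roots, and the roots are linked to each other along the connected boundary of \<open>P\<close>,
  so all these arcs lie in the one component that meets the axes.\<close>

section \<open>Unimodular triangulations and their boundary edges\<close>

text \<open>Smallness of \<open>q\<close> enters only through \<open>coeff_small\<close>. Evaluating
  each \<open>Hk k\<close> on the affine relation between \<open>b j\<close> and a triangle, by the
  expansion for {1, 2, 3} and by that for the triangle, shows that \<open>a j\<close>, in units
  making the coefficients of the triangle 1, is a monomial in \<open>q\<close> with nonnegative
  exponents, not all zero. The obstacle is that this bound lives in the coordinates of one triangle,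
  while \<open>X_P\<close> may be singular at a corner and a triangle contains only some of the
  neighbours of \<open>v\<close>. So every lattice point is placed in the cone of some triangle at
  \<open>v\<close>, where its monomial is a product of nonnegative powers of two neighbouring ones;
  this stays meaningful on the axes, where coordinates vanish. Absolute ratios of neighbouring terms
  on an axis are sought in [1/2, 2], which inversion preserves. Neighbouring terms are followed up
  to the sum 6: this exceeds 4, the most that two such ratios contribute, and 2, past which |R| <=
  S/2 forces 1 - S + R to be negative.\<close>

definition det2 :: "int \<times> int \<Rightarrow> int \<times> int \<Rightarrow> int" where
  "det2 d e = fst d * snd e - snd d * fst e"

text \<open>Cramer's rule: a determinant of absolute value 1 is its own inverse, so the coordinates
  are again integers.\<close>

lemma unimodular_coords:
  assumes "\<bar>det2 d e\<bar> = 1"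
  obtains \<alpha> \<beta> where "fst z = \<alpha> * fst d + \<beta> * fst e" "snd z = \<alpha> * snd d + \<beta> * snd e"
proof
  have D: "det2 d e * det2 d e = 1"
    using assms by (metis abs_mult_self_eq mult_1)
  have "det2 z e * fst d + det2 d z * fst e = det2 d e * fst z"
    "det2 z e * snd d + det2 d z * snd e = det2 d e * snd z"
    by (simp_all add: det2_def algebra_simps)
  then have "det2 d e * (det2 z e * fst d + det2 d z * fst e) = det2 d e * det2 d e * fst z"
    "det2 d e * (det2 z e * snd d + det2 d z * snd e) = det2 d e * det2 d e * snd z"
    by simp_all
  then show "fst z = (det2 d e * det2 z e) * fst d + (det2 d e * det2 d z) * fst e"
    "snd z = (det2 d e * det2 z e) * snd d + (det2 d e * det2 d z) * snd e"
    unfolding D by (simp_all add: algebra_simps)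
qed

lemma lattice_pt_inject [simp]: "lattice_pt z = lattice_pt z' \<longleftrightarrow> z = z'"
  by (simp add: lattice_pt_def prod_eq_iff)

locale lattice_triangulation =
  fixes P :: "(real \<times> real) set" and b :: "nat \<Rightarrow> int \<times> int" and N :: nat and T :: "nat set set"
  assumes poly: "convex_lattice_polygon P"
    and pts: "bij_betw b {1..N} {v. lattice_pt v \<in> P}"
    and tri: "unimodular_triangulation P b N T"
begin

abbreviation pt :: "nat \<Rightarrow> real \<times> real" where
  "pt i \<equiv> lattice_pt (b i)"

lemma b_eq_iff: "i \<in> {1..N} \<Longrightarrow> j \<in> {1..N} \<Longrightarrow> b i = b j \<longleftrightarrow> i = j"
  using inj_on_eq_iff[OF bij_betw_imp_inj_on[OF pts]] .

lemma pt_in: "i \<in> {1..N} \<Longrightarrow> pt i \<in> P"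
  using bij_betw_apply[OF pts] by simp

lemma polytope_P: "polytope P"
  using poly by (auto simp: convex_lattice_polygon_def polytope_def)

lemma convex_P: "convex P" and compact_P: "compact P" and polyhedron_P: "polyhedron P"
  using polytope_P by (auto simp: polytope_imp_convex polytope_imp_compact polytope_imp_polyhedron)

lemma aff_dim_P: "aff_dim P = 2"
  using poly aff_dim_nonempty_interior[of P] by (auto simp: convex_lattice_polygon_def)

lemma finite_T: "finite T"
  and Union_idx_hull: "(\<Union>\<sigma>\<in>T. idx_hull b \<sigma>) = P"
  and Union_T: "\<Union>T = {1..N}"
  using tri[unfolded unimodular_triangulation_def] by blast+

lemma triangle_props:
  "\<forall>\<sigma>\<in>T. \<sigma> \<subseteq> {1..N} \<and> (\<exists>i j k. \<sigma> = {i, j, k} \<and>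
     \<bar>(fst (b j) - fst (b i)) * (snd (b k) - snd (b i))
       - (fst (b k) - fst (b i)) * (snd (b j) - snd (b i))\<bar> = 1)"
  using tri[unfolded unimodular_triangulation_def] by (elim conjE)

lemma idx_hull_Int:
  "\<forall>\<sigma>\<in>T. \<forall>\<tau>\<in>T. idx_hull b \<sigma> \<inter> idx_hull b \<tau> = idx_hull b (\<sigma> \<inter> \<tau>)"
  using tri[unfolded unimodular_triangulation_def] by (elim conjE)

lemma vertex_in_triangle: "i \<in> {1..N} \<Longrightarrow> \<exists>\<sigma>\<in>T. i \<in> \<sigma>"
  using Union_T by blast

lemma triangle_subset: "\<sigma> \<in> T \<Longrightarrow> \<sigma> \<subseteq> {1..N}"
  using bspec[OF triangle_props] by (rule conjunct1)

text \<open>Any vertex can serve as the origin, since changing the base vertex changes the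
  determinant of a triangle at most by its sign. Later coordinates are always taken at a chosen
  vertex.\<close>

lemma triangleE:
  assumes "\<sigma> \<in> T" "v \<in> \<sigma>"
  obtains u w where "\<sigma> = {v, u, w}" "\<bar>det2 (b u - b v) (b w - b v)\<bar> = 1"
proof -
  obtain i j k where ijk: "\<sigma> = {i, j, k}"
    "\<bar>(fst (b j) - fst (b i)) * (snd (b k) - snd (b i))
       - (fst (b k) - fst (b i)) * (snd (b j) - snd (b i))\<bar> = 1"
    using bspec[OF triangle_props assms(1)]
    by (elim conjE exE)
  have d: "\<bar>det2 (b j - b i) (b k - b i)\<bar> = 1" "\<bar>det2 (b i - b j) (b k - b j)\<bar> = 1"
    "\<bar>det2 (b i - b k) (b j - b k)\<bar> = 1"
  proof -
    define D where "D = (fst (b j) - fst (b i)) * (snd (b k) - snd (b i))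
       - (fst (b k) - fst (b i)) * (snd (b j) - snd (b i))"
    have "det2 (b j - b i) (b k - b i) = D" "det2 (b i - b j) (b k - b j) = - D"
      "det2 (b i - b k) (b j - b k) = D"
      by (simp_all add: det2_def D_def algebra_simps)
    then show "\<bar>det2 (b j - b i) (b k - b i)\<bar> = 1" "\<bar>det2 (b i - b j) (b k - b j)\<bar> = 1"
      "\<bar>det2 (b i - b k) (b j - b k)\<bar> = 1"
      using ijk(2) by (simp_all flip: D_def)
  qed
  consider "v = i" | "v = j" | "v = k" using assms(2) ijk(1) by blast
  then show ?thesis
  proof cases
    case 1 then show ?thesis using that[of j k] d ijk by auto
  next
    case 2 then show ?thesis using that[of i k] d ijk by auto
  next
    case 3 then show ?thesis using that[of i j] d ijk by auto
  qed
qed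

lemma triangle_edgeE:
  assumes "\<sigma> \<in> T" "v \<in> \<sigma>" "u \<in> \<sigma>" "u \<noteq> v"
  obtains w where "\<sigma> = {v, u, w}" "\<bar>det2 (b u - b v) (b w - b v)\<bar> = 1"
proof -
  obtain u' w' where *: "\<sigma> = {v, u', w'}" "\<bar>det2 (b u' - b v) (b w' - b v)\<bar> = 1"
    using triangleE[OF assms(1,2)] .
  have sw: "det2 (b w' - b v) (b u' - b v) = - det2 (b u' - b v) (b w' - b v)"
    by (simp add: det2_def)
  from assms * have "u = u' \<or> u = w'" by auto
  then show ?thesis
    using that[of u'] that[of w'] * sw by (metis abs_minus_cancel insert_commute)
qed

lemma triangle_distinct:
  assumes "\<bar>det2 (b u - b v) (b w - b v)\<bar> = 1"
  shows "u \<noteq> v" "w \<noteq> v" "u \<noteq> w"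
proof -
  have [simp]: "det2 0 d = 0" "det2 d 0 = 0" "det2 d d = 0" for d
    by (simp_all add: det2_def mult.commute)
  have "u = v \<or> w = v \<or> u = w \<Longrightarrow> det2 (b u - b v) (b w - b v) = 0"
    by (elim disjE) simp_all
  then have "\<not> (u = v \<or> w = v \<or> u = w)"
    using assms by (metis abs_zero zero_neq_one)
  then show "u \<noteq> v" "w \<noteq> v" "u \<noteq> w" by blast+
qed

lemma triangle_independent:
  assumes "\<sigma> \<in> T"
  shows "\<not> affine_dependent (pt ` \<sigma>)"
proof -
  obtain i where i: "i \<in> \<sigma>"
    using bspec[OF triangle_props assms]
    by (elim conjE exE) auto
  obtain u w where *: "\<sigma> = {i, u, w}" "\<bar>det2 (b u - b i) (b w - b i)\<bar> = 1"
    using triangleE[OF assms i] .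
  have "\<not> collinear {pt u, pt i, pt w}"
  proof
    assume "collinear {pt u, pt i, pt w}"
    then have "collinear {0, pt u - pt i, pt w - pt i}"
      by (simp add: collinear_3[of "pt u"])
    then have "pt u - pt i = 0 \<or> pt w - pt i = 0 \<or> (\<exists>c. pt w - pt i = c *\<^sub>R (pt u - pt i))"
      unfolding collinear_lemma by blast
    moreover have "real_of_int (det2 (b u - b i) (b w - b i)) =
        fst (pt u - pt i) * snd (pt w - pt i) - snd (pt u - pt i) * fst (pt w - pt i)"
      by (simp add: det2_def lattice_pt_def)
    ultimately have "real_of_int (det2 (b u - b i) (b w - b i)) = 0"
      by (elim disjE exE) (simp_all only: fst_scaleR snd_scaleR real_scaleR_def fst_zero snd_zero, simp_all)
    with *(2) show False by simp
  qed
  then have "\<not> affine_dependent {pt u, pt i, pt w}"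
    unfolding collinear_3_eq_affine_dependent by blast
  then show ?thesis
    using *(1) by (simp add: insert_commute)
qed

lemma idx_hull_Int_sub:
  assumes "\<sigma> \<in> T" "I \<subseteq> \<sigma>" "J \<subseteq> \<sigma>"
  shows "idx_hull b I \<inter> idx_hull b J = idx_hull b (I \<inter> J)"
proof -
  have "\<not> affine_dependent (pt ` I \<union> pt ` J)"
    using triangle_independent[OF assms(1)] affine_dependent_subset[of "pt ` I \<union> pt ` J" "pt ` \<sigma>"] assms
    by blast
  then have "convex hull (pt ` I \<inter> pt ` J) = convex hull (pt ` I) \<inter> convex hull (pt ` J)"
    by (rule convex_hull_Int)
  moreover have "inj_on pt \<sigma>"
    using triangle_subset[OF assms(1)] b_eq_iff unfolding inj_on_def lattice_pt_inject by blast
  then have "pt ` I \<inter> pt ` J = pt ` (I \<inter> J)"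
    using assms by (metis inj_on_image_Int)
  ultimately show ?thesis
    by (simp add: idx_hull_def image_image)
qed

text \<open>The triangulation is face-to-face by an assumption on whole triangles. Two faces are
  reduced to this by intersecting each with the common face of the two triangles, inside a single
  simplex, where affine independence makes convex hulls commute with intersections.\<close>

lemma idx_hull_Int_faces:
  assumes "\<sigma> \<in> T" "I \<subseteq> \<sigma>" "\<tau> \<in> T" "J \<subseteq> \<tau>"
  shows "idx_hull b I \<inter> idx_hull b J = idx_hull b (I \<inter> J)"
proof
  have mono: "\<And>A B. A \<subseteq> B \<Longrightarrow> idx_hull b A \<subseteq> idx_hull b B"
    unfolding idx_hull_def by (intro hull_mono) auto
  show "idx_hull b (I \<inter> J) \<subseteq> idx_hull b I \<inter> idx_hull b J"
    using mono by simp
  have "idx_hull b I \<inter> idx_hull b J \<subseteq> idx_hull b (\<sigma> \<inter> \<tau>)"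
    using mono[OF assms(2)] mono[OF assms(4)] idx_hull_Int assms(1,3) by blast
  then have "idx_hull b I \<inter> idx_hull b J \<subseteq> (idx_hull b I \<inter> idx_hull b (\<sigma> \<inter> \<tau>)) \<inter> idx_hull b J"
    by blast
  also have "idx_hull b I \<inter> idx_hull b (\<sigma> \<inter> \<tau>) = idx_hull b (I \<inter> (\<sigma> \<inter> \<tau>))"
    by (rule idx_hull_Int_sub[OF assms(1,2)]) auto
  also have "idx_hull b (I \<inter> (\<sigma> \<inter> \<tau>)) \<inter> idx_hull b J = idx_hull b (I \<inter> (\<sigma> \<inter> \<tau>) \<inter> J)"
    by (rule idx_hull_Int_sub[OF assms(3)]) (use assms in auto)
  also have "\<dots> \<subseteq> idx_hull b (I \<inter> J)"
    by (rule mono) auto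
  finally show "idx_hull b I \<inter> idx_hull b J \<subseteq> idx_hull b (I \<inter> J)" .
qed

text \<open>The point \<open>v\<close> is itself a face of some triangle, so its intersection with
  another face is spanned by \<open>{v}\<close> or by nothing.\<close>

lemma vertex_in_hull:
  assumes "v \<in> {1..N}" "\<sigma> \<in> T" "I \<subseteq> \<sigma>" "pt v \<in> idx_hull b I"
  shows "v \<in> I"
proof -
  obtain \<tau> where \<tau>: "\<tau> \<in> T" "v \<in> \<tau>" using vertex_in_triangle assms(1) by blast
  have "pt v \<in> idx_hull b {v}" by (simp add: idx_hull_def)
  then have "pt v \<in> idx_hull b (I \<inter> {v})"
    using idx_hull_Int_faces[OF assms(2,3) \<tau>(1), of "{v}"] \<tau> assms(4) by auto
  then show ?thesis by (cases "v \<in> I") (auto simp: idx_hull_def)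
qed

text \<open>Points of the segment from \<open>b v\<close> to \<open>b j\<close> close to \<open>b v\<close> lie in one triangle, which then has
  \<open>v\<close> as a vertex.\<close>

lemma cone_coords:
  assumes v: "v \<in> {1..N}" and j: "j \<in> {1..N}"
  obtains u w \<alpha> \<beta> where "{v, u, w} \<in> T" "\<bar>det2 (b u - b v) (b w - b v)\<bar> = 1"
    "b j - b v = (int \<alpha> * fst (b u - b v) + int \<beta> * fst (b w - b v),
                  int \<alpha> * snd (b u - b v) + int \<beta> * snd (b w - b v))"
proof -
  define x where "x n = pt v + (1 / real (Suc n)) *\<^sub>R (pt j - pt v)" for n
  have xP: "x n \<in> P" for n
  proof -
    have "x n = (1 - 1 / real (Suc n)) *\<^sub>R pt v + (1 / real (Suc n)) *\<^sub>R pt j"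
      by (simp add: x_def algebra_simps)
    then show ?thesis
      using convexD[OF convex_P pt_in[OF v] pt_in[OF j], of "1 - 1 / real (Suc n)" "1 / real (Suc n)"]
      by simp
  qed
  then have "\<forall>n. \<exists>\<sigma>\<in>T. x n \<in> idx_hull b \<sigma>"
    using Union_idx_hull by blast
  then obtain f where f: "\<And>n. f n \<in> T" "\<And>n. x n \<in> idx_hull b (f n)" by metis
  have "finite (range f)" using f(1) finite_T by (meson finite_subset image_subset_iff)
  then obtain n0 where inf: "infinite {n. f n = f n0}"
    using pigeonhole_infinite[of UNIV f] by auto
  define \<sigma> where "\<sigma> = f n0"
  have xlim: "x \<longlonglongrightarrow> pt v"
  proof -
    have "(\<lambda>n. pt v + (1 / real (Suc n)) *\<^sub>R (pt j - pt v)) \<longlonglongrightarrow> pt v + 0 *\<^sub>R (pt j - pt v)"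
      using LIMSEQ_inverse_real_of_nat by (intro tendsto_intros) (simp add: inverse_eq_divide)
    then show ?thesis unfolding x_def[abs_def] by simp
  qed
  have fin: "finite \<sigma>" using triangle_subset[of \<sigma>] f(1) finite_subset \<sigma>_def by blast
  have cl: "closed (idx_hull b \<sigma>)"
    unfolding idx_hull_def using fin
    by (simp add: compact_imp_closed finite_imp_compact_convex_hull)
  obtain r :: "nat \<Rightarrow> nat" where r: "strict_mono r" "\<And>n. f (r n) = \<sigma>"
    using infinite_enumerate[OF inf] \<sigma>_def by auto
  have "(x \<circ> r) \<longlonglongrightarrow> pt v" using xlim r(1) LIMSEQ_subseq_LIMSEQ by blast
  then have "pt v \<in> idx_hull b \<sigma>"
    using closed_sequentially[OF cl] f(2) r(2) by (metis comp_apply)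
  then have vs: "v \<in> \<sigma>"
    using vertex_in_hull[OF v, of \<sigma> \<sigma>] f(1) \<sigma>_def by blast
  then obtain u w where uw: "\<sigma> = {v, u, w}" "\<bar>det2 (b u - b v) (b w - b v)\<bar> = 1"
    using triangleE f(1) \<sigma>_def by metis
  obtain \<alpha> \<beta> where ab: "fst (b j - b v) = \<alpha> * fst (b u - b v) + \<beta> * fst (b w - b v)"
    "snd (b j - b v) = \<alpha> * snd (b u - b v) + \<beta> * snd (b w - b v)"
    using unimodular_coords[OF uw(2)] by metis
  have "x n0 \<in> convex hull {pt v, pt u, pt w}"
    using f(2)[of n0] uw(1) by (simp add: \<sigma>_def idx_hull_def)
  then obtain s t where st: "s \<ge> 0" "t \<ge> 0" "x n0 = pt v + s *\<^sub>R (pt u - pt v) + t *\<^sub>R (pt w - pt v)"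
    unfolding convex_hull_3_alt by auto
  define m where "m = real (Suc n0)"
  have m: "m > 0" by (simp add: m_def)
  from st(3) have "pt j - pt v = (m * s) *\<^sub>R (pt u - pt v) + (m * t) *\<^sub>R (pt w - pt v)"
  proof -
    have "(1 / m) *\<^sub>R (pt j - pt v) = s *\<^sub>R (pt u - pt v) + t *\<^sub>R (pt w - pt v)"
      using st(3) unfolding x_def m_def by (simp add: algebra_simps)
    then have "m *\<^sub>R ((1 / m) *\<^sub>R (pt j - pt v)) = m *\<^sub>R (s *\<^sub>R (pt u - pt v) + t *\<^sub>R (pt w - pt v))"
      by simp
    then show ?thesis using m by (simp add: scaleR_add_right)
  qed
  then have eq: "real_of_int (fst (b j - b v)) = m * s * fst (b u - b v) + m * t * fst (b w - b v)"
    "real_of_int (snd (b j - b v)) = m * s * snd (b u - b v) + m * t * snd (b w - b v)"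
    by (auto simp: lattice_pt_def prod_eq_iff)
  \<comment> \<open>Two expansions of \<open>b j - b v\<close> in the same basis: integer
    coefficients from unimodularity, nonnegative real ones from the convex hull. The nonzero
    determinant identifies them.\<close>
  let ?D = "real_of_int (det2 (b u - b v) (b w - b v))"
  have e1: "(real_of_int \<alpha> - m * s) * fst (b u - b v) + (real_of_int \<beta> - m * t) * fst (b w - b v) = 0"
    "(real_of_int \<alpha> - m * s) * snd (b u - b v) + (real_of_int \<beta> - m * t) * snd (b w - b v) = 0"
    using eq unfolding ab of_int_add of_int_mult left_diff_distrib by linarith+
  have "(real_of_int \<alpha> - m * s) * ?D =
      ((real_of_int \<alpha> - m * s) * fst (b u - b v) + (real_of_int \<beta> - m * t) * fst (b w - b v)) * snd (b w - b v)
    - ((real_of_int \<alpha> - m * s) * snd (b u - b v) + (real_of_int \<beta> - m * t) * snd (b w - b v)) * fst (b w - b v)"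
    by (simp add: det2_def algebra_simps)
  then have A: "(real_of_int \<alpha> - m * s) * ?D = 0" unfolding e1 by simp
  have "(real_of_int \<beta> - m * t) * ?D =
      ((real_of_int \<alpha> - m * s) * snd (b u - b v) + (real_of_int \<beta> - m * t) * snd (b w - b v)) * fst (b u - b v)
    - ((real_of_int \<alpha> - m * s) * fst (b u - b v) + (real_of_int \<beta> - m * t) * fst (b w - b v)) * snd (b u - b v)"
    by (simp add: det2_def algebra_simps)
  then have B: "(real_of_int \<beta> - m * t) * ?D = 0" unfolding e1 by simp
  have "?D \<noteq> 0" using uw(2) by auto
  then have "real_of_int \<alpha> = m * s" "real_of_int \<beta> = m * t" using A B by auto
  then have "\<alpha> \<ge> 0" "\<beta> \<ge> 0"
    using m st by (smt (verit) mult_nonneg_nonneg of_int_0_le_iff)+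
  then show ?thesis
    using that[of u w "nat \<alpha>" "nat \<beta>"] uw f(1)[of n0] ab by (simp add: \<sigma>_def prod_eq_iff)
qed

section \<open>Sides of the polygon and the boundary edges that subdivide them\<close>

lemma side_functional:
  assumes "E \<in> polygon_sides P"
  obtains a c where "a \<noteq> 0" "\<And>x. x \<in> P \<Longrightarrow> a \<bullet> x \<le> c" "E = {x \<in> P. a \<bullet> x = c}"
proof -
  have E: "E face_of P" "aff_dim E = 1" using assms by (simp_all add: polygon_sides_def)
  then have "E exposed_face_of P"
    using exposed_face_of_polyhedron[OF polyhedron_P] by blast
  then obtain a c where ac: "P \<subseteq> {x. a \<bullet> x \<le> c}" "E = P \<inter> {x. a \<bullet> x = c}"
    unfolding exposed_face_of_def by blast
  have "a \<noteq> 0"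
  proof
    assume "a = 0"
    then have "E = P \<or> E = {}" using ac(2) by auto
    then show False using E(2) aff_dim_P by auto
  qed
  then show ?thesis using that[of a c] ac by blast
qed

text \<open>A supporting functional of the side vanishes on \<open>y - x\<close>, so in the plane it
  is a multiple of the determinant against \<open>y - x\<close>. The resulting description of
  \<open>E\<close> mentions only \<open>x\<close> and \<open>y\<close>, which is why two common
  points determine a side.\<close>

lemma side_line:
  assumes "E \<in> polygon_sides P" "x \<in> E" "y \<in> E" "x \<noteq> y"
  obtains l where "l \<noteq> 0"
    "\<And>z. z \<in> P \<Longrightarrow> l * (fst (y - x) * snd (z - x) - snd (y - x) * fst (z - x)) \<ge> 0"
    "E = {z \<in> P. fst (y - x) * snd (z - x) - snd (y - x) * fst (z - x) = 0}"
proof -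
  obtain a c where a: "a \<noteq> 0" "\<And>x. x \<in> P \<Longrightarrow> a \<bullet> x \<le> c" "E = {x \<in> P. a \<bullet> x = c}"
    using side_functional[OF assms(1)] by metis
  obtain d1 d2 where d: "y - x = (d1, d2)" by fastforce
  obtain a1 a2 where a12: "a = (a1, a2)" by fastforce
  have "a \<bullet> (y - x) = 0" using assms a(3) by (simp add: inner_diff_right)
  then have ad: "a1 * d1 + a2 * d2 = 0" by (simp add: d a12)
  have nz: "d1\<^sup>2 + d2\<^sup>2 \<noteq> 0" using d assms(4) by (auto simp: sum_power2_eq_zero_iff simp flip: zero_prod_def)
  define l where "l = (a2 * d1 - a1 * d2) / (d1\<^sup>2 + d2\<^sup>2)"
  have "a1 * (d1\<^sup>2 + d2\<^sup>2) = - ((a2 * d1 - a1 * d2) * d2) + d1 * (a1 * d1 + a2 * d2)"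
    by (simp add: power2_eq_square algebra_simps)
  then have l1: "a1 = - l * d2" using ad nz by (simp add: l_def field_simps)
  have "a2 * (d1\<^sup>2 + d2\<^sup>2) = ((a2 * d1 - a1 * d2) * d1) + d2 * (a1 * d1 + a2 * d2)"
    by (simp add: power2_eq_square algebra_simps)
  then have l2: "a2 = l * d1" using ad nz by (simp add: l_def field_simps)
  have l0: "l \<noteq> 0" using l1 l2 a12 a(1) by (auto simp: zero_prod_def)
  have val: "a \<bullet> z - c = l * (fst (y - x) * snd (z - x) - snd (y - x) * fst (z - x))" for z
  proof -
    have "a \<bullet> z - c = a \<bullet> (z - x)" using assms(2) a(3) by (simp add: inner_diff_right)
    also have "\<dots> = a1 * fst (z - x) + a2 * snd (z - x)"
      by (simp add: a12 inner_prod_def)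
    also have "\<dots> = l * (d1 * snd (z - x) - d2 * fst (z - x))"
      unfolding l1 l2 by (simp add: algebra_simps)
    finally show ?thesis unfolding d by simp
  qed
  \<comment> \<open>The functional is maximal on \<open>E\<close>, while the claim describes
    \<open>E\<close> by a minimum; hence the change of sign.\<close>
  show ?thesis
  proof (rule that[of "- l"])
    show "- l \<noteq> 0" using l0 by simp
    show "- l * (fst (y - x) * snd (z - x) - snd (y - x) * fst (z - x)) \<ge> 0" if "z \<in> P" for z
      using val[of z] a(2)[OF that] by simp
    show "E = {z \<in> P. fst (y - x) * snd (z - x) - snd (y - x) * fst (z - x) = 0}"
      unfolding a(3) using val l0 by (metis (no_types, lifting) eq_iff_diff_eq_0 mult_eq_0_iff)
  qed
qed

lemma side_unique:
  assumes "E \<in> polygon_sides P" "F \<in> polygon_sides P" "x \<in> E" "y \<in> E" "x \<in> F" "y \<in> F" "x \<noteq> y"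
  shows "E = F"
proof -
  have "E = {z \<in> P. fst (y - x) * snd (z - x) - snd (y - x) * fst (z - x) = 0}"
    by (rule side_line[OF assms(1,3,4,7)])
  moreover have "F = {z \<in> P. fst (y - x) * snd (z - x) - snd (y - x) * fst (z - x) = 0}"
    by (rule side_line[OF assms(2,5,6,7)])
  ultimately show ?thesis by (rule trans[OF _ sym])
qed

lemma side_subset: "E \<in> polygon_sides P \<Longrightarrow> E \<subseteq> P"
  by (simp add: polygon_sides_def face_of_imp_subset)

text \<open>An oriented edge of the subdivision that the triangulation induces on the side
  \<open>E\<close>. The orientation is kept because \<open>v\<close> acts as origin and
  \<open>u\<close> as direction along the side.\<close>

definition bedge :: "(real \<times> real) set \<Rightarrow> nat \<Rightarrow> nat \<Rightarrow> bool" where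
  "bedge E v u \<longleftrightarrow> E \<in> polygon_sides P \<and> v \<noteq> u \<and> pt v \<in> E \<and> pt u \<in> E \<and> (\<exists>\<sigma>\<in>T. v \<in> \<sigma> \<and> u \<in> \<sigma>)"

lemma bedge_sym: "bedge E v u \<Longrightarrow> bedge E u v"
  by (auto simp: bedge_def)

lemma bedge_side: "bedge E v u \<Longrightarrow> E \<in> polygon_sides P"
  by (simp add: bedge_def)

lemma bedge_range: "bedge E v u \<Longrightarrow> v \<in> {1..N} \<and> u \<in> {1..N}"
  unfolding bedge_def using triangle_subset by blast

lemma bedge_triangle:
  assumes "bedge E v u"
  obtains w where "{v, u, w} \<in> T" "\<bar>det2 (b u - b v) (b w - b v)\<bar> = 1"
  using assms triangle_edgeE unfolding bedge_def by metis

text \<open>Up to the sign \<open>e\<close>, the determinant against the edge vector is the integral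
  inward height above the side.\<close>

lemma bedge_normal:
  assumes "bedge E v u"
  obtains e where "e = 1 \<or> e = -1"
    "\<And>i. i \<in> {1..N} \<Longrightarrow> e * det2 (b u - b v) (b i - b v) \<ge> 0"
    "\<And>i. i \<in> {1..N} \<Longrightarrow> e * det2 (b u - b v) (b i - b v) = 0 \<longleftrightarrow> pt i \<in> E"
proof -
  have E: "E \<in> polygon_sides P" "pt v \<in> E" "pt u \<in> E" and vu: "v \<noteq> u"
    using assms by (simp_all add: bedge_def)
  have ne: "pt v \<noteq> pt u" using bedge_range[OF assms] b_eq_iff vu by (metis lattice_pt_inject)
  obtain l where l: "l \<noteq> 0"
    "\<And>z. z \<in> P \<Longrightarrow> l * (fst (pt u - pt v) * snd (z - pt v) - snd (pt u - pt v) * fst (z - pt v)) \<ge> 0"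
    "E = {z \<in> P. fst (pt u - pt v) * snd (z - pt v) - snd (pt u - pt v) * fst (z - pt v) = 0}"
    by (rule side_line[OF E ne]) blast
  have det: "fst (pt u - pt v) * snd (pt i - pt v) - snd (pt u - pt v) * fst (pt i - pt v)
      = real_of_int (det2 (b u - b v) (b i - b v))" for i
    by (simp add: det2_def lattice_pt_def)
  define e :: int where "e = (if l > 0 then 1 else -1)"
  show ?thesis
  proof (rule that[of e])
    show e: "e = 1 \<or> e = -1" by (simp add: e_def)
    fix i assume i: "i \<in> {1..N}"
    have "l * real_of_int (det2 (b u - b v) (b i - b v)) \<ge> 0"
      using l(2)[OF pt_in[OF i]] det by simp
    then show "e * det2 (b u - b v) (b i - b v) \<ge> 0"
      using l(1) by (auto simp: e_def zero_le_mult_iff)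
    have "pt i \<in> E \<longleftrightarrow> real_of_int (det2 (b u - b v) (b i - b v)) = 0"
      unfolding l(3) by (simp only: mem_Collect_eq det pt_in[OF i] simp_thms)
    then show "e * det2 (b u - b v) (b i - b v) = 0 \<longleftrightarrow> pt i \<in> E"
      using e by auto
  qed
qed

lemma bedge_third_notin:
  assumes "bedge E v u" "{v, u, w} \<in> T" "\<bar>det2 (b u - b v) (b w - b v)\<bar> = 1"
  shows "pt w \<notin> E"
proof -
  obtain e where e: "e = 1 \<or> e = -1"
    "\<And>i. i \<in> {1..N} \<Longrightarrow> e * det2 (b u - b v) (b i - b v) = 0 \<longleftrightarrow> pt i \<in> E"
    using bedge_normal[OF assms(1)] by metis
  have "w \<in> {1..N}" using triangle_subset[OF assms(2)] by simp
  then show ?thesis using e assms(3) by (metis abs_zero mult_eq_0_iff zero_neq_one zero_neq_neg_one)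
qed

lemma bedge_collinear:
  assumes "bedge E v u" "i \<in> {1..N}" "pt i \<in> E"
  obtains \<alpha> where "b i - b v = (\<alpha> * fst (b u - b v), \<alpha> * snd (b u - b v))"
proof -
  obtain e where e: "e = 1 \<or> e = -1"
    "\<And>i. i \<in> {1..N} \<Longrightarrow> e * det2 (b u - b v) (b i - b v) = 0 \<longleftrightarrow> pt i \<in> E"
    using bedge_normal[OF assms(1)] by metis
  obtain w where w: "{v, u, w} \<in> T" "\<bar>det2 (b u - b v) (b w - b v)\<bar> = 1"
    using bedge_triangle[OF assms(1)] .
  obtain \<alpha> \<beta> where ab: "fst (b i - b v) = \<alpha> * fst (b u - b v) + \<beta> * fst (b w - b v)"
    "snd (b i - b v) = \<alpha> * snd (b u - b v) + \<beta> * snd (b w - b v)"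
    using unimodular_coords[OF w(2)] by metis
  have "det2 (b u - b v) (b i - b v) = \<beta> * det2 (b u - b v) (b w - b v)"
    unfolding det2_def ab by (simp only: algebra_simps)
  moreover have "det2 (b u - b v) (b i - b v) = 0"
    using e assms(2,3) by (metis mult_eq_0_iff zero_neq_one zero_neq_neg_one)
  ultimately have "\<beta> = 0" using w(2) by (metis abs_zero mult_eq_0_iff zero_neq_one)
  then show ?thesis using that[of \<alpha>] ab by (simp add: prod_eq_iff)
qed

text \<open>Both edge vectors lie on one line and belong to triangles of determinant +-1, so the
  factor between them is +-1; the factor 1 would identify two lattice points. Hence a boundary point
  has at most two neighbours on a side.\<close>

lemma bedge_opposite:
  assumes "bedge E v u" "bedge E v u'" "u \<noteq> u'"
  shows "b u' - b v = - (b u - b v)"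
proof -
  have r: "u \<in> {1..N}" "u' \<in> {1..N}" "v \<in> {1..N}" "pt u \<in> E" "pt u' \<in> E"
    using bedge_range assms by (auto simp: bedge_def)
  obtain \<alpha> where \<alpha>: "b u' - b v = (\<alpha> * fst (b u - b v), \<alpha> * snd (b u - b v))"
    using bedge_collinear[OF assms(1) r(2,5)] .
  obtain w where w: "\<bar>det2 (b u' - b v) (b w - b v)\<bar> = 1"
    using bedge_triangle[OF assms(2)] .
  have "det2 (b u' - b v) (b w - b v) = \<alpha> * det2 (b u - b v) (b w - b v)"
    unfolding \<alpha> det2_def by (simp add: algebra_simps)
  then have "\<bar>\<alpha>\<bar> = 1" using w by (metis abs_zmult_eq_1)
  moreover have "\<alpha> \<noteq> 1"
  proof
    assume "\<alpha> = 1"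
    then have "b u' = b u" using \<alpha> by (simp add: prod_eq_iff)
    then show False using b_eq_iff r assms(3) by metis
  qed
  ultimately have "\<alpha> = -1" by linarith
  then show ?thesis using \<alpha> by (simp add: prod_eq_iff)
qed

lemma idx_hull_edge_subset: "bedge E v u \<Longrightarrow> idx_hull b {v, u} \<subseteq> E"
  unfolding idx_hull_def bedge_def polygon_sides_def
  by (intro hull_minimal) (auto dest: face_of_imp_convex)

text \<open>A side meets a triangle in a face of that triangle, and not in all of it, because the
  third vertex of a boundary edge lies off the side. So a point of the side lies on a boundary edge
  or is one of finitely many lattice points. The edges form a closed set and the side has no
  isolated points, which excludes exceptions.\<close>

lemma side_covered:
  assumes E: "E \<in> polygon_sides P"
  shows "E = \<Union>{idx_hull b {v, u} |v u. bedge E v u}" (is "E = ?C")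
proof
  show "?C \<subseteq> E" using idx_hull_edge_subset by blast
  have fin: "finite {idx_hull b {v, u} |v u. bedge E v u}"
    by (rule finite_subset[of _ "(\<lambda>(v, u). idx_hull b {v, u}) ` ({1..N} \<times> {1..N})"])
       (use bedge_range in force, simp)
  have cl: "closed ?C"
    using fin by (intro closed_Union) (auto simp: idx_hull_def compact_imp_closed finite_imp_compact_convex_hull)
  obtain a c where a: "a \<noteq> 0" "E = {x \<in> P. a \<bullet> x = c}"
    using side_functional[OF E] by metis
  have step: "x \<in> ?C \<or> x \<in> pt ` {1..N}" if x: "x \<in> E" for x
  proof -
    have "x \<in> P" using x side_subset[OF E] by blast
    then obtain \<sigma> where \<sigma>: "\<sigma> \<in> T" "x \<in> idx_hull b \<sigma>" using Union_idx_hull by blast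
    have sub: "idx_hull b \<sigma> \<subseteq> P" using Union_idx_hull \<sigma>(1) by blast
    have fs: "finite \<sigma>" using triangle_subset[OF \<sigma>(1)] finite_subset by blast
    have "(E \<inter> idx_hull b \<sigma>) face_of (P \<inter> idx_hull b \<sigma>)"
      using E by (intro face_of_slice) (auto simp: polygon_sides_def idx_hull_def)
    then have "(E \<inter> idx_hull b \<sigma>) face_of (convex hull (pt ` \<sigma>))"
      using sub by (simp add: idx_hull_def image_image inf_absorb2)
    then obtain S where S: "S \<subseteq> pt ` \<sigma>" "E \<inter> idx_hull b \<sigma> = convex hull S"
      using face_of_convex_hull_subset[of "pt ` \<sigma>"] fs by (metis finite_imageI finite_imp_compact)
    then obtain I where I: "I \<subseteq> \<sigma>" "S = pt ` I" by (meson subset_imageE)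
    have IE: "pt i \<in> E" if "i \<in> I" for i
      using S I that hull_subset[of S convex] by blast
    have xI: "x \<in> idx_hull b I" using S I x \<sigma> by (auto simp: idx_hull_def image_image)
    then have "I \<noteq> {}" by (auto simp: idx_hull_def)
    then obtain v where v: "v \<in> I" by blast
    then obtain u w where uw: "\<sigma> = {v, u, w}" "\<bar>det2 (b u - b v) (b w - b v)\<bar> = 1"
      using triangleE[OF \<sigma>(1)] I(1) by blast
    note dist = triangle_distinct[OF uw(2)]
    have be: "bedge E v i" if "i \<in> I" "i \<noteq> v" for i
      using E IE v that \<sigma>(1) I(1) unfolding bedge_def by blast
    have not3: "\<not> (u \<in> I \<and> w \<in> I)"
      using be[of u] bedge_third_notin[of E v u w] IE[of w] uw \<sigma>(1) dist by blast
    consider "I = {v}" | "I = {v, u}" | "I = {v, w}" using not3 I(1) uw(1) v by blast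
    then show ?thesis
    proof cases
      case 1 then show ?thesis using xI triangle_subset[OF \<sigma>(1)] uw(1) by (auto simp: idx_hull_def)
    next
      case 2 then show ?thesis using xI be[of u] dist by blast
    next
      case 3 then show ?thesis using xI be[of w] dist by blast
    qed
  qed
  show "E \<subseteq> ?C"
  proof
    fix x assume x: "x \<in> E"
    show "x \<in> ?C"
    proof (rule ccontr)
      assume nx: "x \<notin> ?C"
      have "connected E" "aff_dim E \<noteq> 0"
        using E by (auto simp: polygon_sides_def face_of_imp_convex convex_connected)
      then have "x islimpt E" using connected_imp_perfect_aff_dim x by blast
      then have "x islimpt (?C \<union> pt ` {1..N})"
        using step by (meson Un_iff islimpt_subset subsetI)
      then have "x islimpt ?C" by (simp add: islimpt_Un islimpt_finite)
      then show False using cl nx by (meson closed_limpt)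
    qed
  qed
qed

lemma bedge_common_vertex:
  assumes "bedge E v u" "bedge F v' u'" "x \<in> idx_hull b {v, u}" "x \<in> idx_hull b {v', u'}"
  obtains i where "i \<in> {v, u}" "i \<in> {v', u'}"
proof -
  obtain \<sigma> \<tau> where "\<sigma> \<in> T" "{v, u} \<subseteq> \<sigma>" "\<tau> \<in> T" "{v', u'} \<subseteq> \<tau>"
    using assms(1,2) unfolding bedge_def by (metis empty_subsetI insert_subset)
  then have "x \<in> idx_hull b ({v, u} \<inter> {v', u'})"
    using idx_hull_Int_faces[of \<sigma> "{v, u}" \<tau> "{v', u'}"] assms by blast
  then have "{v, u} \<inter> {v', u'} \<noteq> {}" by (metis convex_hull_empty empty_iff idx_hull_def image_empty)
  then show ?thesis using that by blast
qed

lemma bedge_at_vertex: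
  assumes "E \<in> polygon_sides P" "v \<in> {1..N}" "pt v \<in> E"
  obtains u where "bedge E v u"
proof -
  obtain v' u where *: "bedge E v' u" "pt v \<in> idx_hull b {v', u}"
    using side_covered[OF assms(1)] assms(3) by blast
  then obtain \<sigma> where "\<sigma> \<in> T" "{v', u} \<subseteq> \<sigma>" unfolding bedge_def by auto
  then have "v \<in> {v', u}" using vertex_in_hull[OF assms(2)] * by blast
  then show ?thesis using that bedge_sym *(1) by blast
qed

text \<open>A common point of two sides is covered by a boundary edge of each, and edges that meet
  share a vertex of the triangulation.\<close>

lemma sides_common_vertex:
  assumes "E \<in> polygon_sides P" "F \<in> polygon_sides P" "E \<noteq> F" "E \<inter> F \<noteq> {}"
  obtains v u u' where "bedge E v u" "bedge F v u'"
proof -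
  obtain x where x: "x \<in> E" "x \<in> F" using assms(4) by blast
  obtain v u where vu: "bedge E v u" "x \<in> idx_hull b {v, u}"
    using side_covered[OF assms(1)] x(1) by blast
  obtain v' u' where vu': "bedge F v' u'" "x \<in> idx_hull b {v', u'}"
    using side_covered[OF assms(2)] x(2) by blast
  obtain i where "i \<in> {v, u}" "i \<in> {v', u'}" using bedge_common_vertex[OF vu(1) vu'(1) vu(2) vu'(2)] .
  then show ?thesis using that[of i] vu(1) vu'(1) bedge_sym by blast
qed

text \<open>Induction along the boundary without a cyclic enumeration of its edges. The relative
  boundary of \<open>P\<close> is connected, and the edges with \<open>Q\<close> and those without
  form two closed sets covering it. A common point of the two would yield a common vertex, where
  \<open>sym\<close> and \<open>step\<close> transfer \<open>Q\<close>.\<close>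

lemma bedge_induct:
  assumes start: "bedge E0 v0 u0" "Q E0 v0 u0"
    and sym: "\<And>E v u. bedge E v u \<Longrightarrow> Q E v u \<Longrightarrow> Q E u v"
    and step: "\<And>E v u F u'. bedge E v u \<Longrightarrow> bedge F v u' \<Longrightarrow> Q E v u \<Longrightarrow> Q F v u'"
    and goal: "bedge F v u"
  shows "Q F v u"
proof (rule ccontr)
  assume nq: "\<not> Q F v u"
  \<comment> \<open>\<open>R\<close> is the identity or \<open>Not\<close>, so that one definition
    gives both closed sets.\<close>
  define A where "A R = \<Union>{idx_hull b {v, u} |v u. \<exists>E. bedge E v u \<and> R (Q E v u)}" for R :: "bool \<Rightarrow> bool"
  have cl: "closed (A R)" for R
  proof -
    have "finite {idx_hull b {v, u} |v u. \<exists>E. bedge E v u \<and> R (Q E v u)}"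
      by (rule finite_subset[of _ "(\<lambda>(v, u). idx_hull b {v, u}) ` ({1..N} \<times> {1..N})"])
         (auto dest!: bedge_range)
    then show ?thesis unfolding A_def
      by (intro closed_Union) (auto simp: idx_hull_def compact_imp_closed finite_imp_compact_convex_hull)
  qed
  have rf: "rel_frontier P = \<Union>(polygon_sides P)"
    unfolding rel_frontier_of_polyhedron[OF polyhedron_P] facet_of_def aff_dim_P polygon_sides_def
    by (intro arg_cong[where f = Union] Collect_cong) auto
  have "\<Union>(polygon_sides P) = A (\<lambda>q. q) \<union> A Not"
  proof
    show "\<Union>(polygon_sides P) \<subseteq> A (\<lambda>q. q) \<union> A Not"
    proof
      fix x assume "x \<in> \<Union>(polygon_sides P)"
      then obtain E where "E \<in> polygon_sides P" "x \<in> E" by blast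
      then obtain v u where "bedge E v u" "x \<in> idx_hull b {v, u}"
        using side_covered by blast
      then show "x \<in> A (\<lambda>q. q) \<union> A Not" unfolding A_def by blast
    qed
    show "A (\<lambda>q. q) \<union> A Not \<subseteq> \<Union>(polygon_sides P)"
      unfolding A_def using idx_hull_edge_subset bedge_side by blast
  qed
  moreover have "connected (rel_frontier P)"
    using connected_sphere_gen[OF convex_P compact_imp_bounded[OF compact_P]] aff_dim_P by simp
  moreover have "A (\<lambda>q. q) \<inter> A Not = {}"
  proof (rule ccontr)
    assume "A (\<lambda>q. q) \<inter> A Not \<noteq> {}"
    then obtain x v u E v' u' F where *: "bedge E v u" "Q E v u" "x \<in> idx_hull b {v, u}"
      "bedge F v' u'" "\<not> Q F v' u'" "x \<in> idx_hull b {v', u'}"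
      unfolding A_def by blast
    obtain i where i: "i \<in> {v, u}" "i \<in> {v', u'}"
      using bedge_common_vertex[OF *(1,4,3,6)] .
    obtain j where j: "bedge E i j" "Q E i j" using i(1) *(1,2) sym bedge_sym by blast
    obtain k where k: "bedge F i k" "\<not> Q F i k" using i(2) *(4,5) sym bedge_sym by blast
    show False using step[OF j(1) k(1) j(2)] k(2) by blast
  qed
  moreover have "A (\<lambda>q. q) \<noteq> {}" "A Not \<noteq> {}"
  proof -
    have ne: "pt i \<in> idx_hull b {i, j}" for i j by (simp add: idx_hull_def hull_inc)
    show "A (\<lambda>q. q) \<noteq> {}" using start ne unfolding A_def by blast
    show "A Not \<noteq> {}" using goal nq ne unfolding A_def by blast
  qed
  ultimately have "connected (A (\<lambda>q. q) \<union> A Not)" "A (\<lambda>q. q) \<inter> A Not = {}"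
    "A (\<lambda>q. q) \<noteq> {}" "A Not \<noteq> {}"
    using rf by simp_all
  then show False
    using cl[of "\<lambda>q. q"] cl[of Not] connected_closedD[of "A (\<lambda>q. q) \<union> A Not" "A (\<lambda>q. q)" "A Not"] by auto
qed

end

section \<open>Real projective space\<close>

text \<open>\<open>quotient_topology\<close> is built with \<open>topology\<close>, whose open sets
  are the given family only once the axioms of a topology have been checked.\<close>

lemma openin_quotient_topology:
  "openin (quotient_topology X f) U \<longleftrightarrow> U \<subseteq> f ` topspace X \<and> openin X {x \<in> topspace X. f x \<in> U}"
proof -
  have "istopology (\<lambda>U. U \<subseteq> f ` topspace X \<and> openin X {x \<in> topspace X. f x \<in> U})"
    unfolding istopology_def
  proof (intro conjI allI impI)
    fix U V assume U: "U \<subseteq> f ` topspace X \<and> openin X {x \<in> topspace X. f x \<in> U}"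
      and V: "V \<subseteq> f ` topspace X \<and> openin X {x \<in> topspace X. f x \<in> V}"
    show "U \<inter> V \<subseteq> f ` topspace X" using U by blast
    have "{x \<in> topspace X. f x \<in> U \<inter> V} = {x \<in> topspace X. f x \<in> U} \<inter> {x \<in> topspace X. f x \<in> V}"
      by blast
    then show "openin X {x \<in> topspace X. f x \<in> U \<inter> V}" using U V by (simp add: openin_Int)
  next
    fix \<U> assume U: "\<forall>U\<in>\<U>. U \<subseteq> f ` topspace X \<and> openin X {x \<in> topspace X. f x \<in> U}"
    then show "\<Union>\<U> \<subseteq> f ` topspace X" by blast
    have "{x \<in> topspace X. f x \<in> \<Union>\<U>} = \<Union>((\<lambda>U. {x \<in> topspace X. f x \<in> U}) ` \<U>)"
      by blast
    then show "openin X {x \<in> topspace X. f x \<in> \<Union>\<U>}" using U by (auto intro!: openin_Union)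
  qed
  then show ?thesis unfolding quotient_topology_def by (simp add: topology_inverse')
qed

lemma topspace_quotient_topology: "topspace (quotient_topology X f) = f ` topspace X"
proof
  show "topspace (quotient_topology X f) \<subseteq> f ` topspace X"
    using openin_topspace[of "quotient_topology X f"] unfolding openin_quotient_topology by blast
  have "{x \<in> topspace X. f x \<in> f ` topspace X} = topspace X" by blast
  then have "openin (quotient_topology X f) (f ` topspace X)"
    unfolding openin_quotient_topology by simp
  then show "f ` topspace X \<subseteq> topspace (quotient_topology X f)" by (rule openin_subset)
qed

lemma topspace_real_proj_space: "topspace (real_proj_space N) = proj_class ` (coord_space N - {\<lambda>i. 0})"
  unfolding real_proj_space_def topspace_quotient_topology topspace_euclidean_subtopology ..

lemma continuous_map_proj_class:
  "continuous_map (top_of_set (coord_space N - {\<lambda>i. 0})) (real_proj_space N) proj_class"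
  unfolding continuous_map topspace_real_proj_space topspace_euclidean_subtopology
proof (intro conjI allI impI)
  fix U assume "openin (real_proj_space N) U"
  then show "openin (top_of_set (coord_space N - {\<lambda>i. 0})) {x \<in> coord_space N - {\<lambda>i. 0}. proj_class x \<in> U}"
    unfolding real_proj_space_def openin_quotient_topology topspace_euclidean_subtopology by (rule conjunct2)
qed (rule order_refl)

lemma continuous_map_proj_path:
  assumes "continuous_on D f" "f ` D \<subseteq> coord_space N - {\<lambda>i. 0}"
  shows "continuous_map (top_of_set D) (real_proj_space N) (\<lambda>x. proj_class (f x))"
proof -
  have "continuous_map (top_of_set D) (top_of_set (coord_space N - {\<lambda>i. 0})) f"
    using assms by auto
  from continuous_map_compose[OF this continuous_map_proj_class] show ?thesis
    by (simp add: o_def)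
qed

lemma proj_class_self: "x \<in> proj_class x"
  unfolding proj_class_def by (intro CollectI exI[of _ 1]) simp

lemma proj_class_scale:
  assumes "t \<noteq> 0"
  shows "proj_class (\<lambda>i. t * x i) = proj_class x"
proof
  show "proj_class (\<lambda>i. t * x i) \<subseteq> proj_class x"
    unfolding proj_class_def using assms by (force simp: mult.assoc[symmetric])
  show "proj_class x \<subseteq> proj_class (\<lambda>i. t * x i)"
  proof
    fix y assume "y \<in> proj_class x"
    then obtain c where c: "c \<noteq> 0" "y = (\<lambda>i. c * x i)" unfolding proj_class_def by blast
    then have "y = (\<lambda>i. (c / t) * (t * x i))" "c / t \<noteq> 0" using assms by auto
    then show "y \<in> proj_class (\<lambda>i. t * x i)" unfolding proj_class_def by blast
  qed
qed

lemma proj_class_eqD: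
  assumes "proj_class x = proj_class y"
  obtains t where "t \<noteq> 0" "y = (\<lambda>i. t * x i)"
  using proj_class_self[of y] assms unfolding proj_class_def by blast

text \<open>The classes whose representatives satisfy \<Phi> form a closed set, since its preimage
  is the trace of a closed set; invariance under scaling makes \<Phi> independent of the
  representative. Closed homogeneous conditions thus pass to the closure without sequences.\<close>

lemma proj_closure_condition:
  assumes cl: "closed {x. \<Phi> x}"
    and cone: "\<And>x t. \<Phi> x \<Longrightarrow> t \<noteq> 0 \<Longrightarrow> \<Phi> (\<lambda>i. t * x i)"
    and S: "S \<subseteq> coord_space N - {\<lambda>i. 0}" "\<And>x. x \<in> S \<Longrightarrow> \<Phi> x"
    and z: "z \<in> real_proj_space N closure_of (proj_class ` S)"
  obtains x where "x \<in> coord_space N - {\<lambda>i. 0}" "z = proj_class x" "\<Phi> x"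
proof -
  let ?V = "coord_space N - {\<lambda>i. 0}"
  let ?K = "proj_class ` {x \<in> ?V. \<Phi> x}"
  have iff: "proj_class x \<in> ?K \<longleftrightarrow> \<Phi> x" if "x \<in> ?V" for x
  proof
    assume "proj_class x \<in> ?K"
    then obtain y where y: "proj_class y = proj_class x" "\<Phi> y" by force
    obtain t where "t \<noteq> 0" "x = (\<lambda>i. t * y i)" by (rule proj_class_eqD[OF y(1)])
    then show "\<Phi> x" using cone[OF y(2)] by simp
  qed (use that in blast)
  have "closedin (real_proj_space N) ?K"
    unfolding closedin_def topspace_real_proj_space
  proof
    show "?K \<subseteq> proj_class ` ?V" by blast
    have eq: "{x \<in> ?V. proj_class x \<in> proj_class ` ?V - ?K} = ?V \<inter> - {x. \<Phi> x}"
      using iff by auto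
    show "openin (real_proj_space N) (proj_class ` ?V - ?K)"
      unfolding real_proj_space_def openin_quotient_topology topspace_euclidean_subtopology eq
      using openin_open_Int[OF open_Compl[OF cl]] by blast
  qed
  moreover have "proj_class ` S \<subseteq> ?K" using S by blast
  ultimately have "z \<in> ?K" using z closure_of_minimal by blast
  then show ?thesis using that by blast
qed

section \<open>Graphs and estimates for monomials\<close>

text \<open>While \<open>S\<close> is at most \<open>B\<close>, a change of \<open>y\<close> alters
  \<open>R\<close> by at most half the change of \<open>S\<close>, so 1 - S + R strictly decreases
  and has at most one zero. A zero exists between \<open>y = 0\<close>, where the value is
  nonnegative, and a height with \<open>S = B\<close>, where it is at most 1 - B/2 < 0. No
  derivatives are available, so continuity of the zero comes from compactness.\<close>

lemma monotone_graph:
  fixes S R :: "real \<Rightarrow> real \<Rightarrow> real"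
  assumes D: "compact D" and B: "B > 2"
    and contS: "continuous_on (D \<times> {0..}) (\<lambda>p. S (fst p) (snd p))"
    and contR: "continuous_on (D \<times> {0..}) (\<lambda>p. R (fst p) (snd p))"
    and strict: "\<And>x y y'. x \<in> D \<Longrightarrow> 0 \<le> y \<Longrightarrow> y < y' \<Longrightarrow> S x y < S x y'"
    and diff: "\<And>x y y'. x \<in> D \<Longrightarrow> 0 \<le> y \<Longrightarrow> y < y' \<Longrightarrow> S x y' \<le> B \<Longrightarrow> \<bar>R x y' - R x y\<bar> \<le> (S x y' - S x y) / 2"
    and bound: "\<And>x y. x \<in> D \<Longrightarrow> 0 \<le> y \<Longrightarrow> S x y \<le> B \<Longrightarrow> \<bar>R x y\<bar> \<le> S x y / 2"
    and M: "M \<ge> 0" "\<And>x. x \<in> D \<Longrightarrow> S x M \<ge> B"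
    and init: "\<And>x. x \<in> D \<Longrightarrow> S x 0 \<le> B" "\<And>x. x \<in> D \<Longrightarrow> 1 - S x 0 + R x 0 \<ge> 0"
  obtains \<phi> where "continuous_on D \<phi>"
    "\<And>x. x \<in> D \<Longrightarrow> 0 \<le> \<phi> x" "\<And>x. x \<in> D \<Longrightarrow> S x (\<phi> x) \<le> B"
    "\<And>x. x \<in> D \<Longrightarrow> 1 - S x (\<phi> x) + R x (\<phi> x) = 0"
    "\<And>x y. x \<in> D \<Longrightarrow> 0 \<le> y \<Longrightarrow> S x y \<le> B \<Longrightarrow> 1 - S x y + R x y = 0 \<Longrightarrow> y = \<phi> x"
proof -
  have contx: "continuous_on {0..} (\<lambda>y. S x y)" "continuous_on {0..} (\<lambda>y. R x y)" if "x \<in> D" for x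
  proof -
    have "continuous_on {0..} ((\<lambda>p. S (fst p) (snd p)) \<circ> (\<lambda>y. (x, y)))"
      "continuous_on {0..} ((\<lambda>p. R (fst p) (snd p)) \<circ> (\<lambda>y. (x, y)))"
      using that by (intro continuous_on_compose continuous_intros
          continuous_on_subset[OF contS] continuous_on_subset[OF contR]; auto)+
    then show "continuous_on {0..} (\<lambda>y. S x y)" "continuous_on {0..} (\<lambda>y. R x y)"
      by (simp_all add: o_def)
  qed
  have mono: "S x y \<le> S x y'" if "x \<in> D" "0 \<le> y" "y \<le> y'" for x y y'
    using strict[of x y y'] that by (cases "y = y'") auto
  have ex: "\<exists>y. 0 \<le> y \<and> y \<le> M \<and> S x y \<le> B \<and> 1 - S x y + R x y = 0" if x: "x \<in> D" for x
  proof -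
    have sub: "{0..t} \<subseteq> {0..}" for t :: real by auto
    obtain t where t: "0 \<le> t" "t \<le> M" "S x t = B"
      using IVT'[of "S x" 0 B M] init(1)[OF x] M x continuous_on_subset[OF contx(1)[OF x] sub] by auto
    have neg: "1 - S x t + R x t \<le> 0" using bound[OF x t(1)] t(3) B by (simp add: abs_le_iff)
    have "continuous_on {0..t} (\<lambda>y. 1 - S x y + R x y)"
      using contx[OF x] sub by (intro continuous_intros) (blast intro: continuous_on_subset)+
    then obtain y where y: "0 \<le> y" "y \<le> t" "1 - S x y + R x y = 0"
      using IVT2'[of "\<lambda>y. 1 - S x y + R x y" t 0 0] neg init(2)[OF x] t(1) by auto
    then show ?thesis using t mono[OF x y(1,2)] by (intro exI[of _ y]) auto
  qed
  have uniq: "y = y'" if x: "x \<in> D" and "0 \<le> y" "0 \<le> y'" "S x y \<le> B" "S x y' \<le> B"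
    "1 - S x y + R x y = 0" "1 - S x y' + R x y' = 0" for x y y'
  proof -
    have False if "0 \<le> y" "y < y'" "S x y' \<le> B" "1 - S x y + R x y = 0" "1 - S x y' + R x y' = 0" for y y'
      using abs_le_D1[OF diff[OF x that(1-3)]] strict[OF x that(1,2)] that(4,5) by argo
    then show ?thesis using that by (meson linorder_neqE_linordered_idom)
  qed
  from ex obtain \<phi> where \<phi>: "\<And>x. x \<in> D \<Longrightarrow> 0 \<le> \<phi> x \<and> \<phi> x \<le> M \<and> S x (\<phi> x) \<le> B \<and> 1 - S x (\<phi> x) + R x (\<phi> x) = 0"
    by metis
  \<comment> \<open>The graph as a compact set: heights are bounded by \<open>M\<close> and both
    conditions are closed. Its projection to \<open>D\<close> is a continuous bijection from a
    compact set, so the inverse is continuous.\<close>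
  define K where "K = {p \<in> D \<times> {0..M}. S (fst p) (snd p) \<in> {..B}} \<inter>
      {p \<in> D \<times> {0..M}. 1 - S (fst p) (snd p) + R (fst p) (snd p) \<in> {0}}"
  have "D \<times> {0..M} \<subseteq> D \<times> {0..}" by auto
  note sub = continuous_on_subset[OF _ this]
  have cDM: "compact (D \<times> {0..M})" using D by (intro compact_Times) auto
  have "closed {p \<in> D \<times> {0..M}. S (fst p) (snd p) \<in> {..B}}"
    using continuous_closed_preimage[OF sub[OF contS] compact_imp_closed[OF cDM] closed_atMost[of B]]
    by (simp add: vimage_def Int_def)
  moreover have "closed {p \<in> D \<times> {0..M}. 1 - S (fst p) (snd p) + R (fst p) (snd p) \<in> {0}}"
    using continuous_closed_preimage[OF continuous_on_add[OF continuous_on_diff[OF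
          continuous_on_const[of _ 1] sub[OF contS]] sub[OF contR]] compact_imp_closed[OF cDM] closed_singleton[of 0]]
    by (simp add: vimage_def Int_def)
  ultimately have "compact ((D \<times> {0..M}) \<inter> K)"
    using cDM unfolding K_def by (intro compact_Int_closed closed_Int)
  moreover have "(D \<times> {0..M}) \<inter> K = K" by (auto simp: K_def)
  ultimately have cK: "compact K" by simp
  have inv: "(fst p, \<phi> (fst p)) = p" if "p \<in> K" for p
    using that \<phi>[of "fst p"] uniq[of "fst p" "snd p" "\<phi> (fst p)"] by (auto simp: K_def)
  have img: "fst ` K = D"
  proof
    show "D \<subseteq> fst ` K"
    proof
      fix x assume "x \<in> D"
      then have "(x, \<phi> x) \<in> K" using \<phi>[of x] by (auto simp: K_def)
      then show "x \<in> fst ` K" by force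
    qed
  qed (auto simp: K_def)
  have "continuous_on (fst ` K) (\<lambda>x. (x, \<phi> x))"
    using cK inv by (intro continuous_on_inv) (auto intro!: continuous_intros)
  then have "continuous_on D (\<lambda>x. snd (x, \<phi> x))" unfolding img by (rule continuous_on_snd)
  then have "continuous_on D \<phi>" by simp
  then show ?thesis
  proof (rule that)
    fix x y assume "x \<in> D" "0 \<le> y" "S x y \<le> B" "1 - S x y + R x y = 0"
    then show "y = \<phi> x" using \<phi>[of x] uniq[of x y "\<phi> x"] by auto
  qed (use \<phi> in auto)
qed

section \<open>Lipschitz estimates for powers\<close>

lemma power_diff_le:
  fixes x y :: real
  assumes "0 \<le> x" "x \<le> y" "y \<le> B" "1 \<le> B"
  shows "0 \<le> y ^ n - x ^ n" "y ^ n - x ^ n \<le> real n * B ^ n * (y - x)"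
proof -
  show "0 \<le> y ^ n - x ^ n" using assms by (simp add: power_mono)
  show "y ^ n - x ^ n \<le> real n * B ^ n * (y - x)"
  proof (induction n)
    case (Suc n)
    have "y ^ Suc n - x ^ Suc n = y * (y ^ n - x ^ n) + x ^ n * (y - x)" by (simp add: algebra_simps)
    also have "\<dots> \<le> B * (real n * B ^ n * (y - x)) + B ^ Suc n * (y - x)"
    proof (intro add_mono mult_mono mult_right_mono)
      have "x ^ n \<le> B ^ n" using assms by (intro power_mono) auto
      also have "\<dots> \<le> B ^ Suc n" using assms by (intro power_increasing) auto
      finally show "x ^ n \<le> B ^ Suc n" .
    qed (use assms Suc in \<open>auto simp: power_mono\<close>)
    also have "\<dots> = real (Suc n) * B ^ Suc n * (y - x)" by (simp add: algebra_simps)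
    finally show ?case .
  qed simp
qed

text \<open>Telescoping one factor at a time. The crude constant depends only on the total degree,
  so a bound for the degree serves all monomials at once.\<close>

lemma power_prod_diff_le:
  fixes x y x' y' :: real
  assumes "0 \<le> x" "x \<le> x'" "x' \<le> B" "0 \<le> y" "y \<le> y'" "y' \<le> B" "1 \<le> B"
  shows "0 \<le> x' ^ m * y' ^ n - x ^ m * y ^ n"
    "x' ^ m * y' ^ n - x ^ m * y ^ n \<le> real (m + n) * B ^ (m + n) * ((x' - x) + (y' - y))"
proof -
  show "0 \<le> x' ^ m * y' ^ n - x ^ m * y ^ n"
    using assms by (auto intro!: mult_mono power_mono)
  have "x' ^ m * y' ^ n - x ^ m * y ^ n = x' ^ m * (y' ^ n - y ^ n) + y ^ n * (x' ^ m - x ^ m)"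
    by (simp add: algebra_simps)
  also have "\<dots> \<le> B ^ m * (real n * B ^ n * (y' - y)) + B ^ n * (real m * B ^ m * (x' - x))"
    using assms power_diff_le[of x x' B m] power_diff_le[of y y' B n]
    by (intro add_mono mult_mono power_mono) auto
  also have "\<dots> = B ^ (m + n) * (real n * (y' - y) + real m * (x' - x))"
    by (simp add: power_add algebra_simps)
  also have "\<dots> \<le> B ^ (m + n) * (real (m + n) * ((x' - x) + (y' - y)))"
  proof (rule mult_left_mono)
    have "real n * (y' - y) + real m * (x' - x) \<le> real (m + n) * (y' - y) + real (m + n) * (x' - x)"
      using assms by (intro add_mono mult_right_mono) auto
    then show "real n * (y' - y) + real m * (x' - x) \<le> real (m + n) * ((x' - x) + (y' - y))"
      by (simp add: algebra_simps)
  qed (use assms in auto)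
  finally show "x' ^ m * y' ^ n - x ^ m * y ^ n \<le> real (m + n) * B ^ (m + n) * ((x' - x) + (y' - y))"
    by (simp add: mult_ac)
qed

text \<open>Exponents along a side may be negative. Inversion maps [1/2, 2] to itself and is
  Lipschitz there with constant 4, which reduces them to natural exponents and explains the factor
  4.\<close>

lemma powi_bounds:
  fixes s t :: real and \<alpha> :: int
  assumes s: "1/2 \<le> s" "s \<le> t" "t \<le> 2" and K: "\<bar>\<alpha>\<bar> \<le> int K"
  shows "s powi \<alpha> \<le> 2 ^ K" "\<bar>t powi \<alpha> - s powi \<alpha>\<bar> \<le> 4 * real K * 2 ^ K * (t - s)"
proof -
  obtain n where n: "n \<le> K" "\<alpha> = int n \<or> \<alpha> = - int n"
    using K by (intro that[of "nat \<bar>\<alpha>\<bar>"]) auto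
  have inv: "inverse s \<le> 2" "inverse t \<le> inverse s" "0 \<le> inverse t" "inverse t \<le> 2"
    using s by (auto simp: field_simps)
  have "inverse s - inverse t = (t - s) * (inverse s * inverse t)" using s by (simp add: field_simps)
  also have "\<dots> \<le> (t - s) * (2 * 2)"
    using inv s by (intro mult_left_mono mult_mono) auto
  finally have id: "inverse s - inverse t \<le> 4 * (t - s)" by simp
  have n2: "real n * 2 ^ n \<le> real K * 2 ^ K"
    using n(1) by (intro mult_mono power_increasing) auto
  have pK: "(2::real) ^ n \<le> 2 ^ K" using n(1) by (intro power_increasing) auto
  from n(2) show "s powi \<alpha> \<le> 2 ^ K"
  proof
    assume "\<alpha> = int n"
    then show ?thesis using order_trans[OF power_mono[of s 2 n] pK] s by simp
  next
    assume "\<alpha> = - int n"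
    then show ?thesis using order_trans[OF power_mono[of "inverse s" 2 n] pK] inv s
      by (simp add: power_int_minus power_inverse)
  qed
  from n(2) show "\<bar>t powi \<alpha> - s powi \<alpha>\<bar> \<le> 4 * real K * 2 ^ K * (t - s)"
  proof
    assume a: "\<alpha> = int n"
    have "\<bar>t ^ n - s ^ n\<bar> \<le> real n * 2 ^ n * (t - s)" using power_diff_le[of s t 2 n] s by simp
    also have "\<dots> \<le> real K * 2 ^ K * (t - s)" using n2 s by (intro mult_right_mono) auto
    also have "\<dots> \<le> 4 * (real K * 2 ^ K * (t - s))" using s by simp
    finally show ?thesis using a by simp
  next
    assume a: "\<alpha> = - int n"
    have "\<bar>inverse t ^ n - inverse s ^ n\<bar> \<le> real n * 2 ^ n * (inverse s - inverse t)"
      using power_diff_le[of "inverse t" "inverse s" 2 n] inv by simp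
    also have "\<dots> \<le> (real K * 2 ^ K) * (4 * (t - s))" by (rule mult_mono[OF n2 id]) (use inv in auto)
    also have "\<dots> = 4 * real K * 2 ^ K * (t - s)" by (simp only: mult_ac)
    finally show ?thesis using a by (simp only: power_int_minus power_inverse power_int_of_nat)
  qed
qed

section \<open>Coefficients that decay along the triangulation\<close>

definition lincomb :: "int \<times> int \<Rightarrow> int \<Rightarrow> int \<times> int \<Rightarrow> int \<Rightarrow> int \<times> int" where
  "lincomb d \<alpha> e \<beta> = (\<alpha> * fst d + \<beta> * fst e, \<alpha> * snd d + \<beta> * snd e)"

definition idot :: "int \<times> int \<Rightarrow> int \<times> int \<Rightarrow> int" where
  "idot k z = fst k * fst z + snd k * snd z"

lemma idot_lincomb: "idot k (lincomb d \<alpha> e \<beta>) = \<alpha> * idot k d + \<beta> * idot k e"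
  by (simp add: idot_def lincomb_def algebra_simps)

lemma idot_uminus: "idot k (- z) = - idot k z"
  by (simp add: idot_def)

text \<open>At base 0 the exponent law holds for nonnegative exponents. This case allows monomials
  to be evaluated on an axis, where a chart coordinate is 0.\<close>

lemma power_int_add_nonneg:
  fixes x :: real
  assumes "x \<noteq> 0 \<or> (0 \<le> m \<and> 0 \<le> n)"
  shows "x powi (m + n) = x powi m * x powi n"
  using assms by (cases "x = 0") (auto simp: power_int_add power_int_0_left_if)

lemma power_int_mult_nat:
  fixes x :: real
  shows "x powi (int \<alpha> * m) = (x powi m) ^ \<alpha>"
  by (simp add: power_int_mult mult.commute[of "int \<alpha>"])

lemma power_int_root_exists:
  assumes "0 < r" "0 < n"
  obtains x :: real where "0 < x" "x powi n = r"
proof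
  show "0 < root (nat n) r" using assms by simp
  have "root (nat n) r powi n = root (nat n) r ^ nat n" using assms by (simp add: power_int_def)
  then show "root (nat n) r powi n = r" using assms by (simp add: real_root_pow_pos)
qed

text \<open>All that is used of the mirror coefficients. By \<open>coeff_small\<close>, once the
  coefficients of a triangle are scaled to absolute value 1, every other coefficient is at most
  \<delta>; the affine coordinates \<alpha>, \<beta> may be negative here. In
  \<open>delta_small\<close>, \<open>N\<close> bounds the number of terms,
  \<open>(K + 1) * 6 ^ (K + 1)\<close> dominates the Lipschitz constant of a monomial of degree at
  most \<open>K\<close> on [0, 6], and 64 leaves room for the numerical comparisons.\<close>

locale small_patchwork = lattice_triangulation +
  fixes a :: "nat \<Rightarrow> real" and \<delta> :: real and K :: nat
  assumes a_neg: "i \<in> {1..N} \<Longrightarrow> odd (fst (b i)) \<and> odd (snd (b i)) \<Longrightarrow> a i < 0"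
    and a_pos: "i \<in> {1..N} \<Longrightarrow> even (fst (b i)) \<or> even (snd (b i)) \<Longrightarrow> a i > 0"
    and coords_bounded: "{v, u, w} \<in> T \<Longrightarrow> j \<in> {1..N} \<Longrightarrow> b j - b v = lincomb (b u - b v) \<alpha> (b w - b v) \<beta>
      \<Longrightarrow> \<bar>\<alpha>\<bar> + \<bar>\<beta>\<bar> \<le> int K"
    and coeff_small: "{v, u, w} \<in> T \<Longrightarrow> j \<in> {1..N} - {v, u, w} \<Longrightarrow>
      b j - b v = lincomb (b u - b v) \<alpha> (b w - b v) \<beta>
      \<Longrightarrow> \<bar>a j / a v\<bar> \<le> \<delta> * \<bar>a u / a v\<bar> powi \<alpha> * \<bar>a w / a v\<bar> powi \<beta>"
    and delta_pos: "0 < \<delta>"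
    and delta_small: "real N * \<delta> * (64 * real (K + 1) * 6 ^ (K + 1)) \<le> 1"
begin

section \<open>Neighbours of a lattice point and smallness of the remaining terms\<close>

lemma a_nonzero: "i \<in> {1..N} \<Longrightarrow> a i \<noteq> 0"
  using a_neg[of i] a_pos[of i] by (cases "odd (fst (b i)) \<and> odd (snd (b i))") auto

definition c :: "nat \<Rightarrow> nat \<Rightarrow> real" where
  "c v i = \<bar>a i / a v\<bar>"

lemma c_pos: "v \<in> {1..N} \<Longrightarrow> i \<in> {1..N} \<Longrightarrow> c v i > 0"
  by (simp add: c_def a_nonzero del: atLeastAtMost_iff)

definition link :: "nat \<Rightarrow> nat set" where
  "link v = {i. i \<noteq> v \<and> (\<exists>\<sigma>\<in>T. v \<in> \<sigma> \<and> i \<in> \<sigma>)}"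

lemma link_subset: "link v \<subseteq> {1..N} - {v}"
  unfolding link_def using triangle_subset by blast

lemma finite_link: "finite (link v)"
  using link_subset finite_subset by blast

definition nonlink :: "nat \<Rightarrow> nat set" where
  "nonlink v = {1..N} - {v} - link v"

lemma finite_nonlink: "finite (nonlink v)" by (simp add: nonlink_def)

lemma card_nonlink: "real (card (nonlink v)) \<le> real N"
proof -
  have "card (nonlink v) \<le> card {1..N}" by (intro card_mono) (auto simp: nonlink_def)
  then show ?thesis by simp
qed

text \<open>The forms in which \<open>delta_small\<close> is used: for the terms outside the link
  while the neighbouring terms sum to at most 6, for the variation and the size of an axis
  polynomial on [1/2, 2], and for the product of two opposite neighbouring terms.\<close>

lemma delta_bound: "real N * (\<delta> * (real K * 6 ^ K)) \<le> 1 / 16"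
  "real N * (\<delta> * (4 * real K * 2 ^ K)) \<le> 1 / 8" "real N * (\<delta> * 2 ^ K) \<le> 1 / 16"
  "N \<ge> 1 \<Longrightarrow> \<delta> \<le> 1 / 64"
proof -
  have nd: "0 \<le> real N * \<delta>" using delta_pos by simp
  have e: "(1::real) \<le> 6 ^ K" "(2::real) ^ K \<le> 6 ^ K" by (simp_all add: power_mono)
  have p: "real K * 6 ^ K \<le> real (K + 1) * 6 ^ (K + 1)"
    by (intro mult_mono power_increasing) auto
  have q: "real K * 2 ^ K \<le> real K * 6 ^ K" using e by (intro mult_left_mono) auto
  have r: "1 * 6 ^ K \<le> real (K + 1) * 6 ^ (K + 1)"
    by (intro mult_mono power_increasing) auto
  define L where "L = real (K + 1) * 6 ^ (K + 1)"
  have main: "real N * (\<delta> * z) \<le> m" if "z \<le> m * (64 * L)" "m > 0" for z m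
  proof -
    have "(real N * \<delta>) * z \<le> (real N * \<delta>) * (m * (64 * L))"
      using that(1) nd by (rule mult_left_mono)
    also have "\<dots> = m * (real N * \<delta> * (64 * real (K + 1) * 6 ^ (K + 1)))" by (simp only: L_def mult_ac)
    also have "\<dots> \<le> m * 1" using delta_small that(2) by (intro mult_left_mono) auto
    finally show ?thesis by (simp only: mult_ac mult_1_right)
  qed
  note pqr = p[folded L_def] q r[folded L_def] e
  show "real N * (\<delta> * (real K * 6 ^ K)) \<le> 1 / 16" by (rule main) (use pqr in linarith)+
  show "real N * (\<delta> * (4 * real K * 2 ^ K)) \<le> 1 / 8" by (rule main) (use pqr in linarith)+
  show "real N * (\<delta> * 2 ^ K) \<le> 1 / 16" by (rule main) (use pqr in linarith)+
  assume N: "N \<ge> 1"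
  have "\<delta> \<le> real N * (\<delta> * 1)" using N delta_pos by simp
  also have "\<dots> \<le> 1 / 64" by (rule main) (use pqr in linarith)+
  finally show "\<delta> \<le> 1 / 64" .
qed

text \<open>Abstracts the values of the monomials relative to \<open>b v\<close>. Only nonnegative
  exponents in a triangle at \<open>v\<close> occur, so the values on an axis, where some of them
  are 0, qualify as well.\<close>

definition monomial_like :: "nat \<Rightarrow> (nat \<Rightarrow> real) \<Rightarrow> bool" where
  "monomial_like v M \<longleftrightarrow> (\<forall>i\<in>{1..N}. M i \<ge> 0) \<and>
     (\<forall>u w j \<alpha> \<beta>. {v, u, w} \<in> T \<longrightarrow> j \<in> {1..N} \<longrightarrow>
        b j - b v = lincomb (b u - b v) (int \<alpha>) (b w - b v) (int \<beta>) \<longrightarrow> M j = M u ^ \<alpha> * M w ^ \<beta>)"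

text \<open>The point \<open>b j\<close> lies in the cone of a triangle at \<open>v\<close>, so its
  term is at most \<delta> times a product of nonnegative powers of two neighbouring terms. Each of
  these is at most the neighbouring sum, hence at most 6, and the Lipschitz bound for products with
  \<open>B = 6\<close> compares the change of the far term with that of the sum.\<close>

lemma nonlink_term_bounds:
  assumes v: "v \<in> {1..N}" and M: "monomial_like v M" and M': "monomial_like v M'"
    and le: "\<And>i. i \<in> link v \<Longrightarrow> M i \<le> M' i"
    and box: "(\<Sum>i\<in>link v. c v i * M' i) \<le> 6" and j: "j \<in> nonlink v"
  shows "0 \<le> c v j * M' j - c v j * M j"
    "c v j * M' j - c v j * M j \<le> \<delta> * (real K * 6 ^ K) * ((\<Sum>i\<in>link v. c v i * M' i) - (\<Sum>i\<in>link v. c v i * M i))"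
    "c v j * M' j \<le> \<delta> * (real K * 6 ^ K) * (\<Sum>i\<in>link v. c v i * M' i)"
proof -
  have jN: "j \<in> {1..N}" "j \<noteq> v" "j \<notin> link v" using j by (auto simp: nonlink_def)
  obtain u w \<alpha> \<beta> where uw: "{v, u, w} \<in> T" "\<bar>det2 (b u - b v) (b w - b v)\<bar> = 1"
    and lc: "b j - b v = lincomb (b u - b v) (int \<alpha>) (b w - b v) (int \<beta>)"
    using cone_coords[OF v jN(1)] unfolding lincomb_def by blast
  note dist = triangle_distinct[OF uw(2)]
  have uwl: "u \<in> link v" "w \<in> link v" using uw(1) dist unfolding link_def by blast+
  have uwN: "u \<in> {1..N}" "w \<in> {1..N}" using uwl link_subset by blast+
  have njuw: "j \<notin> {v, u, w}" using jN uwl by blast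
  have ab: "int \<alpha> + int \<beta> \<le> int K" using coords_bounded[OF uw(1) jN(1) lc] by simp
  \<comment> \<open>A positive degree makes the product vanish when both neighbouring terms do;
    comparison with the value at 0 then gives a bound proportional to the neighbouring sum instead
    of a constant.\<close>
  have ab0: "\<alpha> + \<beta> > 0"
  proof (rule ccontr)
    assume "\<not> \<alpha> + \<beta> > 0"
    then have "b j = b v" using lc by (simp add: lincomb_def prod_eq_iff)
    then show False using b_eq_iff[OF jN(1) v] jN(2) by blast
  qed
  have cs: "c v j \<le> \<delta> * c v u ^ \<alpha> * c v w ^ \<beta>"
    using coeff_small[OF uw(1) _ lc] jN(1) njuw by (simp add: c_def)
  have Mj: "M j = M u ^ \<alpha> * M w ^ \<beta>" "M' j = M' u ^ \<alpha> * M' w ^ \<beta>"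
    using M M' uw(1) jN(1) lc unfolding monomial_like_def by blast+
  have nn: "0 \<le> M i" "0 \<le> M' i" "0 \<le> c v i" if "i \<in> {1..N}" for i
    using M M' that c_pos[OF v that] unfolding monomial_like_def by auto
  have mono: "c v i * M i \<le> c v i * M' i" if "i \<in> link v" for i
    using le[OF that] nn(3)[of i] link_subset[of v] that by (intro mult_left_mono) blast+
  have nnl: "0 \<le> c v i * M i" "0 \<le> c v i * M' i" if "i \<in> link v" for i
    using nn[of i] link_subset[of v] that by (blast intro: mult_nonneg_nonneg)+
  define S where "S = (\<Sum>i\<in>link v. c v i * M i)"
  define S' where "S' = (\<Sum>i\<in>link v. c v i * M' i)"
  have sub: "{u, w} \<subseteq> link v" using uwl by blast
  have duw: "(c v u * M' u - c v u * M u) + (c v w * M' w - c v w * M w) \<le> S' - S"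
  proof -
    have "(\<Sum>i\<in>{u, w}. c v i * M' i - c v i * M i) \<le> (\<Sum>i\<in>link v. c v i * M' i - c v i * M i)"
      using mono by (intro sum_mono2[OF finite_link sub]) auto
    then show ?thesis using dist(3) by (simp add: S_def S'_def sum_subtractf)
  qed
  have suw: "c v u * M' u + c v w * M' w \<le> S'"
  proof -
    have "(\<Sum>i\<in>{u, w}. c v i * M' i) \<le> (\<Sum>i\<in>link v. c v i * M' i)"
      using nnl by (intro sum_mono2[OF finite_link sub]) auto
    then show ?thesis using dist(3) by (simp add: S'_def)
  qed
  have le6: "c v u * M' u \<le> 6" "c v w * M' w \<le> 6"
    using suw nnl(2)[OF uwl(1)] nnl(2)[OF uwl(2)] box unfolding S'_def by linarith+
  have Kab: "real (\<alpha> + \<beta>) * 6 ^ (\<alpha> + \<beta>) \<le> real K * 6 ^ K"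
    using ab by (intro mult_mono power_increasing) auto
  have prod: "M u ^ \<alpha> * M w ^ \<beta> \<le> M' u ^ \<alpha> * M' w ^ \<beta>"
    using le uwl nn uwN by (intro mult_mono power_mono) auto
  show "0 \<le> c v j * M' j - c v j * M j"
    unfolding Mj using prod nn(3)[OF jN(1)] by (simp add: mult_left_mono)
  have "c v j * M' j - c v j * M j = c v j * (M' u ^ \<alpha> * M' w ^ \<beta> - M u ^ \<alpha> * M w ^ \<beta>)"
    unfolding Mj by (simp add: algebra_simps)
  also have "\<dots> \<le> (\<delta> * c v u ^ \<alpha> * c v w ^ \<beta>) * (M' u ^ \<alpha> * M' w ^ \<beta> - M u ^ \<alpha> * M w ^ \<beta>)"
    using cs prod by (intro mult_right_mono) auto
  also have "\<dots> = \<delta> * ((c v u * M' u) ^ \<alpha> * (c v w * M' w) ^ \<beta> - (c v u * M u) ^ \<alpha> * (c v w * M w) ^ \<beta>)"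
    by (simp add: power_mult_distrib algebra_simps)
  also have "\<dots> \<le> \<delta> * (real (\<alpha> + \<beta>) * 6 ^ (\<alpha> + \<beta>) *
      ((c v u * M' u - c v u * M u) + (c v w * M' w - c v w * M w)))"
    using delta_pos by (intro mult_left_mono power_prod_diff_le(2)[OF nnl(1) mono le6(1) nnl(1) mono le6(2)] uwl) auto
  also have "\<dots> \<le> \<delta> * (real K * 6 ^ K * (S' - S))"
    by (rule mult_left_mono[OF mult_mono[OF Kab duw]])
       (use mono[OF uwl(1)] mono[OF uwl(2)] delta_pos in auto)
  finally show "c v j * M' j - c v j * M j \<le> \<delta> * (real K * 6 ^ K) * (S' - S)"
    by (simp add: mult_ac)
  have "c v j * M' j = c v j * (M' u ^ \<alpha> * M' w ^ \<beta>)"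
    unfolding Mj by simp
  also have "\<dots> \<le> (\<delta> * c v u ^ \<alpha> * c v w ^ \<beta>) * (M' u ^ \<alpha> * M' w ^ \<beta>)"
    using cs nn uwN by (intro mult_right_mono) auto
  also have "\<dots> = \<delta> * ((c v u * M' u) ^ \<alpha> * (c v w * M' w) ^ \<beta> - 0 ^ \<alpha> * 0 ^ \<beta>)"
    using ab0 by (simp add: power_mult_distrib algebra_simps zero_power)
  also have "\<dots> \<le> \<delta> * (real (\<alpha> + \<beta>) * 6 ^ (\<alpha> + \<beta>) * ((c v u * M' u - 0) + (c v w * M' w - 0)))"
    using delta_pos by (intro mult_left_mono power_prod_diff_le(2)[OF _ _ le6(1) _ _ le6(2)] nnl(2) uwl) auto
  also have "\<dots> \<le> \<delta> * (real K * 6 ^ K * S')"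
    by (rule mult_left_mono[OF mult_mono[OF Kab]])
       (use suw nnl(2)[OF uwl(1)] nnl(2)[OF uwl(2)] delta_pos in auto)
  finally show "c v j * M' j \<le> \<delta> * (real K * 6 ^ K) * S'"
    by (simp add: mult_ac)
qed

text \<open>Signs are left open: \<open>t\<close> is any choice of coefficients with the right
  absolute values. At most \<open>N\<close> estimates are added, which leaves 1/16 of the
  neighbouring sum.\<close>

lemma nonlink_sum_bounds:
  assumes v: "v \<in> {1..N}" and M: "monomial_like v M" and M': "monomial_like v M'"
    and le: "\<And>i. i \<in> link v \<Longrightarrow> M i \<le> M' i"
    and box: "(\<Sum>i\<in>link v. c v i * M' i) \<le> 6" and t: "\<And>j. j \<in> nonlink v \<Longrightarrow> \<bar>t j\<bar> = c v j"
  shows "\<bar>(\<Sum>j\<in>nonlink v. t j * M' j) - (\<Sum>j\<in>nonlink v. t j * M j)\<bar>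
      \<le> ((\<Sum>i\<in>link v. c v i * M' i) - (\<Sum>i\<in>link v. c v i * M i)) / 16"
    "\<bar>\<Sum>j\<in>nonlink v. t j * M' j\<bar> \<le> (\<Sum>i\<in>link v. c v i * M' i) / 16"
proof -
  define S where "S = (\<Sum>i\<in>link v. c v i * M i)"
  define S' where "S' = (\<Sum>i\<in>link v. c v i * M' i)"
  note nb = nonlink_term_bounds[OF v M M' le box, folded S_def S'_def]
  have linkN: "\<And>i. i \<in> link v \<Longrightarrow> i \<in> {1..N}" using link_subset by blast
  have nn: "0 \<le> M i" "0 \<le> M' i" "0 \<le> c v i" if "i \<in> {1..N}" for i
    using M M' that c_pos[OF v that] unfolding monomial_like_def by auto
  have SS: "0 \<le> S' - S" "0 \<le> S'"
    unfolding S_def S'_def using le nn linkN by (auto intro!: sum_mono mult_left_mono sum_nonneg)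
  have est: "(\<Sum>j\<in>nonlink v. f j) \<le> z / 16"
    if "\<And>j. j \<in> nonlink v \<Longrightarrow> f j \<le> \<delta> * (real K * 6 ^ K) * z" "0 \<le> z" for f z
  proof -
    have "(\<Sum>j\<in>nonlink v. f j) \<le> real (card (nonlink v)) * (\<delta> * (real K * 6 ^ K) * z)"
      using that(1) by (rule sum_bounded_above)
    also have "\<dots> \<le> real N * (\<delta> * (real K * 6 ^ K) * z)"
      using card_nonlink delta_pos that(2) by (intro mult_right_mono) auto
    also have "\<dots> = (real N * (\<delta> * (real K * 6 ^ K))) * z" by (simp add: mult_ac)
    also have "\<dots> \<le> 1 / 16 * z" using delta_bound(1) that(2) by (rule mult_right_mono)
    finally show ?thesis by simp
  qed
  have "\<bar>(\<Sum>j\<in>nonlink v. t j * M' j) - (\<Sum>j\<in>nonlink v. t j * M j)\<bar>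
      = \<bar>\<Sum>j\<in>nonlink v. t j * (M' j - M j)\<bar>"
    by (simp add: sum_subtractf right_diff_distrib)
  also have "\<dots> \<le> (\<Sum>j\<in>nonlink v. \<bar>t j * (M' j - M j)\<bar>)" by (rule sum_abs)
  also have "\<dots> = (\<Sum>j\<in>nonlink v. c v j * M' j - c v j * M j)"
  proof (rule sum.cong[OF refl])
    fix j assume j: "j \<in> nonlink v"
    have "\<bar>t j * (M' j - M j)\<bar> = \<bar>c v j * (M' j - M j)\<bar>"
      using t[OF j] by (simp add: abs_mult c_def)
    then show "\<bar>t j * (M' j - M j)\<bar> = c v j * M' j - c v j * M j"
      using nb(1)[OF _ j] by (simp add: right_diff_distrib)
  qed
  also have "\<dots> \<le> (S' - S) / 16" using nb(2) SS(1) by (intro est) auto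
  finally show "\<bar>(\<Sum>j\<in>nonlink v. t j * M' j) - (\<Sum>j\<in>nonlink v. t j * M j)\<bar> \<le> (S' - S) / 16" .
  have "\<bar>\<Sum>j\<in>nonlink v. t j * M' j\<bar> \<le> (\<Sum>j\<in>nonlink v. \<bar>t j * M' j\<bar>)" by (rule sum_abs)
  also have "\<dots> = (\<Sum>j\<in>nonlink v. c v j * M' j)"
    using t nn by (intro sum.cong[OF refl]) (auto simp: abs_mult nonlink_def)
  also have "\<dots> \<le> S' / 16" using nb(3) SS(2) by (intro est) auto
  finally show "\<bar>\<Sum>j\<in>nonlink v. t j * M' j\<bar> \<le> S' / 16" .
qed

end

section \<open>The curve near a boundary lattice point\<close>

lemma continuous_on_power_int_nonneg:
  fixes f :: "'a :: topological_space \<Rightarrow> real"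
  assumes "continuous_on A f" "(\<forall>p\<in>A. f p \<noteq> 0) \<or> 0 \<le> n"
  shows "continuous_on A (\<lambda>p. f p powi n)"
  using assms(2)
proof
  assume "0 \<le> n"
  then have eq: "(\<lambda>p. f p powi n) = (\<lambda>p. f p ^ nat n)" by (simp add: power_int_def)
  show ?thesis unfolding eq using assms(1) by (rule continuous_on_power)
qed (use assms(1) in \<open>auto intro: continuous_on_power_int\<close>)

context small_patchwork
begin

text \<open>In the quadrant with signs \<open>quad_x v\<close>, \<open>quad_y v\<close> the term of every lattice point that differs
  from \<open>b v\<close> by a primitive vector has the sign opposite to the term of \<open>b v\<close>.\<close>

definition quad_x :: "nat \<Rightarrow> real" where
  "quad_x v = (if even (snd (b v)) then - 1 else 1)"

definition quad_y :: "nat \<Rightarrow> real" where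
  "quad_y v = (if even (fst (b v)) then - 1 else 1)"

definition quad_sign :: "nat \<Rightarrow> int \<times> int \<Rightarrow> real" where
  "quad_sign v z = quad_x v powi fst z * quad_y v powi snd z"

text \<open>The substitution X = x^(k_1) y^(h_1), Y = x^(k_2) y^(h_2), relative to the monomial of
  \<open>b v\<close>. If \<open>h\<close> is an inward normal of a side at \<open>v\<close>, the
  exponents of \<open>y\<close> are nonnegative and \<open>y = 0\<close> is the axis of that side.
  For positive \<open>x\<close> and \<open>y\<close> the substitution makes sense for any
  \<open>k\<close> and \<open>h\<close>, so singular corners are no exception.\<close>

definition mon :: "nat \<Rightarrow> int \<times> int \<Rightarrow> int \<times> int \<Rightarrow> real \<Rightarrow> real \<Rightarrow> nat \<Rightarrow> real" where
  "mon v k h x y i = x powi idot k (b i - b v) * y powi idot h (b i - b v)"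

text \<open>Homogeneous coordinates in the chosen quadrant, scaled to be 1 at \<open>v\<close>; this
  fixes the representative of the projective point, also on the axes.\<close>

definition chart :: "nat \<Rightarrow> int \<times> int \<Rightarrow> int \<times> int \<Rightarrow> real \<Rightarrow> real \<Rightarrow> nat \<Rightarrow> real" where
  "chart v k h x y i = (if i \<in> {1..N} then quad_sign v (b i - b v) * mon v k h x y i else 0)"

definition G :: "nat \<Rightarrow> int \<times> int \<Rightarrow> int \<times> int \<Rightarrow> real \<Rightarrow> real \<Rightarrow> real" where
  "G v k h x y = (\<Sum>i\<in>{1..N}. a i * chart v k h x y i) / a v"

definition S :: "nat \<Rightarrow> int \<times> int \<Rightarrow> int \<times> int \<Rightarrow> real \<Rightarrow> real \<Rightarrow> real" where
  "S v k h x y = (\<Sum>i\<in>link v. c v i * mon v k h x y i)"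

definition R :: "nat \<Rightarrow> int \<times> int \<Rightarrow> int \<times> int \<Rightarrow> real \<Rightarrow> real \<Rightarrow> real" where
  "R v k h x y = (\<Sum>i\<in>nonlink v. (a i / a v * quad_sign v (b i - b v)) * mon v k h x y i)"

lemma quad_nonzero: "quad_x v \<noteq> 0" "quad_y v \<noteq> 0"
  by (simp_all add: quad_x_def quad_y_def)

lemma abs_quad_sign: "\<bar>quad_sign v z\<bar> = 1"
  by (simp add: quad_sign_def quad_x_def quad_y_def abs_mult power_int_abs)

lemma abs_term: "\<bar>a i / a v * quad_sign v z\<bar> = c v i"
  unfolding abs_mult abs_quad_sign c_def by simp

lemma link_range: "i \<in> link v \<Longrightarrow> i \<in> {1..N}"
  using link_subset by blast

text \<open>An edge vector of a unimodular triangle is nonzero modulo 2, for otherwise the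
  determinant would be even. All signs depend only on parities, and the quadrant is chosen so that
  each of the three nonzero classes gives -1.\<close>

lemma link_term:
  assumes i: "i \<in> link v"
  shows "a i / a v * quad_sign v (b i - b v) = - c v i"
proof -
  obtain \<sigma> where \<sigma>: "\<sigma> \<in> T" "v \<in> \<sigma>" "i \<in> \<sigma>" "i \<noteq> v" using i unfolding link_def by blast
  obtain w where w: "\<bar>det2 (b i - b v) (b w - b v)\<bar> = 1"
    using triangle_edgeE[OF \<sigma>] .
  have iN: "i \<in> {1..N}" "v \<in> {1..N}" using \<sigma> triangle_subset by blast+
  obtain dm dn where d: "b i - b v = (dm, dn)" by fastforce
  have bi: "fst (b i) = fst (b v) + dm" "snd (b i) = snd (b v) + dn"
    using d by (simp_all add: prod_eq_iff algebra_simps)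
  have par: "odd dm \<or> odd dn"
  proof (rule ccontr)
    assume "\<not> (odd dm \<or> odd dn)"
    then have "even (det2 (b i - b v) (b w - b v))" by (simp add: d det2_def)
    then have "even \<bar>det2 (b i - b v) (b w - b v)\<bar>" by simp
    then show False unfolding w by simp
  qed
  define sg where "sg j = (if odd (fst (b j)) \<and> odd (snd (b j)) then - 1 else 1 :: real)" for j
  have sa: "a j = sg j * \<bar>a j\<bar>" if "j \<in> {1..N}" for j
    using a_neg[OF that] a_pos[OF that] by (auto simp: sg_def)
  have "a i / a v = (sg i * \<bar>a i\<bar>) / (sg v * \<bar>a v\<bar>)" using sa[OF iN(1)] sa[OF iN(2)] by simp
  also have "\<dots> = sg i * sg v * c v i" by (simp add: sg_def c_def)
  finally have "a i / a v = sg i * sg v * c v i" .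
  moreover have "sg i * sg v * quad_sign v (b i - b v) = - 1"
    using par unfolding d quad_sign_def quad_x_def quad_y_def sg_def bi
    by (cases "even (fst (b v))"; cases "even (snd (b v))"; cases "even dm"; cases "even dn")
       (simp_all add: power_int_minus_left)
  moreover have "sg i * sg v * c v i * quad_sign v (b i - b v) = (sg i * sg v * quad_sign v (b i - b v)) * c v i"
    by (simp only: mult_ac)
  ultimately show ?thesis by simp
qed

lemma chart_center: "v \<in> {1..N} \<Longrightarrow> chart v k h x y v = 1"
  by (simp add: chart_def mon_def quad_sign_def idot_def)

lemma G_split:
  assumes v: "v \<in> {1..N}"
  shows "G v k h x y = 1 - S v k h x y + R v k h x y"
proof -
  let ?f = "\<lambda>i. a i / a v * chart v k h x y i"
  have eq: "{1..N} = insert v (link v \<union> nonlink v)"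
    using v link_subset[of v] by (auto simp: nonlink_def)
  have "G v k h x y = sum ?f {1..N}"
    by (simp add: G_def sum_divide_distrib)
  also have "\<dots> = ?f v + sum ?f (link v \<union> nonlink v)"
    unfolding eq using link_subset[of v] by (subst sum.insert) (auto simp: finite_link finite_nonlink nonlink_def)
  also have "sum ?f (link v \<union> nonlink v) = sum ?f (link v) + sum ?f (nonlink v)"
    by (rule sum.union_disjoint) (auto simp: finite_link finite_nonlink nonlink_def)
  also have "?f v = 1" using chart_center[OF v] a_nonzero[OF v] by simp
  also have "sum ?f (link v) = - S v k h x y"
    unfolding S_def sum_negf[symmetric]
  proof (rule sum.cong[OF refl])
    fix i assume i: "i \<in> link v"
    have "?f i = (a i / a v * quad_sign v (b i - b v)) * mon v k h x y i"
      unfolding chart_def using link_range[OF i] by (simp only: if_True mult.assoc)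
    then show "?f i = - (c v i * mon v k h x y i)" unfolding link_term[OF i] by simp
  qed
  also have "sum ?f (nonlink v) = R v k h x y"
    unfolding R_def
  proof (rule sum.cong[OF refl])
    fix i assume "i \<in> nonlink v"
    then have "i \<in> {1..N}" by (simp add: nonlink_def)
    then show "?f i = (a i / a v * quad_sign v (b i - b v)) * mon v k h x y i"
      unfolding chart_def by (simp only: if_True mult.assoc)
  qed
  finally show ?thesis by simp
qed

lemma chart_swap: "chart v k h x y = chart v h k y x"
  by (rule ext) (simp add: chart_def mon_def)

lemma G_swap: "G v k h x y = G v h k y x"
  unfolding G_def chart_swap[of v k h x y] ..

lemma S_swap: "S v k h x y = S v h k y x"
  by (simp add: S_def mon_def mult_ac)

lemma mon_nonneg: "0 \<le> x \<Longrightarrow> 0 \<le> y \<Longrightarrow> 0 \<le> mon v k h x y i"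
  by (simp add: mon_def)

lemma monomial_like_mon:
  assumes v: "v \<in> {1..N}" and x: "0 \<le> x" and y: "0 \<le> y"
    and k: "0 < x \<or> (\<forall>i\<in>{1..N}. 0 \<le> idot k (b i - b v))"
    and h: "0 < y \<or> (\<forall>i\<in>{1..N}. 0 \<le> idot h (b i - b v))"
  shows "monomial_like v (mon v k h x y)"
  unfolding monomial_like_def
proof (intro conjI ballI allI impI)
  show "0 \<le> mon v k h x y i" for i using x y by (rule mon_nonneg)
  fix u w j \<alpha> \<beta>
  assume T: "{v, u, w} \<in> T" and j: "b j - b v = lincomb (b u - b v) (int \<alpha>) (b w - b v) (int \<beta>)"
  have uw: "u \<in> {1..N}" "w \<in> {1..N}" using triangle_subset[OF T] by blast+
  have pw: "z powi idot l (b j - b v) = (z powi idot l (b u - b v)) ^ \<alpha> * (z powi idot l (b w - b v)) ^ \<beta>"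
    if "0 \<le> z" "0 < z \<or> (\<forall>i\<in>{1..N}. 0 \<le> idot l (b i - b v))" for z :: real and l
  proof -
    have "z \<noteq> 0 \<or> (0 \<le> int \<alpha> * idot l (b u - b v) \<and> 0 \<le> int \<beta> * idot l (b w - b v))"
      using that(2) uw by (metis less_irrefl mult_nonneg_nonneg of_nat_0_le_iff)
    then show ?thesis unfolding j idot_lincomb by (simp add: power_int_add_nonneg power_int_mult_nat)
  qed
  show "mon v k h x y j = mon v k h x y u ^ \<alpha> * mon v k h x y w ^ \<beta>"
    unfolding mon_def pw[OF x k] pw[OF y h] by (simp add: power_mult_distrib mult_ac)
qed

text \<open>The chart vector is the monomial vector of \<open>(X, Y)\<close> divided by its entry
  \<open>l\<close> at \<open>v\<close>; the class is therefore the same, and so is the equation up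
  to the factor \<open>l * a v\<close>.\<close>

lemma chart_torus:
  assumes v: "v \<in> {1..N}" and x: "0 < x" and y: "0 < y"
  obtains z where "z \<in> real_torus" "proj_class (chart v k h x y) = proj_class (monomial_map b N z)"
    "mirror_poly b N a (fst z) (snd z) = 0 \<longleftrightarrow> G v k h x y = 0"
proof -
  define X where "X = quad_x v * (x powi fst k * y powi fst h)"
  define Y where "Y = quad_y v * (x powi snd k * y powi snd h)"
  define l where "l = X powi fst (b v) * Y powi snd (b v)"
  have XY: "X \<noteq> 0" "Y \<noteq> 0" using quad_nonzero[of v] x y by (auto simp: X_def Y_def)
  then have l: "l \<noteq> 0" by (simp add: l_def)
  have val: "X powi fst (b i) * Y powi snd (b i) = l * (quad_sign v (b i - b v) * mon v k h x y i)" for i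
  proof -
    obtain dm dn where d: "b i - b v = (dm, dn)" by fastforce
    have bi: "fst (b i) = fst (b v) + dm" "snd (b i) = snd (b v) + dn"
      using d by (simp_all add: prod_eq_iff algebra_simps)
    have "X powi fst (b i) * Y powi snd (b i) = l * (X powi dm * Y powi dn)"
      unfolding bi using XY by (simp add: power_int_add l_def)
    also have "X powi dm * Y powi dn = (quad_x v powi dm * quad_y v powi dn) *
        (x powi (fst k * dm + snd k * dn) * y powi (fst h * dm + snd h * dn))"
      using x y by (simp add: X_def Y_def power_int_mult_distrib power_int_mult power_int_add)
    finally show ?thesis unfolding quad_sign_def mon_def idot_def d by simp
  qed
  have mm: "monomial_map b N (X, Y) = (\<lambda>i. l * chart v k h x y i)"
    by (rule ext) (simp add: monomial_map_def chart_def val)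
  have "mirror_poly b N a X Y = (\<Sum>i\<in>{1..N}. l * (a i * chart v k h x y i))"
    unfolding mirror_poly_def
  proof (rule sum.cong[OF refl])
    fix i assume "i \<in> {1..N}"
    then show "a i * X powi fst (b i) * Y powi snd (b i) = l * (a i * chart v k h x y i)"
      unfolding chart_def mult.assoc[of "a i"] val by simp
  qed
  also have "\<dots> = l * (a v * G v k h x y)"
    using a_nonzero[OF v] unfolding sum_distrib_left[symmetric] by (simp add: G_def)
  finally have "mirror_poly b N a X Y = 0 \<longleftrightarrow> G v k h x y = 0"
    using l a_nonzero[OF v] by simp
  moreover have "proj_class (monomial_map b N (X, Y)) = proj_class (chart v k h x y)"
    unfolding mm by (rule proj_class_scale[OF l])
  ultimately show ?thesis using that[of "(X, Y)"] XY by (simp add: real_torus_def)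
qed

text \<open>No neighbouring monomial decreases when \<open>y\<close> grows, since \<open>h\<close>
  is nonnegative at all lattice points relative to \<open>b v\<close>; this is the comparison that
  \<open>nonlink_sum_bounds\<close> asks for.\<close>

lemma S_R_estimates:
  assumes v: "v \<in> {1..N}" and x: "0 \<le> x"
    and k: "0 < x \<or> (\<forall>i\<in>{1..N}. 0 \<le> idot k (b i - b v))"
    and h: "\<forall>i\<in>{1..N}. 0 \<le> idot h (b i - b v)"
    and y: "0 \<le> y" "y \<le> y'" and box: "S v k h x y' \<le> 6"
  shows "\<bar>R v k h x y' - R v k h x y\<bar> \<le> (S v k h x y' - S v k h x y) / 16"
    "\<bar>R v k h x y'\<bar> \<le> S v k h x y' / 16"
proof -
  have y': "0 \<le> y'" using y by simp
  have le: "mon v k h x y i \<le> mon v k h x y' i" if "i \<in> link v" for i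
    unfolding mon_def using x y h link_range[OF that]
    by (intro mult_left_mono power_int_mono) auto
  note ml = monomial_like_mon[OF v x y(1) k disjI2[OF h]] monomial_like_mon[OF v x y' k disjI2[OF h]]
  show "\<bar>R v k h x y' - R v k h x y\<bar> \<le> (S v k h x y' - S v k h x y) / 16"
    unfolding R_def S_def
    by (rule nonlink_sum_bounds(1)[OF v ml _ box[unfolded S_def]]) (simp_all add: le abs_term del: times_divide_eq_left)
  show "\<bar>R v k h x y'\<bar> \<le> S v k h x y' / 16"
    unfolding R_def S_def
    by (rule nonlink_sum_bounds(2)[OF v ml _ box[unfolded S_def]]) (simp_all add: le abs_term del: times_divide_eq_left)
qed

lemma S_nonneg: "v \<in> {1..N} \<Longrightarrow> 0 \<le> x \<Longrightarrow> 0 \<le> y \<Longrightarrow> 0 \<le> S v k h x y"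
  unfolding S_def by (intro sum_nonneg mult_nonneg_nonneg mon_nonneg) (simp_all add: c_def)

lemma continuous_on_mon:
  assumes x: "continuous_on A f" "\<And>p. p \<in> A \<Longrightarrow> 0 \<le> f p"
    and k: "(\<forall>p\<in>A. 0 < f p) \<or> 0 \<le> idot k (b i - b v)"
    and y: "continuous_on A g" "0 \<le> idot h (b i - b v)"
  shows "continuous_on A (\<lambda>p. mon v k h (f p) (g p) i)"
  unfolding mon_def
proof (intro continuous_on_mult continuous_on_power_int_nonneg x(1) y(1))
  show "(\<forall>p\<in>A. f p \<noteq> 0) \<or> 0 \<le> idot k (b i - b v)" using k by fastforce
  show "(\<forall>p\<in>A. g p \<noteq> 0) \<or> 0 \<le> idot h (b i - b v)" using y(2) by blast
qed

text \<open>The neighbour \<open>w\<close> off the side makes \<open>S\<close> strictly increasing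
  in \<open>y\<close>. The third condition on \<open>w\<close> keeps the power of \<open>x\<close>
  in its term positive even at \<open>x = 0\<close>, where the other axis of a corner is
  reached.\<close>

lemma chart_graph:
  assumes v: "v \<in> {1..N}" and x12: "0 \<le> x1" "x1 < x2"
    and k: "0 < x1 \<or> (\<forall>i\<in>{1..N}. 0 \<le> idot k (b i - b v))"
    and h: "\<forall>i\<in>{1..N}. 0 \<le> idot h (b i - b v)"
    and w: "w \<in> link v" "0 < idot h (b w - b v)" "0 < x1 \<or> idot k (b w - b v) = 0"
    and init: "\<And>x. x1 \<le> x \<Longrightarrow> x \<le> x2 \<Longrightarrow> S v k h x 0 \<le> 6" "\<And>x. x1 \<le> x \<Longrightarrow> x \<le> x2 \<Longrightarrow> 0 \<le> G v k h x 0"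
  obtains \<phi> where "continuous_on {x1..x2} \<phi>"
    "\<And>x. x \<in> {x1..x2} \<Longrightarrow> 0 \<le> \<phi> x" "\<And>x. x \<in> {x1..x2} \<Longrightarrow> G v k h x (\<phi> x) = 0"
    "\<And>x y. x \<in> {x1..x2} \<Longrightarrow> 0 \<le> y \<Longrightarrow> S v k h x y \<le> 6 \<Longrightarrow> G v k h x y = 0 \<Longrightarrow> y = \<phi> x"
proof -
  let ?D = "{x1..x2}"
  have xk: "0 \<le> x" "0 < x \<or> (\<forall>i\<in>{1..N}. 0 \<le> idot k (b i - b v))" if "x \<in> ?D" for x
    using that x12 k by auto
  have cmon: "continuous_on (?D \<times> {0..}) (\<lambda>p. mon v k h (fst p) (snd p) i)" if "i \<in> {1..N}" for i
  proof (rule continuous_on_mon)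
    show "(\<forall>p\<in>?D \<times> {0..}. 0 < fst p) \<or> 0 \<le> idot k (b i - b v)" using k that by auto
  qed (use x12 h that in \<open>auto intro!: continuous_intros\<close>)
  have contS: "continuous_on (?D \<times> {0..}) (\<lambda>p. S v k h (fst p) (snd p))"
    unfolding S_def by (intro continuous_on_sum continuous_on_mult continuous_on_const cmon link_range)
  have contR: "continuous_on (?D \<times> {0..}) (\<lambda>p. R v k h (fst p) (snd p))"
    unfolding R_def by (intro continuous_on_sum continuous_on_mult continuous_on_const cmon) (simp add: nonlink_def)
  have cw: "0 < c v w" using c_pos[OF v link_range[OF w(1)]] .
  have xw: "0 < x powi idot k (b w - b v)" if "x \<in> ?D" for x
    using w(3) that x12 by (cases "x = 0") auto
  have ple: "mon v k h x y i \<le> mon v k h x y' i" if "x \<in> ?D" "0 \<le> y" "y \<le> y'" "i \<in> link v" for x y y' i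
    unfolding mon_def using xk[OF that(1)] that h link_range[OF that(4)]
    by (intro mult_left_mono power_int_mono) auto
  have cnn: "0 \<le> c v i" for i by (simp add: c_def)
  have strict: "S v k h x y < S v k h x y'" if x: "x \<in> ?D" and y: "0 \<le> y" "y < y'" for x y y'
    unfolding S_def
  proof (rule sum_strict_mono_ex1[OF finite_link])
    show "\<forall>i\<in>link v. c v i * mon v k h x y i \<le> c v i * mon v k h x y' i"
      using ple[OF x y(1)] y cnn by (auto intro: mult_left_mono)
    have "y powi idot h (b w - b v) < y' powi idot h (b w - b v)"
      using w(2) y by (intro power_int_strict_mono) auto
    then have "c v w * mon v k h x y w < c v w * mon v k h x y' w"
      unfolding mon_def using cw xw[OF x] by (intro mult_strict_left_mono) auto
    then show "\<exists>i\<in>link v. c v i * mon v k h x y i < c v i * mon v k h x y' i" using w(1) by blast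
  qed
  have "continuous_on ?D (\<lambda>x. x powi idot k (b w - b v))"
    using w(3) by (intro continuous_on_power_int_nonneg) auto
  then obtain x0 where x0: "x0 \<in> ?D" "\<And>x. x \<in> ?D \<Longrightarrow> x0 powi idot k (b w - b v) \<le> x powi idot k (b w - b v)"
    using continuous_attains_inf[OF compact_Icc[of x1 x2], of "\<lambda>x. x powi idot k (b w - b v)"] x12(2)
    by (metis atLeastatMost_empty_iff less_imp_le)
  \<comment> \<open>The least coefficient of the term of \<open>w\<close> over the compact interval.
    It yields one height \<open>M\<close>, valid for all \<open>x\<close>, at which this term alone
    reaches 6.\<close>
  define \<mu> where "\<mu> = c v w * x0 powi idot k (b w - b v)"
  have mu: "0 < \<mu>" using cw xw[OF x0(1)] by (simp add: \<mu>_def)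
  define M where "M = max 1 (6 / \<mu>)"
  have M: "1 \<le> M" "6 \<le> \<mu> * M" using mu by (auto simp: M_def max_def field_simps)
  have SM: "6 \<le> S v k h x M" if x: "x \<in> ?D" for x
  proof -
    have "M powi 1 \<le> M powi idot h (b w - b v)"
      using M(1) w(2) by (intro power_int_increasing) auto
    then have "\<mu> * M \<le> (c v w * x powi idot k (b w - b v)) * M powi idot h (b w - b v)"
      unfolding \<mu>_def using x0(2)[OF x] cw M(1) mu xw[OF x] by (intro mult_mono mult_left_mono) auto
    also have "\<dots> = c v w * mon v k h x M w" by (simp add: mon_def)
    also have "\<dots> \<le> S v k h x M"
      unfolding S_def using w(1) mon_nonneg[OF xk(1)[OF x]] M(1) cnn
      by (intro member_le_sum[OF _ _ finite_link]) auto
    finally show ?thesis using M(2) by simp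
  qed
  obtain \<phi> where \<phi>: "continuous_on ?D \<phi>" "\<And>x. x \<in> ?D \<Longrightarrow> 0 \<le> \<phi> x"
    "\<And>x. x \<in> ?D \<Longrightarrow> 1 - S v k h x (\<phi> x) + R v k h x (\<phi> x) = 0"
    "\<And>x y. x \<in> ?D \<Longrightarrow> 0 \<le> y \<Longrightarrow> S v k h x y \<le> 6 \<Longrightarrow> 1 - S v k h x y + R v k h x y = 0 \<Longrightarrow> y = \<phi> x"
  proof (rule monotone_graph[of ?D 6 "S v k h" "R v k h" M])
    fix x y y' assume *: "x \<in> ?D" "0 \<le> y" "y < y'" "S v k h x y' \<le> 6"
    have "\<bar>R v k h x y' - R v k h x y\<bar> \<le> (S v k h x y' - S v k h x y) / 16"
      using S_R_estimates(1)[OF v xk[OF *(1)] h *(2) less_imp_le[OF *(3)] *(4)] .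
    then show "\<bar>R v k h x y' - R v k h x y\<bar> \<le> (S v k h x y' - S v k h x y) / 2"
      using strict[OF *(1-3)] by simp
  next
    fix x y assume *: "x \<in> ?D" "0 \<le> y" "S v k h x y \<le> 6"
    have "\<bar>R v k h x y\<bar> \<le> S v k h x y / 16"
      using S_R_estimates(2)[OF v xk[OF *(1)] h *(2) order_refl *(3)] .
    then show "\<bar>R v k h x y\<bar> \<le> S v k h x y / 2"
      using S_nonneg[OF v xk(1)[OF *(1)] *(2), of k h] by simp
  next
    fix x assume "x \<in> ?D"
    then show "0 \<le> 1 - S v k h x 0 + R v k h x 0" "S v k h x 0 \<le> 6"
      using init[of x] G_split[OF v, of k h x 0] by auto
  qed (use contS contR strict SM M(1) in auto)
  show ?thesis using that[OF \<phi>(1,2)] \<phi>(3,4) G_split[OF v] by metis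
qed

section \<open>Points of the curve on the axes\<close>

text \<open>Position of \<open>b i\<close> on the line through \<open>b v\<close> and
  \<open>b u\<close>, with 0 at \<open>v\<close> and 1 at \<open>u\<close>; for lattice points of
  the side the division is exact.\<close>

definition pos :: "nat \<Rightarrow> nat \<Rightarrow> nat \<Rightarrow> int" where
  "pos v u i = idot (b u - b v) (b i - b v) div idot (b u - b v) (b u - b v)"

text \<open>Homogeneous coordinates of the point on the axis of \<open>E\<close> at which the terms of \<open>u\<close> and \<open>v\<close>
  have the ratio \<open>- s\<close>.\<close>

definition edge_vec :: "(real \<times> real) set \<Rightarrow> nat \<Rightarrow> nat \<Rightarrow> real \<Rightarrow> nat \<Rightarrow> real" where
  "edge_vec E v u s i = (if i \<in> {1..N} \<and> pt i \<in> E then (- s * a v / a u) powi pos v u i else 0)"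

definition edge_poly :: "(real \<times> real) set \<Rightarrow> nat \<Rightarrow> nat \<Rightarrow> real \<Rightarrow> real" where
  "edge_poly E v u s = (\<Sum>i\<in>{1..N}. a i * edge_vec E v u s i) / a v"

lemma pos_eqI:
  assumes "bedge E v u" "b i - b v = (\<alpha> * fst (b u - b v), \<alpha> * snd (b u - b v))"
  shows "pos v u i = \<alpha>"
proof -
  have "b u - b v \<noteq> 0"
    using assms(1) bedge_range[OF assms(1)] b_eq_iff[of u v] unfolding bedge_def by auto
  then have "fst (b u - b v) \<noteq> 0 \<or> snd (b u - b v) \<noteq> 0" by (metis prod.collapse zero_prod_def)
  then have "idot (b u - b v) (b u - b v) \<noteq> 0"
    unfolding idot_def by (metis sum_squares_eq_zero_iff)
  moreover have "idot (b u - b v) (b i - b v) = \<alpha> * idot (b u - b v) (b u - b v)"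
    unfolding assms(2) idot_def fst_conv snd_conv by (simp only: distrib_left mult_ac)
  ultimately show ?thesis by (simp add: pos_def)
qed

lemma bedge_pos:
  assumes "bedge E v u" "i \<in> {1..N}" "pt i \<in> E"
  shows "b i - b v = (pos v u i * fst (b u - b v), pos v u i * snd (b u - b v))"
proof -
  obtain \<alpha> where \<alpha>: "b i - b v = (\<alpha> * fst (b u - b v), \<alpha> * snd (b u - b v))"
    using bedge_collinear[OF assms] .
  show ?thesis unfolding pos_eqI[OF assms(1) \<alpha>] by (rule \<alpha>)
qed

lemma pos_base: "bedge E v u \<Longrightarrow> pos v u v = 0" "bedge E v u \<Longrightarrow> pos v u u = 1"
  by (rule pos_eqI, assumption, simp add: prod_eq_iff)+

lemma pos_reverse:
  assumes "bedge E v u" "i \<in> {1..N}" "pt i \<in> E"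
  shows "pos u v i = 1 - pos v u i"
proof (rule pos_eqI[OF bedge_sym[OF assms(1)]])
  show "b i - b u = ((1 - pos v u i) * fst (b v - b u), (1 - pos v u i) * snd (b v - b u))"
    using bedge_pos[OF assms] by (simp add: prod_eq_iff algebra_simps)
qed

text \<open>The third vertex of a triangle on the edge lies off the side, so it differs from
  \<open>i\<close>, and \<open>b i\<close> has second coordinate 0 in that triangle.\<close>

lemma side_coeff:
  assumes "bedge E v u" "i \<in> {1..N}" "pt i \<in> E" "i \<notin> {v, u}"
  shows "c v i \<le> \<delta> * c v u powi pos v u i" "\<bar>pos v u i\<bar> \<le> int K"
proof -
  obtain w where w: "{v, u, w} \<in> T" "\<bar>det2 (b u - b v) (b w - b v)\<bar> = 1"
    using bedge_triangle[OF assms(1)] .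
  have "i \<noteq> w" using bedge_third_notin[OF assms(1) w] assms(3) by blast
  then have i: "i \<in> {1..N} - {v, u, w}" using assms(2,4) by blast
  have lc: "b i - b v = lincomb (b u - b v) (pos v u i) (b w - b v) 0"
    unfolding lincomb_def using bedge_pos[OF assms(1-3)] by simp
  show "c v i \<le> \<delta> * c v u powi pos v u i"
    using coeff_small[OF w(1) i lc] by (simp add: c_def)
  show "\<bar>pos v u i\<bar> \<le> int K"
    using coords_bounded[OF w(1) assms(2) lc] by simp
qed

definition others :: "(real \<times> real) set \<Rightarrow> nat \<Rightarrow> nat \<Rightarrow> nat set" where
  "others E v u = {i \<in> {1..N}. pt i \<in> E \<and> i \<notin> {v, u}}"

text \<open>The coefficient that remains at \<open>i\<close> on the axis once the terms of
  \<open>v\<close> and \<open>u\<close> are normalised to 1 and -s. In this scale it is at most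
  \<delta> in absolute value, whatever the exponent.\<close>

definition edge_coeff :: "nat \<Rightarrow> nat \<Rightarrow> nat \<Rightarrow> real" where
  "edge_coeff v u i = a i / a v * (- a v / a u) powi pos v u i"

lemma card_others: "real (card (others E v u)) \<le> real N"
proof -
  have "card (others E v u) \<le> card {1..N}" by (intro card_mono) (auto simp: others_def)
  then show ?thesis by simp
qed

lemma edge_coeff_small:
  assumes "bedge E v u" "i \<in> others E v u"
  shows "\<bar>edge_coeff v u i\<bar> \<le> \<delta>"
proof -
  have i: "i \<in> {1..N}" "pt i \<in> E" "i \<notin> {v, u}" using assms(2) by (auto simp: others_def)
  have r: "v \<in> {1..N}" "u \<in> {1..N}" using bedge_range[OF assms(1)] by blast+
  have cu: "0 < c v u" using c_pos[OF r] .
  have "\<bar>- a v / a u\<bar> = inverse (c v u)" by (simp add: c_def)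
  then have "\<bar>edge_coeff v u i\<bar> = c v i * inverse (c v u) powi pos v u i"
    by (simp add: edge_coeff_def abs_mult power_int_abs c_def)
  also have "\<dots> \<le> (\<delta> * c v u powi pos v u i) * inverse (c v u) powi pos v u i"
    using side_coeff(1)[OF assms(1) i] cu by (intro mult_right_mono) auto
  also have "\<dots> = \<delta> * (c v u * inverse (c v u)) powi pos v u i"
    by (simp add: power_int_mult_distrib)
  also have "\<dots> = \<delta>" using cu by simp
  finally show ?thesis .
qed

lemma edge_poly_split:
  assumes "bedge E v u"
  shows "edge_poly E v u s = 1 - s + (\<Sum>i\<in>others E v u. edge_coeff v u i * s powi pos v u i)"
proof -
  let ?f = "\<lambda>i. a i / a v * edge_vec E v u s i"
  have r: "v \<in> {1..N}" "u \<in> {1..N}" "v \<noteq> u" "pt v \<in> E" "pt u \<in> E"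
    using bedge_range[OF assms] assms unfolding bedge_def by blast+
  have nz: "a v \<noteq> 0" "a u \<noteq> 0" using a_nonzero r(1,2) by blast+
  have sub: "insert v (insert u (others E v u)) \<subseteq> {1..N}" using r by (auto simp: others_def)
  have fin: "finite (others E v u)" by (simp add: others_def)
  have "edge_poly E v u s = sum ?f {1..N}"
    by (simp add: edge_poly_def sum_divide_distrib)
  also have "\<dots> = sum ?f (insert v (insert u (others E v u)))"
    by (rule sum.mono_neutral_right[OF _ sub]) (auto simp: others_def edge_vec_def)
  also have "\<dots> = ?f v + (?f u + sum ?f (others E v u))"
    using fin r(3) by (simp add: others_def)
  also have "?f v = 1" using nz r pos_base(1)[OF assms] by (simp add: edge_vec_def)
  also have "?f u = - s" using nz r pos_base(2)[OF assms] by (simp add: edge_vec_def)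
  also have "sum ?f (others E v u) = (\<Sum>i\<in>others E v u. edge_coeff v u i * s powi pos v u i)"
  proof (rule sum.cong[OF refl])
    fix i assume "i \<in> others E v u"
    then have i: "i \<in> {1..N}" "pt i \<in> E" by (auto simp: others_def)
    have "(- s * a v / a u) = (- a v / a u) * s" by simp
    then have "(- s * a v / a u) powi pos v u i = (- a v / a u) powi pos v u i * s powi pos v u i"
      by (simp only: power_int_mult_distrib)
    then show "?f i = edge_coeff v u i * s powi pos v u i"
      unfolding edge_vec_def edge_coeff_def using i by (simp only: if_True simp_thms mult.assoc)
  qed
  finally show ?thesis by simp
qed

text \<open>The part 1 - s has slope -1, and on [1/2, 2] the other terms together have Lipschitz
  constant at most 1/8.\<close>

lemma edge_poly_strict_decreasing:
  assumes "bedge E v u" "1/2 \<le> s" "s < t" "t \<le> 2"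
  shows "edge_poly E v u t < edge_poly E v u s"
proof -
  have est: "\<bar>edge_coeff v u i * t powi pos v u i - edge_coeff v u i * s powi pos v u i\<bar>
      \<le> \<delta> * (4 * real K * 2 ^ K * (t - s))" if i: "i \<in> others E v u" for i
  proof -
    have p: "\<bar>pos v u i\<bar> \<le> int K" using side_coeff(2)[OF assms(1)] i by (auto simp: others_def)
    have "\<bar>edge_coeff v u i * t powi pos v u i - edge_coeff v u i * s powi pos v u i\<bar>
        = \<bar>edge_coeff v u i\<bar> * \<bar>t powi pos v u i - s powi pos v u i\<bar>"
      by (simp add: right_diff_distrib[symmetric] abs_mult)
    also have "\<dots> \<le> \<delta> * (4 * real K * 2 ^ K * (t - s))"
      using edge_coeff_small[OF assms(1) i] powi_bounds(2)[OF assms(2) less_imp_le[OF assms(3)] assms(4) p] delta_pos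
      by (intro mult_mono) auto
    finally show ?thesis .
  qed
  let ?r = "\<lambda>s. \<Sum>i\<in>others E v u. edge_coeff v u i * s powi pos v u i"
  have "?r t - ?r s \<le> (\<Sum>i\<in>others E v u. \<bar>edge_coeff v u i * t powi pos v u i - edge_coeff v u i * s powi pos v u i\<bar>)"
    unfolding sum_subtractf[symmetric] by (intro sum_mono) simp
  also have "\<dots> \<le> real (card (others E v u)) * (\<delta> * (4 * real K * 2 ^ K * (t - s)))"
    using est by (rule sum_bounded_above)
  also have "\<dots> \<le> real N * (\<delta> * (4 * real K * 2 ^ K * (t - s)))"
    using card_others delta_pos assms(3) by (intro mult_right_mono) auto
  also have "\<dots> = (real N * (\<delta> * (4 * real K * 2 ^ K))) * (t - s)" by (simp only: mult_ac)
  also have "\<dots> \<le> 1 / 8 * (t - s)" using delta_bound(2) assms(3) by (intro mult_right_mono) auto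
  finally have "?r t - ?r s \<le> 1 / 8 * (t - s)" .
  moreover have "1 - t + A < 1 - s + B" if "A - B \<le> 1 / 8 * (t - s)" for A B
    using that assms(3) by argo
  ultimately show ?thesis unfolding edge_poly_split[OF assms(1)] by blast
qed

text \<open>Stated for absolute values because negative ratios must be excluded later: a point of
  the curve on an axis is not known in advance to lie in the closure of the chosen quadrant.\<close>

lemma edge_poly_rest:
  assumes "bedge E v u" "1/2 \<le> \<bar>s\<bar>" "\<bar>s\<bar> \<le> 2"
  shows "\<bar>\<Sum>i\<in>others E v u. edge_coeff v u i * s powi pos v u i\<bar> \<le> 1 / 16"
proof -
  have est: "\<bar>edge_coeff v u i * s powi pos v u i\<bar> \<le> \<delta> * 2 ^ K" if i: "i \<in> others E v u" for i
  proof -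
    have p: "\<bar>pos v u i\<bar> \<le> int K" using side_coeff(2)[OF assms(1)] i by (auto simp: others_def)
    have "\<bar>edge_coeff v u i * s powi pos v u i\<bar> = \<bar>edge_coeff v u i\<bar> * \<bar>s\<bar> powi pos v u i"
      by (simp add: abs_mult power_int_abs)
    also have "\<dots> \<le> \<delta> * 2 ^ K"
      using edge_coeff_small[OF assms(1) i] powi_bounds(1)[OF assms(2) order_refl assms(3) p] delta_pos assms(2)
      by (intro mult_mono) auto
    finally show ?thesis .
  qed
  have "\<bar>\<Sum>i\<in>others E v u. edge_coeff v u i * s powi pos v u i\<bar>
      \<le> (\<Sum>i\<in>others E v u. \<bar>edge_coeff v u i * s powi pos v u i\<bar>)" by (rule sum_abs)
  also have "\<dots> \<le> real (card (others E v u)) * (\<delta> * 2 ^ K)"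
    using est by (rule sum_bounded_above)
  also have "\<dots> \<le> real N * (\<delta> * 2 ^ K)"
    using card_others delta_pos by (intro mult_right_mono) auto
  also have "\<dots> \<le> 1 / 16" by (rule delta_bound(3))
  finally show ?thesis .
qed

lemma edge_root_unique:
  assumes "bedge E v u" "1/2 \<le> s" "s \<le> 2" "edge_poly E v u s = 0"
    "1/2 \<le> t" "t \<le> 2" "edge_poly E v u t = 0"
  shows "s = t"
  using edge_poly_strict_decreasing[OF assms(1), of s t] edge_poly_strict_decreasing[OF assms(1), of t s] assms
  by (cases s t rule: linorder_cases) auto

lemma edge_root_exists:
  assumes "bedge E v u"
  shows "\<exists>s. 1/2 \<le> s \<and> s \<le> 2 \<and> edge_poly E v u s = 0"
proof -
  have "continuous_on {1/2..2} (edge_poly E v u)"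
    unfolding edge_poly_split[OF assms]
    by (intro continuous_intros) auto
  moreover have "edge_poly E v u 2 \<le> 0" "0 \<le> edge_poly E v u (1/2)"
    unfolding edge_poly_split[OF assms]
    using edge_poly_rest[OF assms, of 2] edge_poly_rest[OF assms, of "1/2"] by (auto simp: abs_le_iff)
  ultimately show ?thesis using IVT2'[of "edge_poly E v u" 2 0 "1/2"] by fastforce
qed

text \<open>The choice is determined, since the root in [1/2, 2] is unique.\<close>

definition edge_root :: "(real \<times> real) set \<Rightarrow> nat \<Rightarrow> nat \<Rightarrow> real" where
  "edge_root E v u = (SOME s. 1/2 \<le> s \<and> s \<le> 2 \<and> edge_poly E v u s = 0)"

lemma edge_root:
  assumes "bedge E v u"
  shows "1/2 \<le> edge_root E v u" "edge_root E v u \<le> 2" "edge_poly E v u (edge_root E v u) = 0"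
  using someI_ex[OF edge_root_exists[OF assms]] unfolding edge_root_def by blast+

definition edge_point :: "(real \<times> real) set \<Rightarrow> nat \<Rightarrow> nat \<Rightarrow> (nat \<Rightarrow> real) set" where
  "edge_point E v u = proj_class (edge_vec E v u (edge_root E v u))"

lemma edge_vec_reverse:
  assumes "bedge E v u" "s \<noteq> 0"
  shows "edge_vec E u v (inverse s) = (\<lambda>i. (- a u / (s * a v)) * edge_vec E v u s i)"
proof
  fix i
  have r: "v \<in> {1..N}" "u \<in> {1..N}" using bedge_range[OF assms(1)] by blast+
  have nz: "a v \<noteq> 0" "a u \<noteq> 0" using a_nonzero r by blast+
  show "edge_vec E u v (inverse s) i = (- a u / (s * a v)) * edge_vec E v u s i"
  proof (cases "i \<in> {1..N} \<and> pt i \<in> E")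
    case True
    define \<tau> where "\<tau> = - s * a v / a u"
    have \<tau>: "\<tau> \<noteq> 0" "- inverse s * a u / a v = inverse \<tau>" "- a u / (s * a v) = inverse \<tau>"
      using nz assms(2) by (auto simp: \<tau>_def divide_simps)
    have "inverse \<tau> powi (1 - pos v u i) = inverse \<tau> * \<tau> powi pos v u i"
      using \<tau>(1) by (simp add: power_int_diff power_int_inverse divide_simps)
    then show ?thesis
      using True unfolding edge_vec_def \<tau>(2,3) \<tau>_def[symmetric] by (simp add: pos_reverse[OF assms(1)])
  next
    case False
    show ?thesis unfolding edge_vec_def if_not_P[OF False] by simp
  qed
qed

text \<open>Exchanging \<open>u\<close> and \<open>v\<close> inverts the ratio \<open>s\<close> and
  rescales the vector. The interval [1/2, 2] is stable under inversion, so uniqueness of the root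
  identifies the two points.\<close>

lemma edge_point_sym:
  assumes "bedge E v u"
  shows "edge_point E v u = edge_point E u v"
proof -
  define s where "s = edge_root E v u"
  note s = edge_root[OF assms, folded s_def]
  have s0: "s \<noteq> 0" using s(1) by auto
  have r: "v \<in> {1..N}" "u \<in> {1..N}" using bedge_range[OF assms(1)] by blast+
  have nz: "a v \<noteq> 0" "a u \<noteq> 0" using a_nonzero r by blast+
  define l where "l = - a u / (s * a v)"
  have l: "l \<noteq> 0" using nz s0 by (simp add: l_def)
  note rev = edge_vec_reverse[OF assms s0, folded l_def]
  have "edge_poly E u v (inverse s) = l * (\<Sum>i\<in>{1..N}. a i * edge_vec E v u s i) / a u"
    unfolding edge_poly_def rev by (simp add: sum_distrib_left mult.left_commute)
  also have "(\<Sum>i\<in>{1..N}. a i * edge_vec E v u s i) = 0"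
    using s(3) nz(1) by (simp add: edge_poly_def)
  finally have "edge_poly E u v (inverse s) = 0" by simp
  moreover have "1/2 \<le> inverse s" "inverse s \<le> 2" using s(1,2) s0 by (auto simp: field_simps)
  ultimately have "inverse s = edge_root E u v"
    using edge_root_unique[OF bedge_sym[OF assms]] edge_root[OF bedge_sym[OF assms]] by blast
  then have "edge_point E u v = proj_class (\<lambda>i. l * edge_vec E v u s i)"
    unfolding edge_point_def using rev by simp
  then show ?thesis unfolding edge_point_def proj_class_scale[OF l] s_def by simp
qed

lemma side_normal:
  assumes "bedge E v u"
  obtains h where "\<forall>i\<in>{1..N}. 0 \<le> idot h (b i - b v)"
    "\<And>i. i \<in> {1..N} \<Longrightarrow> idot h (b i - b v) = 0 \<longleftrightarrow> pt i \<in> E"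
proof -
  obtain e where e: "e = 1 \<or> e = -1"
    "\<And>i. i \<in> {1..N} \<Longrightarrow> e * det2 (b u - b v) (b i - b v) \<ge> 0"
    "\<And>i. i \<in> {1..N} \<Longrightarrow> e * det2 (b u - b v) (b i - b v) = 0 \<longleftrightarrow> pt i \<in> E"
    using bedge_normal[OF assms] by blast
  have eq: "idot (- e * snd (b u - b v), e * fst (b u - b v)) z = e * det2 (b u - b v) z" for z
    unfolding idot_def det2_def fst_conv snd_conv by (simp only: right_diff_distrib mult_ac mult_minus_left) simp
  show ?thesis using that[of "(- e * snd (b u - b v), e * fst (b u - b v))"] e(2,3) unfolding eq by blast
qed

lemma link_side:
  assumes "E \<in> polygon_sides P" "pt v \<in> E" "i \<in> link v" "pt i \<in> E"
  shows "bedge E v i"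
  using assms unfolding bedge_def link_def by auto

lemma bedge_link: "bedge E v u \<Longrightarrow> u \<in> link v"
  unfolding bedge_def link_def by auto

text \<open>At \<open>y = 0\<close> only lattice points of \<open>E\<close> keep a nonzero
  coordinate. By \<open>link_term\<close> the quadrant sign at \<open>u\<close> is
  \<open>- c v u * a v / a u\<close>, so the chart runs through exactly the points with positive
  ratio \<open>s\<close>.\<close>

lemma chart_axis:
  assumes be: "bedge E v u" and h: "\<And>i. i \<in> {1..N} \<Longrightarrow> idot h (b i - b v) = 0 \<longleftrightarrow> pt i \<in> E" and x: "0 < x"
  shows "chart v k h x 0 = edge_vec E v u (c v u * x powi idot k (b u - b v))"
proof
  fix i
  have r: "v \<in> {1..N}" "u \<in> {1..N}" using bedge_range[OF be] by blast+
  have nz: "a v \<noteq> 0" "a u \<noteq> 0" using a_nonzero r by blast+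
  have qs: "quad_sign v (b u - b v) = - c v u * a v / a u"
    using link_term[OF bedge_link[OF be]] nz by (simp add: field_simps)
  show "chart v k h x 0 i = edge_vec E v u (c v u * x powi idot k (b u - b v)) i"
  proof (cases "i \<in> {1..N} \<and> pt i \<in> E")
    case True
    define \<alpha> where "\<alpha> = pos v u i"
    have d: "b i - b v = (\<alpha> * fst (b u - b v), \<alpha> * snd (b u - b v))"
      unfolding \<alpha>_def using bedge_pos[OF be] True by blast
    have kd: "idot k (b i - b v) = \<alpha> * idot k (b u - b v)"
      unfolding d idot_def fst_conv snd_conv by (simp only: distrib_left mult_ac)
    have "quad_sign v (b i - b v) = quad_sign v (b u - b v) powi \<alpha>"
      unfolding d quad_sign_def fst_conv snd_conv
      by (simp add: power_int_mult_distrib power_int_mult mult.commute[of \<alpha>])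
    moreover have "x powi idot k (b i - b v) = (x powi idot k (b u - b v)) powi \<alpha>"
      unfolding kd by (simp add: power_int_mult mult.commute[of \<alpha>])
    moreover have "idot h (b i - b v) = 0" using h True by blast
    ultimately have "chart v k h x 0 i = (quad_sign v (b u - b v) * x powi idot k (b u - b v)) powi \<alpha>"
      using True by (simp add: chart_def mon_def power_int_mult_distrib)
    also have "quad_sign v (b u - b v) * x powi idot k (b u - b v) = - (c v u * x powi idot k (b u - b v)) * a v / a u"
      unfolding qs by simp
    finally show ?thesis using True by (simp add: edge_vec_def \<alpha>_def)
  next
    case False
    then show ?thesis using h[of i] by (auto simp: chart_def mon_def edge_vec_def)
  qed
qed

lemma G_axis:
  assumes "bedge E v u" "\<And>i. i \<in> {1..N} \<Longrightarrow> idot h (b i - b v) = 0 \<longleftrightarrow> pt i \<in> E" "0 < x"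
  shows "G v k h x 0 = edge_poly E v u (c v u * x powi idot k (b u - b v))"
proof -
  have "chart v k h x 0 = edge_vec E v u (c v u * x powi idot k (b u - b v))"
    by (rule chart_axis[OF assms(1) _ assms(3)]) (rule assms(2))
  then show ?thesis by (simp only: G_def edge_poly_def)
qed

lemma S_axis:
  assumes h: "\<And>i. i \<in> {1..N} \<Longrightarrow> idot h (b i - b v) = 0 \<longleftrightarrow> pt i \<in> E"
    and I: "{i \<in> link v. pt i \<in> E} = I"
  shows "S v k h x 0 = (\<Sum>i\<in>I. c v i * x powi idot k (b i - b v))"
proof -
  have mon0: "mon v k h x 0 i = (if pt i \<in> E then x powi idot k (b i - b v) else 0)" if "i \<in> link v" for i
    using h[OF link_range[OF that]] by (cases "pt i \<in> E") (auto simp: mon_def)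
  have "S v k h x 0 = (\<Sum>i\<in>I. c v i * mon v k h x 0 i)"
    unfolding S_def using I mon0
    by (intro sum.mono_neutral_right[OF finite_link]) auto
  also have "\<dots> = (\<Sum>i\<in>I. c v i * x powi idot k (b i - b v))"
    using I mon0 by (intro sum.cong[OF refl]) auto
  finally show ?thesis .
qed

section \<open>Arcs of the curve\<close>

abbreviation PS :: "(nat \<Rightarrow> real) set topology" where
  "PS \<equiv> real_proj_space N"

abbreviation curve :: "(nat \<Rightarrow> real) set set" where
  "curve \<equiv> real_mirror_curve_closure b N a"

text \<open>The interior is required to lie in the torus, which keeps the arc off every axis that
  does not contain an endpoint. The parameter interval is free because the chart coordinate
  \<open>x\<close> serves as parameter.\<close>

definition arc_between :: "(nat \<Rightarrow> real) set \<Rightarrow> (nat \<Rightarrow> real) set \<Rightarrow> bool" where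
  "arc_between z z' \<longleftrightarrow> (\<exists>x1 x2 g. x1 < x2 \<and> continuous_map (top_of_set {x1..x2::real}) PS g \<and>
     inj_on g {x1..x2} \<and> g ` {x1..x2} \<subseteq> curve \<and> g x1 = z \<and> g x2 = z' \<and>
     (\<forall>x\<in>{x1<..<x2}. g x \<in> proj_class ` monomial_map b N ` real_torus))"

lemma chart_in_coord_space:
  assumes "v \<in> {1..N}"
  shows "chart v k h x y \<in> coord_space N - {\<lambda>i. 0}"
proof -
  have "chart v k h x y \<noteq> (\<lambda>i. 0)"
    using chart_center[OF assms, of k h x y] by (metis zero_neq_one)
  then show ?thesis by (auto simp: coord_space_def chart_def)
qed

text \<open>Follows the zero function of \<open>chart_graph\<close>. At interior \<open>x\<close>
  the value at \<open>y = 0\<close> is positive, so the zero has \<open>y > 0\<close> and the point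
  lies in the torus; uniqueness of the zero forces the prescribed endpoints, and these belong to the
  curve as limits of interior points.\<close>

lemma chart_arc:
  assumes v: "v \<in> {1..N}" and x12: "0 \<le> x1" "x1 < x2"
    and k: "0 < x1 \<or> (\<forall>i\<in>{1..N}. 0 \<le> idot k (b i - b v))"
    and h: "\<forall>i\<in>{1..N}. 0 \<le> idot h (b i - b v)"
    and w: "w \<in> link v" "0 < idot h (b w - b v)" "0 < x1 \<or> idot k (b w - b v) = 0"
    and u: "u \<in> {1..N}" "0 < idot k (b u - b v)" "idot h (b u - b v) = 0"
    and box: "\<And>x. x1 \<le> x \<Longrightarrow> x \<le> x2 \<Longrightarrow> S v k h x 0 \<le> 6"
    and pos: "\<And>x. x1 < x \<Longrightarrow> x < x2 \<Longrightarrow> 0 < G v k h x 0"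
    and ends: "0 \<le> G v k h x1 0" "G v k h x2 0 = 0"
    and y1: "0 \<le> y1" "S v k h x1 y1 \<le> 6" "G v k h x1 y1 = 0"
  shows "arc_between (proj_class (chart v k h x1 y1)) (proj_class (chart v k h x2 0))"
proof -
  let ?D = "{x1..x2}"
  have G0: "0 \<le> G v k h x 0" if "x1 \<le> x" "x \<le> x2" for x
    using pos[of x] ends that by (cases "x = x1 \<or> x = x2") auto
  obtain \<phi> where \<phi>: "continuous_on ?D \<phi>"
    "\<And>x. x \<in> ?D \<Longrightarrow> 0 \<le> \<phi> x" "\<And>x. x \<in> ?D \<Longrightarrow> G v k h x (\<phi> x) = 0"
    "\<And>x y. x \<in> ?D \<Longrightarrow> 0 \<le> y \<Longrightarrow> S v k h x y \<le> 6 \<Longrightarrow> G v k h x y = 0 \<Longrightarrow> y = \<phi> x"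
    by (rule chart_graph[OF v x12 k h w box G0]) blast+
  have e1: "\<phi> x1 = y1" using \<phi>(4)[of x1 y1] y1 x12 by simp
  have e2: "\<phi> x2 = 0" using \<phi>(4)[of x2 0] ends(2) x12 box[of x2] by simp
  define f where "f x = chart v k h x (\<phi> x)" for x
  define g where "g x = proj_class (f x)" for x
  have fV: "f ` ?D \<subseteq> coord_space N - {\<lambda>i. 0}"
    unfolding f_def by (rule image_subsetI) (rule chart_in_coord_space[OF v])
  have cf: "continuous_on ?D f"
  proof (rule continuous_on_coordinatewise_then_product)
    fix i
    show "continuous_on ?D (\<lambda>x. f x i)"
    proof (cases "i \<in> {1..N}")
      case True
      have "continuous_on ?D (\<lambda>x. mon v k h x (\<phi> x) i)"
      proof (rule continuous_on_mon)
        show "(\<forall>x\<in>?D. 0 < x) \<or> 0 \<le> idot k (b i - b v)" using k True by auto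
      qed (use x12 h True \<phi> in \<open>auto intro!: continuous_intros\<close>)
      then have "continuous_on ?D (\<lambda>x. quad_sign v (b i - b v) * mon v k h x (\<phi> x) i)"
        by (intro continuous_on_mult continuous_on_const)
      then show ?thesis using True by (simp add: f_def chart_def)
    next
      case False
      show ?thesis unfolding f_def chart_def if_not_P[OF False] by (rule continuous_on_const)
    qed
  qed
  have cg: "continuous_map (top_of_set ?D) PS g"
    unfolding g_def using continuous_map_proj_path[OF cf fV] .
  \<comment> \<open>Both representatives are 1 at \<open>v\<close>, so equal classes give equal
    vectors. The coordinate at \<open>u\<close> does not involve \<open>y\<close> and is a strictly
    increasing power of \<open>x\<close> up to sign.\<close>
  have inj: "inj_on g ?D"
  proof (rule inj_onI)
    fix x x' assume x: "x \<in> ?D" "x' \<in> ?D" and eq: "g x = g x'"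
    obtain t where t: "f x' = (\<lambda>i. t * f x i)"
      using proj_class_eqD[OF eq[unfolded g_def]] by blast
    have "f x' v = t * f x v" unfolding t ..
    then have "t = 1" using chart_center[OF v] by (simp add: f_def)
    then have "f x' u = f x u" unfolding t by simp
    then have eq: "x' powi idot k (b u - b v) = x powi idot k (b u - b v)"
      using u(1,3) abs_quad_sign[of v "b u - b v"] by (auto simp: f_def chart_def mon_def)
    have less: "y powi idot k (b u - b v) < y' powi idot k (b u - b v)" if "0 \<le> y" "y < y'" for y y' :: real
      using that u(2) by (intro power_int_strict_mono) auto
    have nn: "0 \<le> x" "0 \<le> x'" using x x12(1) by simp_all
    have "\<not> x < x'" using less[OF nn(1), of x'] unfolding eq by blast
    moreover have "\<not> x' < x" using less[OF nn(2), of x] unfolding eq by blast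
    ultimately show "x = x'" by simp
  qed
  have int: "g x \<in> proj_class ` monomial_map b N ` {z \<in> real_torus. mirror_poly b N a (fst z) (snd z) = 0}"
    if x: "x \<in> {x1<..<x2}" for x
  proof -
    have xD: "x \<in> ?D" "0 < x" using x x12 by auto
    have "\<phi> x \<noteq> 0" using \<phi>(3)[OF xD(1)] pos[of x] x by auto
    then have py: "0 < \<phi> x" using \<phi>(2)[OF xD(1)] by simp
    obtain z where z: "z \<in> real_torus" "proj_class (chart v k h x (\<phi> x)) = proj_class (monomial_map b N z)"
      "mirror_poly b N a (fst z) (snd z) = 0 \<longleftrightarrow> G v k h x (\<phi> x) = 0"
      using chart_torus[OF v xD(2) py] by blast
    have "z \<in> {z \<in> real_torus. mirror_poly b N a (fst z) (snd z) = 0}" using z \<phi>(3)[OF xD(1)] by blast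
    then show ?thesis unfolding g_def f_def z(2) by blast
  qed
  have "g ` ?D = g ` (top_of_set ?D closure_of {x1<..<x2})"
  proof -
    have "{x1..x2} \<inter> {x1<..<x2} = {x1<..<x2}" by auto
    then have "top_of_set ?D closure_of {x1<..<x2} = ?D"
      using x12(2) by (simp add: closure_of_subtopology euclidean_closure_of)
    then show ?thesis by simp
  qed
  also have "\<dots> \<subseteq> PS closure_of (g ` {x1<..<x2})"
    by (rule continuous_map_image_closure_subset[OF cg])
  also have "\<dots> \<subseteq> curve"
    unfolding real_mirror_curve_closure_def using int by (intro closure_of_mono) blast
  finally have sub: "g ` ?D \<subseteq> curve" .
  show ?thesis
    unfolding arc_between_def
  proof (intro exI conjI)
    show "g x1 = proj_class (chart v k h x1 y1)" "g x2 = proj_class (chart v k h x2 0)"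
      by (simp_all add: g_def f_def e1 e2)
    show "\<forall>x\<in>{x1<..<x2}. g x \<in> proj_class ` monomial_map b N ` real_torus"
      using int by blast
  qed (use x12 cg inj sub in auto)
qed

text \<open>With the inward normals of both sides, \<open>y = 0\<close> is the axis of
  \<open>E\<close> and \<open>x = 0\<close> that of \<open>F\<close>. On the axis of
  \<open>E\<close>, \<open>S\<close> is the single term of \<open>u\<close>, which grows from 0 to
  its root: below 1/2 the equation is positive because \<open>R\<close> is small, and from 1/2 on
  because the axis polynomial decreases to its zero.\<close>

lemma corner_arc:
  assumes E: "bedge E v u" and F: "bedge F v u'" and ne: "E \<noteq> F"
  shows "arc_between (edge_point F v u') (edge_point E v u)"
proof -
  have r: "v \<in> {1..N}" "u \<in> {1..N}" "u' \<in> {1..N}" using bedge_range E F by blast+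
  have sides: "E \<in> polygon_sides P" "F \<in> polygon_sides P" "pt v \<in> E" "pt v \<in> F" "pt u \<in> E" "pt u' \<in> F"
    "v \<noteq> u" "v \<noteq> u'"
    using E F unfolding bedge_def by auto
  have uF: "pt u \<notin> F" using side_unique[OF sides(1,2,3,5,4)] ne sides(7) b_eq_iff[OF r(1,2)] by auto
  have uE: "pt u' \<notin> E" using side_unique[OF sides(1,2,3) _ sides(4,6)] ne sides(8) b_eq_iff[OF r(1,3)] by auto
  obtain h where h: "\<forall>i\<in>{1..N}. 0 \<le> idot h (b i - b v)"
    "\<And>i. i \<in> {1..N} \<Longrightarrow> idot h (b i - b v) = 0 \<longleftrightarrow> pt i \<in> E"
    using side_normal[OF E] by blast
  obtain k where k: "\<forall>i\<in>{1..N}. 0 \<le> idot k (b i - b v)"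
    "\<And>i. i \<in> {1..N} \<Longrightarrow> idot k (b i - b v) = 0 \<longleftrightarrow> pt i \<in> F"
    using side_normal[OF F] by blast
  have ku: "0 < idot k (b u - b v)" using k(1) k(2)[OF r(2)] uF r(2) by (metis order_le_less)
  have hu': "0 < idot h (b u' - b v)" using h(1) h(2)[OF r(3)] uE r(3) by (metis order_le_less)
  have hu: "idot h (b u - b v) = 0" using h(2)[OF r(2)] sides(5) by blast
  have ku': "idot k (b u' - b v) = 0" using k(2)[OF r(3)] sides(6) by blast
  \<comment> \<open>A second neighbour on the same side would be opposite to \<open>w\<close>, and
    the normal of the other side would be negative on it.\<close>
  have only: "{i \<in> link v. pt i \<in> E0} = {w}"
    if be: "bedge E0 v w" and l: "\<forall>i\<in>{1..N}. 0 \<le> idot l (b i - b v)" "0 < idot l (b w - b v)" for E0 w l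
  proof
    show "{i \<in> link v. pt i \<in> E0} \<subseteq> {w}"
    proof
      fix i assume i: "i \<in> {i \<in> link v. pt i \<in> E0}"
      have bi: "bedge E0 v i" using link_side[of E0 v i] i be unfolding bedge_def by blast
      have "idot l (b i - b v) \<ge> 0" using l(1) i link_range by blast
      show "i \<in> {w}"
      proof (rule ccontr)
        assume "i \<notin> {w}"
        then have "b i - b v = - (b w - b v)" using bedge_opposite[OF be bi] by blast
        then have "idot l (b i - b v) = - idot l (b w - b v)" by (simp only: idot_uminus)
        then show False using \<open>idot l (b i - b v) \<ge> 0\<close> l(2) by linarith
      qed
    qed
    show "{w} \<subseteq> {i \<in> link v. pt i \<in> E0}" using bedge_link[OF be] be unfolding bedge_def by blast
  qed
  have Sx: "S v k h x 0 = c v u * x powi idot k (b u - b v)" for x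
    using S_axis[OF h(2) only[OF E k(1) ku]] by simp
  have Sy: "S v h k y 0 = c v u' * y powi idot h (b u' - b v)" for y
    using S_axis[OF k(2) only[OF F h(1) hu']] by simp
  have cu: "0 < c v u" "0 < c v u'" using c_pos r by blast+
  define s where "s = edge_root E v u"
  note s = edge_root[OF E, folded s_def]
  define s' where "s' = edge_root F v u'"
  note s' = edge_root[OF F, folded s'_def]
  have "0 < s / c v u" "0 < s' / c v u'" using s(1) s'(1) cu by auto
  then obtain x2 y1 where x2: "0 < x2" "x2 powi idot k (b u - b v) = s / c v u"
    and y1: "0 < y1" "y1 powi idot h (b u' - b v) = s' / c v u'"
    using power_int_root_exists[OF _ ku] power_int_root_exists[OF _ hu'] by metis
  have cx2: "c v u * x2 powi idot k (b u - b v) = s" using x2(2) cu by simp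
  have cy1: "c v u' * y1 powi idot h (b u' - b v) = s'" using y1(2) cu by simp
  have Gx: "G v k h x 0 = edge_poly E v u (c v u * x powi idot k (b u - b v))" if "0 < x" for x
    by (rule G_axis[OF E _ that]) (rule h(2))
  have lt: "c v u * x powi idot k (b u - b v) < s" if "0 \<le> x" "x < x2" for x
    unfolding cx2[symmetric] using that ku cu by (intro mult_strict_left_mono power_int_strict_mono) auto
  have le: "c v u * x powi idot k (b u - b v) \<le> s" if "0 \<le> x" "x \<le> x2" for x
    unfolding cx2[symmetric] using that ku cu by (intro mult_left_mono power_int_mono) auto
  have box: "S v k h x 0 \<le> 6" if "0 \<le> x" "x \<le> x2" for x
    unfolding Sx using le[OF that] s(2) by simp
  have pos: "0 < G v k h x 0" if x: "0 \<le> x" "x < x2" for x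
  proof (cases "1/2 \<le> c v u * x powi idot k (b u - b v)")
    case True
    then have "0 < x" using x ku by (cases "x = 0") auto
    then show ?thesis
      using Gx edge_poly_strict_decreasing[OF E True lt[OF x] s(2)] s(3) by simp
  next
    case False
    have xb: "S v k h x 0 \<le> 6" using box x by simp
    have "\<bar>R v k h x 0\<bar> \<le> S v k h x 0 / 16"
      using S_R_estimates(2)[OF r(1) x(1) disjI2[OF k(1)] h(1) order_refl order_refl xb] .
    moreover have "S v k h x 0 < 1/2" using False unfolding Sx by simp
    ultimately show ?thesis unfolding G_split[OF r(1)] by (auto simp: abs_le_iff)
  qed
  have Gx2: "G v k h x2 0 = 0" using Gx[OF x2(1)] cx2 s(3) by simp
  have Gy: "G v k h 0 y1 = 0"
  proof -
    have "G v h k y1 0 = edge_poly F v u' (c v u' * y1 powi idot h (b u' - b v))"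
      by (rule G_axis[OF F _ y1(1)]) (rule k(2))
    then show ?thesis unfolding G_swap[of v k h] cy1 s'(3) .
  qed
  have Sy1: "S v k h 0 y1 \<le> 6" unfolding S_swap[of v k h] Sy cy1 using s'(2) by simp
  have "arc_between (proj_class (chart v k h 0 y1)) (proj_class (chart v k h x2 0))"
    by (rule chart_arc[OF r(1) order_refl x2(1) disjI2[OF k(1)] h(1) bedge_link[OF F] hu' disjI2[OF ku'] r(2) ku hu])
       (use box less_imp_le[OF pos[of 0]] pos Gx2 y1 Sy1 Gy x2(1) in auto)
  moreover have "chart v k h 0 y1 = edge_vec F v u' s'"
  proof -
    have "chart v h k y1 0 = edge_vec F v u' (c v u' * y1 powi idot h (b u' - b v))"
      by (rule chart_axis[OF F _ y1(1)]) (rule k(2))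
    then show ?thesis unfolding chart_swap[of v k h] cy1 .
  qed
  moreover have "chart v k h x2 0 = edge_vec E v u s"
  proof -
    have "chart v k h x2 0 = edge_vec E v u (c v u * x2 powi idot k (b u - b v))"
      by (rule chart_axis[OF E _ x2(1)]) (rule h(2))
    then show ?thesis unfolding cx2 .
  qed
  ultimately show ?thesis by (simp add: edge_point_def s_def s'_def)
qed

text \<open>The opposite neighbour sits at position -1, so the bound by \<delta> times the inverse
  of \<open>c v u\<close> is a bound for the product.\<close>

lemma opposite_coeff_small:
  assumes E: "bedge E v u" and E': "bedge E v u'" and ne: "u \<noteq> u'"
  shows "c v u * c v u' \<le> \<delta>"
proof -
  have r: "v \<in> {1..N}" "u \<in> {1..N}" "u' \<in> {1..N}" using bedge_range E E' by blast+
  have side: "pt u' \<in> E" "v \<noteq> u'" using E' unfolding bedge_def by auto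
  have "b u' - b v = (- 1 * fst (b u - b v), - 1 * snd (b u - b v))"
    unfolding bedge_opposite[OF E E' ne] by (simp add: prod_eq_iff)
  then have "pos v u u' = - 1" by (rule pos_eqI[OF E])
  then have "c v u' \<le> \<delta> * inverse (c v u)"
    using side_coeff(1)[OF E r(3) side(1)] ne side(2) by (simp add: power_int_minus)
  then show ?thesis using c_pos[OF r(1,2)] by (simp add: field_simps)
qed

text \<open>Here \<open>k\<close> points along the side from \<open>v\<close> to \<open>u\<close>
  and \<open>x\<close> stays positive: the term \<open>A\<close> of \<open>u\<close> grows, the term
  \<open>B\<close> of \<open>u'\<close> decays, and their product is a constant at most \<delta>.
  The arc starts where \<open>B\<close> equals its root and ends where \<open>A\<close>
  does.\<close>

lemma collinear_arc:
  assumes E: "bedge E v u" and E': "bedge E v u'" and ne: "u \<noteq> u'"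
  shows "arc_between (edge_point E v u') (edge_point E v u)"
proof -
  have r: "v \<in> {1..N}" "u \<in> {1..N}" "u' \<in> {1..N}" using bedge_range E E' by blast+
  have side: "E \<in> polygon_sides P" "pt v \<in> E" "pt u \<in> E" "pt u' \<in> E" "v \<noteq> u" "v \<noteq> u'"
    using E E' unfolding bedge_def by auto
  have opp: "b u' - b v = - (b u - b v)" using bedge_opposite[OF E E' ne] .
  obtain h where h: "\<forall>i\<in>{1..N}. 0 \<le> idot h (b i - b v)"
    "\<And>i. i \<in> {1..N} \<Longrightarrow> idot h (b i - b v) = 0 \<longleftrightarrow> pt i \<in> E"
    using side_normal[OF E] by blast
  define k where "k = b u - b v"
  define \<kappa> where "\<kappa> = idot k (b u - b v)"
  have \<kappa>: "0 < \<kappa>"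
  proof -
    have "b u - b v \<noteq> 0" using b_eq_iff[OF r(1,2)] side(5) by auto
    then have "fst (b u - b v) \<noteq> 0 \<or> snd (b u - b v) \<noteq> 0" by (metis prod.collapse zero_prod_def)
    then show ?thesis unfolding \<kappa>_def k_def idot_def
      by (metis sum_squares_gt_zero_iff)
  qed
  have ku': "idot k (b u' - b v) = - \<kappa>" unfolding opp idot_uminus \<kappa>_def ..
  obtain w where w: "{v, u, w} \<in> T" "\<bar>det2 (b u - b v) (b w - b v)\<bar> = 1"
    using bedge_triangle[OF E] .
  have wl: "w \<in> link v" using w(1) triangle_distinct[OF w(2)] unfolding link_def by blast
  have wE: "pt w \<notin> E" using bedge_third_notin[OF E w] .
  have hw: "0 < idot h (b w - b v)"
    using h(1) h(2)[OF link_range[OF wl]] wE link_range[OF wl] by (metis order_le_less)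
  have hu: "idot h (b u - b v) = 0" using h(2)[OF r(2)] side(3) by blast
  have only: "{i \<in> link v. pt i \<in> E} = {u, u'}"
  proof
    show "{i \<in> link v. pt i \<in> E} \<subseteq> {u, u'}"
    proof
      fix i assume i: "i \<in> {i \<in> link v. pt i \<in> E}"
      have bi: "bedge E v i" using link_side[OF side(1,2)] i by blast
      show "i \<in> {u, u'}"
      proof (rule ccontr)
        assume n: "i \<notin> {u, u'}"
        have "b i - b v = b u' - b v" using bedge_opposite[OF E bi] n opp by auto
        then have "b i = b u'" by simp
        then show False using b_eq_iff[OF _ r(3)] i link_range n by blast
      qed
    qed
    show "{u, u'} \<subseteq> {i \<in> link v. pt i \<in> E}" using bedge_link[OF E] bedge_link[OF E'] side by blast
  qed
  have Sx: "S v k h x 0 = c v u * x powi \<kappa> + c v u' * x powi (- \<kappa>)" for x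
    using S_axis[OF h(2) only, where k = k and x = x] ne by (simp add: \<kappa>_def[symmetric] ku')
  have cu: "0 < c v u" "0 < c v u'" using c_pos r by blast+
  have prod: "c v u * c v u' \<le> \<delta>" using opposite_coeff_small[OF E E' ne] .
  have d64: "\<delta> \<le> 1 / 64" using delta_bound(4) r(1) by auto
  define s where "s = edge_root E v u"
  note s = edge_root[OF E, folded s_def]
  define s' where "s' = edge_root E v u'"
  note s' = edge_root[OF E', folded s'_def]
  have s0: "0 < s / c v u" "0 < c v u' / s'" using s(1) s'(1) cu by auto
  obtain x1 where x1: "0 < x1" "x1 powi \<kappa> = c v u' / s'"
    using power_int_root_exists[OF s0(2) \<kappa>] by metis
  obtain x2 where x2: "0 < x2" "x2 powi \<kappa> = s / c v u"
    using power_int_root_exists[OF s0(1) \<kappa>] by metis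
  have mono: "x powi \<kappa> < y powi \<kappa>" if "0 < x" "x < y" for x y :: real
    using that \<kappa> by (intro power_int_strict_mono) auto
  \<comment> \<open>Both roots are at least 1/2, so their product is far above that of the
    coefficients; this puts the two endpoints in the right order.\<close>
  have "(1/2) * (1/2) \<le> s * s'" using s(1) s'(1) by (intro mult_mono) auto
  then have "c v u * c v u' < s * s'" using prod d64 by linarith
  then have "x1 powi \<kappa> < x2 powi \<kappa>"
    unfolding x1(2) x2(2) using cu s'(1) by (simp add: field_simps)
  then have x12: "x1 < x2" using mono[OF x2(1), of x1] by (cases x1 x2 rule: linorder_cases) auto
  define A where "A x = c v u * x powi \<kappa>" for x :: real
  define B where "B x = c v u' * x powi (- \<kappa>)" for x :: real
  have A2: "A x2 = s" using x2(2) cu by (simp add: A_def)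
  have B1: "B x1 = s'" using x1(2) cu s'(1) by (simp add: B_def power_int_minus)
  have Alt: "A x < s" if "0 < x" "x < x2" for x
    unfolding A2[symmetric] A_def using mono[OF that] cu by simp
  have Blt: "B x < s'" if "x1 < x" for x
  proof -
    have "inverse (x powi \<kappa>) < inverse (x1 powi \<kappa>)"
      using mono[OF x1(1) that] x1(1) by (intro less_imp_inverse_less) auto
    then show ?thesis unfolding B1[symmetric] B_def power_int_minus using cu by simp
  qed
  have AB: "A x * B x \<le> \<delta>" "0 \<le> A x" "0 \<le> B x" if "0 < x" for x
  proof -
    have "A x * B x = c v u * c v u'" using that by (simp add: A_def B_def power_int_minus)
    then show "A x * B x \<le> \<delta>" using prod by simp
  qed (use that cu in \<open>auto simp: A_def B_def\<close>)
  have GA: "G v k h x 0 = edge_poly E v u (A x)" if "0 < x" for x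
    unfolding A_def \<kappa>_def by (rule G_axis[OF E _ that]) (rule h(2))
  have GB: "G v k h x 0 = edge_poly E v u' (B x)" if "0 < x" for x
    unfolding B_def ku'[symmetric] by (rule G_axis[OF E' _ that]) (rule h(2))
  have box: "S v k h x 0 \<le> 6" if x: "x1 \<le> x" "x \<le> x2" for x
  proof -
    have "A x \<le> s" using Alt[of x] A2 x x1(1) by (cases "x = x2") auto
    moreover have "B x \<le> s'" using Blt[of x] B1 x by (cases "x = x1") auto
    ultimately show ?thesis using Sx[of x] s(2) s'(2) by (simp add: A_def B_def)
  qed
  have pos: "0 < G v k h x 0" if x: "x1 < x" "x < x2" for x
  proof -
    have x0: "0 < x" using x x1(1) by simp
    consider "1/2 \<le> A x" | "1/2 \<le> B x" | "A x < 1/2" "B x < 1/2" by linarith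
    then show ?thesis
    proof cases
      case 1
      then show ?thesis
        using edge_poly_strict_decreasing[OF E 1 Alt[OF x0 x(2)] s(2)] s(3) GA[OF x0] by simp
    next
      case 2
      then show ?thesis
        using edge_poly_strict_decreasing[OF E' 2 Blt[OF x(1)] s'(2)] s'(3) GB[OF x0] by simp
    next
      case 3
      \<comment> \<open>Two terms above 1/8 would have a product above 1/64. Hence the two terms sum
        to at most 5/8, which leaves the equation positive.\<close>
      have "A x \<le> 1/8 \<or> B x \<le> 1/8"
      proof (rule ccontr)
        assume "\<not> (A x \<le> 1/8 \<or> B x \<le> 1/8)"
        then have "(1/8) * (1/8) < A x * B x" by (intro mult_strict_mono) auto
        then show False using AB(1)[OF x0] d64 by linarith
      qed
      then have S58: "S v k h x 0 \<le> 5/8" using 3 Sx[of x] by (auto simp: A_def B_def)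
      have xb: "S v k h x 0 \<le> 6" using S58 by simp
      have "\<bar>R v k h x 0\<bar> \<le> S v k h x 0 / 16"
        using S_R_estimates(2)[OF r(1) less_imp_le[OF x0] disjI1[OF x0] h(1) order_refl order_refl xb] .
      then show ?thesis unfolding G_split[OF r(1)] using S58 by (auto simp: abs_le_iff)
    qed
  qed
  have G2: "G v k h x2 0 = 0" using GA[OF x2(1)] A2 s(3) by simp
  have G1: "G v k h x1 0 = 0" using GB[OF x1(1)] B1 s'(3) by simp
  have "arc_between (proj_class (chart v k h x1 0)) (proj_class (chart v k h x2 0))"
    by (rule chart_arc[OF r(1) less_imp_le[OF x1(1)] x12 disjI1[OF x1(1)] h(1) wl hw disjI1[OF x1(1)] r(2) \<kappa>[unfolded \<kappa>_def] hu])
       (use box pos G1 G2 x12 in auto)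
  moreover have "chart v k h x1 0 = edge_vec E v u' s'"
    unfolding B1[symmetric] B_def ku'[symmetric] by (rule chart_axis[OF E' _ x1(1)]) (rule h(2))
  moreover have "chart v k h x2 0 = edge_vec E v u s"
    unfolding A2[symmetric] A_def \<kappa>_def by (rule chart_axis[OF E _ x2(1)]) (rule h(2))
  ultimately show ?thesis by (simp add: edge_point_def s_def s'_def)
qed

text \<open>The binomial equations between the monomials, and the linear equation of the curve; they
  pass to the closure.\<close>

definition curve_eqs :: "(nat \<Rightarrow> real) \<Rightarrow> bool" where
  "curve_eqs x \<longleftrightarrow> (\<Sum>i\<in>{1..N}. a i * x i) = 0 \<and>
     (\<forall>v\<in>{1..N}. \<forall>u\<in>{1..N}. \<forall>j\<in>{1..N}. \<forall>n. b j - b v = (int n * fst (b u - b v), int n * snd (b u - b v)) \<longrightarrow>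
        x j * x v ^ n = x u ^ n * x v) \<and>
     (\<forall>v\<in>{1..N}. \<forall>u\<in>{1..N}. \<forall>j\<in>{1..N}. b j - b v = - (b u - b v) \<longrightarrow> x u * x j = x v ^ 2)"

lemma closed_imp_const: "closed {x. Q x} \<Longrightarrow> closed {x. R0 \<longrightarrow> Q x}"
  by (cases R0) simp_all

lemma closed_curve_eqs: "closed {x. curve_eqs x}"
  unfolding curve_eqs_def Ball_def
  by (intro closed_Collect_conj closed_Collect_all closed_imp_const closed_Collect_eq
      continuous_on_sum continuous_on_mult continuous_on_power continuous_on_const continuous_on_product_coordinates)

lemma curve_eqs_scale:
  assumes "curve_eqs x"
  shows "curve_eqs (\<lambda>i. t * x i)"
proof -
  have "(\<Sum>i\<in>{1..N}. a i * (t * x i)) = t * (\<Sum>i\<in>{1..N}. a i * x i)"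
    by (simp add: sum_distrib_left mult.left_commute)
  moreover have "t * x j * (t * x v) ^ n = (t * x u) ^ n * (t * x v)" if "x j * x v ^ n = x u ^ n * x v" for j v u n
  proof -
    have "t * x j * (t * x v) ^ n = t ^ Suc n * (x j * x v ^ n)" by (simp add: power_mult_distrib mult_ac)
    then show ?thesis unfolding that by (simp add: power_mult_distrib mult_ac)
  qed
  moreover have "t * x u * (t * x j) = (t * x v) ^ 2" if "x u * x j = x v ^ 2" for j v u
  proof -
    have "t * x u * (t * x j) = t ^ 2 * (x u * x j)" by (simp add: power2_eq_square mult_ac)
    then show ?thesis unfolding that by (simp add: power_mult_distrib)
  qed
  ultimately show ?thesis
    using assms unfolding curve_eqs_def by (intro conjI ballI allI impI) (simp, blast, blast)
qed

lemma curve_eqs_torus: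
  assumes z: "z \<in> real_torus" "mirror_poly b N a (fst z) (snd z) = 0"
  shows "curve_eqs (monomial_map b N z)"
proof -
  let ?m = "monomial_map b N z"
  have XY: "fst z \<noteq> 0" "snd z \<noteq> 0" using z(1) by (auto simp: real_torus_def)
  have m: "?m i = fst z powi fst (b i) * snd z powi snd (b i)" if "i \<in> {1..N}" for i
    using that by (simp add: monomial_map_def)
  define q where "q d = fst z powi fst d * snd z powi snd d" for d :: "int \<times> int"
  have mq: "?m i = ?m v * q (b i - b v)" if "i \<in> {1..N}" "v \<in> {1..N}" for i v
  proof -
    have e: "fst z powi fst (b i) = fst z powi fst (b v) * fst z powi fst (b i - b v)"
      "snd z powi snd (b i) = snd z powi snd (b v) * snd z powi snd (b i - b v)"
      using power_int_add[OF disjI1[OF XY(1)], of "fst (b v)" "fst (b i - b v)"]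
        power_int_add[OF disjI1[OF XY(2)], of "snd (b v)" "snd (b i - b v)"] by simp_all
    show ?thesis unfolding m[OF that(1)] m[OF that(2)] q_def e by (simp only: mult_ac)
  qed
  have "(\<Sum>i\<in>{1..N}. a i * ?m i) = mirror_poly b N a (fst z) (snd z)"
    unfolding mirror_poly_def by (intro sum.cong[OF refl]) (simp add: m mult.assoc)
  then have 1: "(\<Sum>i\<in>{1..N}. a i * ?m i) = 0" using z(2) by simp
  have 2: "?m j * ?m v ^ n = ?m u ^ n * ?m v"
    if r: "v \<in> {1..N}" "u \<in> {1..N}" "j \<in> {1..N}" and d: "b j - b v = (int n * fst (b u - b v), int n * snd (b u - b v))"
    for v u j n
  proof -
    have "q (b j - b v) = q (b u - b v) ^ n"
      unfolding d q_def fst_conv snd_conv power_int_mult_nat by (simp add: power_mult_distrib)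
    then show ?thesis
      unfolding mq[OF r(3,1)] mq[OF r(2,1)] by (simp only: power_mult_distrib mult_ac)
  qed
  have 3: "?m u * ?m j = ?m v ^ 2"
    if r: "v \<in> {1..N}" "u \<in> {1..N}" "j \<in> {1..N}" and d: "b j - b v = - (b u - b v)" for v u j
  proof -
    have "q d * q (- d) = 1" for d
      using XY by (simp add: q_def power_int_minus field_simps)
    then have "q (b u - b v) * q (b j - b v) = 1" unfolding d .
    then have "?m v * q (b u - b v) * (?m v * q (b j - b v)) = ?m v ^ 2"
      by (simp add: power2_eq_square mult_ac)
    then show ?thesis
      unfolding mq[OF r(3,1), symmetric] mq[OF r(2,1), symmetric] .
  qed
  show ?thesis unfolding curve_eqs_def
    by (intro conjI ballI allI impI; (rule 1 | (rule 2; assumption) | (rule 3; assumption)))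
qed

lemma curve_homogeneous:
  assumes "z \<in> curve"
  obtains x where "z = proj_class x" "x \<in> coord_space N - {\<lambda>i. 0}" "curve_eqs x"
proof (cases "N = 0")
  case True
  have "coord_space N - {\<lambda>i. 0} = {}" using True by (auto simp: coord_space_def)
  then have "topspace PS = {}" by (simp add: topspace_real_proj_space)
  then have "curve = {}" unfolding real_mirror_curve_closure_def using closure_of_subset_topspace[of PS] by blast
  then show ?thesis using assms by simp
next
  case False
  let ?M = "monomial_map b N ` {z \<in> real_torus. mirror_poly b N a (fst z) (snd z) = 0}"
  have "x \<in> coord_space N - {\<lambda>i. 0}" if x: "x \<in> ?M" for x
  proof -
    obtain y where y: "y \<in> real_torus" "x = monomial_map b N y" using x by blast
    have "x 1 \<noteq> 0" using y False by (auto simp: monomial_map_def real_torus_def)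
    then have "x \<noteq> (\<lambda>i. 0)" by metis
    then show ?thesis unfolding y(2) by (auto simp: coord_space_def monomial_map_def)
  qed
  then have sub: "?M \<subseteq> coord_space N - {\<lambda>i. 0}" by blast
  obtain x where "x \<in> coord_space N - {\<lambda>i. 0}" "z = proj_class x" "curve_eqs x"
  proof (rule proj_closure_condition[OF closed_curve_eqs _ sub])
    show "curve_eqs x" if "x \<in> ?M" for x using that curve_eqs_torus by blast
    show "z \<in> PS closure_of (proj_class ` ?M)"
      using assms unfolding real_mirror_curve_closure_def .
  qed (use curve_eqs_scale in blast)+
  then show ?thesis using that by blast
qed

text \<open>The inward normal is nonnegative on the two edge vectors of the cone and vanishes on
  \<open>b j - b v\<close>, so an edge vector that occurs with a positive coefficient lies along the
  side; only one of the two can.\<close>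

lemma side_ray:
  assumes F: "F \<in> polygon_sides P" and v: "v \<in> {1..N}" "pt v \<in> F" and j: "j \<in> {1..N}" "pt j \<in> F" "j \<noteq> v"
  obtains u n where "bedge F v u" "n \<ge> 1" "b j - b v = (int n * fst (b u - b v), int n * snd (b u - b v))"
proof -
  obtain u0 where u0: "bedge F v u0" using bedge_at_vertex[OF F v] .
  obtain h where h: "\<forall>i\<in>{1..N}. 0 \<le> idot h (b i - b v)"
    "\<And>i. i \<in> {1..N} \<Longrightarrow> idot h (b i - b v) = 0 \<longleftrightarrow> pt i \<in> F"
    using side_normal[OF u0] by blast
  obtain u w \<alpha> \<beta> where uw: "{v, u, w} \<in> T" "\<bar>det2 (b u - b v) (b w - b v)\<bar> = 1"
    and lc: "b j - b v = (int \<alpha> * fst (b u - b v) + int \<beta> * fst (b w - b v),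
                  int \<alpha> * snd (b u - b v) + int \<beta> * snd (b w - b v))"
    using cone_coords[OF v(1) j(1)] .
  note dist = triangle_distinct[OF uw(2)]
  have r: "u \<in> {1..N}" "w \<in> {1..N}" using triangle_subset[OF uw(1)] by blast+
  have "idot h (b j - b v) = int \<alpha> * idot h (b u - b v) + int \<beta> * idot h (b w - b v)"
    unfolding lc lincomb_def[symmetric] by (rule idot_lincomb)
  moreover have "idot h (b j - b v) = 0" using h(2) j by blast
  moreover have "0 \<le> int \<alpha> * idot h (b u - b v)" "0 \<le> int \<beta> * idot h (b w - b v)" using h(1) r by simp_all
  ultimately have z: "int \<alpha> * idot h (b u - b v) = 0" "int \<beta> * idot h (b w - b v) = 0" by linarith+
  have nv: "b j - b v \<noteq> 0" using b_eq_iff[OF j(1) v(1)] j(3) by auto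
  show ?thesis
  proof (cases "pt u \<in> F")
    case True
    have be: "bedge F v u" using F v(2) True dist(1) uw(1) unfolding bedge_def by blast
    have "pt w \<notin> F" using bedge_third_notin[OF be uw] .
    then have "idot h (b w - b v) \<noteq> 0" using h(2)[OF r(2)] by blast
    then have "\<beta> = 0" using z(2) by simp
    then have eq: "b j - b v = (int \<alpha> * fst (b u - b v), int \<alpha> * snd (b u - b v))" using lc by simp
    have "\<alpha> \<noteq> 0"
    proof
      assume "\<alpha> = 0"
      then have "b j - b v = 0" unfolding eq by (simp add: zero_prod_def)
      then show False using nv by blast
    qed
    then show ?thesis using that[OF be _ eq] by simp
  next
    case False
    then have "idot h (b u - b v) \<noteq> 0" using h(2)[OF r(1)] by blast
    then have \<alpha>: "\<alpha> = 0" using z(1) by simp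
    then have eq: "b j - b v = (int \<beta> * fst (b w - b v), int \<beta> * snd (b w - b v))" using lc by simp
    have \<beta>: "\<beta> \<noteq> 0"
    proof
      assume "\<beta> = 0"
      then have "b j - b v = 0" unfolding eq by (simp add: zero_prod_def)
      then show False using nv by blast
    qed
    then have "pt w \<in> F" using z(2) h(2)[OF r(2)] by simp
    then have "bedge F v w"
      unfolding bedge_def using F v(2) dist(2) by (intro conjI bexI[OF _ uw(1)]) auto
    then show ?thesis using that[OF _ _ eq] \<beta> by simp
  qed
qed

text \<open>Let \<open>v\<close> carry the term of largest absolute value and \<open>u\<close> the
  largest among its neighbours on the side. The terms sum to 0, so that of \<open>v\<close> must be
  balanced. Terms beyond the neighbours are at most \<delta> relative to it, and a neighbour
  opposite to \<open>u\<close> contributes at most 1/4, so \<open>u\<close> has to balance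
  \<open>v\<close>; the binomial equations then express all coordinates by the ratio of these
  two.\<close>

lemma axis_point:
  assumes z: "z \<in> curve" and F: "F \<in> polygon_sides P" and ax: "z \<in> toric_axis b N F"
  obtains v u where "bedge F v u" "z = edge_point F v u"
proof -
  obtain x where x: "z = proj_class x" "x \<in> coord_space N - {\<lambda>i. 0}" "curve_eqs x"
    using curve_homogeneous[OF z] .
  have off: "x i = 0" if "i \<in> {1..N}" "pt i \<notin> F" for i
    using ax that proj_class_self[of x] unfolding toric_axis_def x(1) by blast
  have lin: "(\<Sum>i\<in>{1..N}. a i * x i) = 0" using x(3) unfolding curve_eqs_def by blast
  have bin: "x j * x v ^ n = x u ^ n * x v"
    if "v \<in> {1..N}" "u \<in> {1..N}" "j \<in> {1..N}" "b j - b v = (int n * fst (b u - b v), int n * snd (b u - b v))" for v u j n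
    using x(3) that unfolding curve_eqs_def by blast
  have sq: "x u * x j = x v ^ 2"
    if "v \<in> {1..N}" "u \<in> {1..N}" "j \<in> {1..N}" "b j - b v = - (b u - b v)" for v u j
    using x(3) that unfolding curve_eqs_def by blast
  obtain i0 where i0: "x i0 \<noteq> 0" using x(2) by fastforce
  have i0N: "i0 \<in> {1..N}" using x(2) i0 unfolding coord_space_def by blast
  have fin: "finite ((\<lambda>i. \<bar>a i * x i\<bar>) ` {1..N})" by simp
  have "Max ((\<lambda>i. \<bar>a i * x i\<bar>) ` {1..N}) \<in> (\<lambda>i. \<bar>a i * x i\<bar>) ` {1..N}"
    using i0N by (intro Max_in[OF fin]) blast
  then obtain v where v: "v \<in> {1..N}" "Max ((\<lambda>i. \<bar>a i * x i\<bar>) ` {1..N}) = \<bar>a v * x v\<bar>" by blast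
  have vmax: "\<bar>a i * x i\<bar> \<le> \<bar>a v * x v\<bar>" if "i \<in> {1..N}" for i
    unfolding v(2)[symmetric] using that by (intro Max_ge[OF fin]) blast
  have "a i0 * x i0 \<noteq> 0" using i0 a_nonzero[OF i0N] by simp
  then have avx: "a v * x v \<noteq> 0" using vmax[OF i0N] by auto
  then have xv: "x v \<noteq> 0" by auto
  have av: "a v \<noteq> 0" using a_nonzero[OF v(1)] .
  have vF: "pt v \<in> F" using off[OF v(1)] xv by blast
  define y where "y i = a i * x i / (a v * x v)" for i
  have y1: "\<bar>y i\<bar> \<le> 1" if "i \<in> {1..N}" for i
    using vmax[OF that] avx by (simp add: y_def)
  have yc: "\<bar>y i\<bar> = c v i * \<bar>x i / x v\<bar>" for i by (simp add: y_def c_def abs_mult)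
  have nbf: "finite {u. bedge F v u}"
    by (rule finite_subset[of _ "{1..N}"]) (use bedge_range in blast, simp)
  have nbn: "{u. bedge F v u} \<noteq> {}" using bedge_at_vertex[OF F v(1) vF] by blast
  have finy: "finite ((\<lambda>i. \<bar>y i\<bar>) ` {u. bedge F v u})" using nbf by simp
  have "Max ((\<lambda>i. \<bar>y i\<bar>) ` {u. bedge F v u}) \<in> (\<lambda>i. \<bar>y i\<bar>) ` {u. bedge F v u}"
    using nbn by (intro Max_in[OF finy]) blast
  then obtain u where u: "bedge F v u" "Max ((\<lambda>i. \<bar>y i\<bar>) ` {u. bedge F v u}) = \<bar>y u\<bar>" by blast
  have umax: "\<bar>y i\<bar> \<le> \<bar>y u\<bar>" if "bedge F v i" for i
    unfolding u(2)[symmetric] using that by (intro Max_ge[OF finy]) blast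
  have uN: "u \<in> {1..N}" using bedge_range[OF u(1)] by blast
  have ray: "x j / x v = (x w / x v) ^ n"
    if "bedge F v w" "j \<in> {1..N}" "b j - b v = (int n * fst (b w - b v), int n * snd (b w - b v))" for w j n
  proof -
    have "x j * x v ^ n = x w ^ n * x v" using bin[OF v(1) _ that(2,3)] bedge_range[OF that(1)] by blast
    then show ?thesis using xv by (simp add: power_divide field_simps)
  qed
  have nb: "\<bar>y w\<bar> \<le> 1/4" if "bedge F v w" "w \<noteq> u" for w
  proof (rule ccontr)
    assume "\<not> \<bar>y w\<bar> \<le> 1/4"
    then have "1/4 < \<bar>y w\<bar>" "1/4 < \<bar>y u\<bar>" using umax[OF that(1)] by auto
    then have "(1/4) * (1/4) < \<bar>y u\<bar> * \<bar>y w\<bar>" by (intro mult_strict_mono) auto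
    also have "\<bar>y u\<bar> * \<bar>y w\<bar> = c v u * c v w * (\<bar>x u * x w\<bar> / \<bar>x v\<bar> ^ 2)"
      unfolding yc by (simp add: abs_mult power2_eq_square)
    also have "x u * x w = x v ^ 2"
      using sq[OF v(1) uN _ bedge_opposite[OF u(1) that(1)]] bedge_range[OF that(1)] that(2) by blast
    also have "c v u * c v w * (\<bar>x v ^ 2\<bar> / \<bar>x v\<bar> ^ 2) = c v u * c v w" using xv by simp
    also have "\<dots> \<le> \<delta>" using opposite_coeff_small[OF u(1) that(1)] that(2) by blast
    also have "\<dots> \<le> 1/64" using delta_bound(4) v(1) by auto
    finally show False by simp
  qed
  have split: "(\<Sum>i\<in>{1..N}. y i) = 1 + y u + (\<Sum>i\<in>others F v u. y i)"
  proof -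
    have sub: "insert v (insert u (others F v u)) \<subseteq> {1..N}" using v(1) uN by (auto simp: others_def)
    have vu: "v \<noteq> u" "pt u \<in> F" using u(1) unfolding bedge_def by blast+
    have "(\<Sum>i\<in>{1..N}. y i) = sum y (insert v (insert u (others F v u)))"
    proof (rule sum.mono_neutral_right[OF _ sub])
      show "\<forall>i\<in>{1..N} - insert v (insert u (others F v u)). y i = 0"
      proof
        fix i assume "i \<in> {1..N} - insert v (insert u (others F v u))"
        then have "i \<in> {1..N}" "pt i \<notin> F" unfolding others_def by blast+
        then show "y i = 0" unfolding y_def using off by simp
      qed
    qed simp
    also have "\<dots> = y v + (y u + sum y (others F v u))"
      using vu by (simp add: others_def)
    also have "y v = 1" using avx by (simp add: y_def)
    finally show ?thesis by simp
  qed
  have ysum: "(\<Sum>i\<in>{1..N}. y i) = 0"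
    using lin unfolding y_def sum_divide_distrib[symmetric] by simp
  have yu: "1/2 \<le> \<bar>y u\<bar>"
  proof (rule ccontr)
    assume n: "\<not> 1/2 \<le> \<bar>y u\<bar>"
    \<comment> \<open>The only possible neighbour on the side besides \<open>u\<close>. If there is
      none, \<open>j0\<close> is an arbitrary index and the allowance of 1/4 for it merely weakens
      the estimate.\<close>
    define j0 where "j0 = (SOME w. bedge F v w \<and> w \<noteq> u)"
    have j0: "w = j0" if "bedge F v w" "w \<noteq> u" for w
    proof -
      have "\<exists>w. bedge F v w \<and> w \<noteq> u" using that by blast
      then have j: "bedge F v j0 \<and> j0 \<noteq> u" unfolding j0_def by (rule someI_ex)
      have "b w - b v = b j0 - b v"
        using bedge_opposite[OF u(1) that(1) that(2)[symmetric]] bedge_opposite[OF u(1), of j0] j by simp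
      then have "b w = b j0" by simp
      then show ?thesis using b_eq_iff[of w j0] bedge_range j that(1) by blast
    qed
    have est: "\<bar>y i\<bar> \<le> \<delta> + (if i = j0 then 1/4 else 0)" if i: "i \<in> others F v u" for i
    proof (cases "bedge F v i")
      case True
      have "i \<noteq> u" using i by (simp add: others_def)
      then show ?thesis using nb[OF True] j0[OF True] delta_pos by simp
    next
      case False
      have iF: "i \<in> {1..N}" "pt i \<in> F" "i \<noteq> v" using i by (auto simp: others_def)
      obtain w n where wn: "bedge F v w" "n \<ge> 1" "b i - b v = (int n * fst (b w - b v), int n * snd (b w - b v))"
        using side_ray[OF F v(1) vF iF] .
      have iw: "i \<notin> {v, w}" using False wn(1) iF(3) by blast
      have wN: "w \<in> {1..N}" using bedge_range[OF wn(1)] by blast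
      have "c v i \<le> \<delta> * c v w powi pos v w i" by (rule side_coeff(1)[OF wn(1) iF(1,2) iw])
      then have ci: "c v i \<le> \<delta> * c v w ^ n" unfolding pos_eqI[OF wn(1,3)] by simp
      have "\<bar>y i\<bar> = c v i * \<bar>x w / x v\<bar> ^ n"
        unfolding yc ray[OF wn(1) iF(1) wn(3)] power_abs ..
      also have "\<dots> \<le> (\<delta> * c v w ^ n) * \<bar>x w / x v\<bar> ^ n" using ci by (intro mult_right_mono) auto
      also have "\<dots> = \<delta> * \<bar>y w\<bar> ^ n" unfolding yc by (simp only: power_mult_distrib mult.assoc)
      also have "\<dots> \<le> \<delta> * 1" using y1[OF wN] delta_pos by (intro mult_left_mono power_le_one) auto
      finally show ?thesis by (cases "i = j0") auto
    qed
    have fo: "finite (others F v u)" by (simp add: others_def)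
    have "\<bar>\<Sum>i\<in>others F v u. y i\<bar> \<le> (\<Sum>i\<in>others F v u. \<bar>y i\<bar>)" by (rule sum_abs)
    also have "\<dots> \<le> (\<Sum>i\<in>others F v u. \<delta> + (if i = j0 then 1/4 else 0))" using est by (rule sum_mono)
    also have "\<dots> = real (card (others F v u)) * \<delta> + (\<Sum>i\<in>others F v u. if i = j0 then 1/4 else 0)"
      by (simp add: sum.distrib)
    also have "\<dots> \<le> real N * \<delta> + 1/4"
      using card_others delta_pos fo by (intro add_mono mult_right_mono) auto
    also have "real N * \<delta> \<le> real N * (\<delta> * 2 ^ K)"
      using delta_pos by (intro mult_left_mono) auto
    also have "\<dots> \<le> 1/16" by (rule delta_bound(3))
    finally have "\<bar>\<Sum>i\<in>others F v u. y i\<bar> \<le> 1/16 + 1/4" by simp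
    then show False using n split ysum by argo
  qed
  have xu: "x u \<noteq> 0" using yu by (auto simp: y_def)
  have au: "a u \<noteq> 0" using a_nonzero[OF uN] .
  define t where "t = - y u"
  have t: "- t * a v / a u = x u / x v" using av au xv by (simp add: t_def y_def)
  have xt: "x = (\<lambda>i. x v * edge_vec F v u t i)"
  proof
    fix i
    show "x i = x v * edge_vec F v u t i"
    proof (cases "i \<in> {1..N} \<and> pt i \<in> F")
      case True
      have "x i / x v = (x u / x v) powi pos v u i"
      proof (cases "i = v")
        case True
        then show ?thesis using xv pos_base(1)[OF u(1)] by simp
      next
        case iv: False
        obtain w n where wn: "bedge F v w" "n \<ge> 1" "b i - b v = (int n * fst (b w - b v), int n * snd (b w - b v))"
          using side_ray[OF F v(1) vF _ _ iv] True by blast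
        have xi: "x i / x v = (x w / x v) ^ n" using ray[OF wn(1) _ wn(3)] True by blast
        show ?thesis
        proof (cases "w = u")
          case True
          then have "pos v u i = int n" using pos_eqI[OF u(1)] wn(3) by blast
          then show ?thesis using xi True by simp
        next
          case False
          have op: "b w - b v = - (b u - b v)" using bedge_opposite[OF u(1) wn(1)] False by blast
          have "b i - b v = (- int n * fst (b u - b v), - int n * snd (b u - b v))"
            unfolding wn(3) op by (simp add: prod_eq_iff algebra_simps)
          then have p: "pos v u i = - int n" by (rule pos_eqI[OF u(1)])
          have "x u * x w = x v ^ 2" using sq[OF v(1) uN _ op] bedge_range[OF wn(1)] by blast
          then have "x w / x v = inverse (x u / x v)"
            using xu xv by (simp add: field_simps power2_eq_square)
          then show ?thesis unfolding xi p by (simp add: power_int_minus power_divide)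
        qed
      qed
      then have "x i = x v * (x u / x v) powi pos v u i" using xv by (simp add: field_simps)
      then show ?thesis unfolding edge_vec_def t using True by simp
    next
      case False
      have "x i = 0" using False off x(2) unfolding coord_space_def by blast
      then show ?thesis unfolding edge_vec_def if_not_P[OF False] by simp
    qed
  qed
  have "(\<Sum>i\<in>{1..N}. a i * (x v * edge_vec F v u t i)) = 0" using lin by (subst (asm) xt)
  then have "x v * (\<Sum>i\<in>{1..N}. a i * edge_vec F v u t i) = 0"
    by (simp add: sum_distrib_left mult.left_commute)
  then have Ft: "edge_poly F v u t = 0" using xv by (simp add: edge_poly_def)
  have at: "1/2 \<le> \<bar>t\<bar>" "\<bar>t\<bar> \<le> 1" using yu y1[OF uN] by (simp_all add: t_def)
  have "\<bar>\<Sum>i\<in>others F v u. edge_coeff v u i * t powi pos v u i\<bar> \<le> 1 / 16"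
    using edge_poly_rest[OF u(1) at(1)] at(2) by simp
  \<comment> \<open>For negative \<open>t\<close> the part 1 - t is at least 3/2, which the
    remaining 1/16 cannot cancel.\<close>
  then have "1/2 \<le> t" using Ft at unfolding edge_poly_split[OF u(1)] by argo
  then have "t = edge_root F v u"
    using edge_root_unique[OF u(1) _ _ Ft edge_root[OF u(1)]] at(2) by simp
  moreover have "z = proj_class (edge_vec F v u t)"
    unfolding x(1) by (subst xt) (rule proj_class_scale[OF xv])
  ultimately show ?thesis using that[OF u(1)] by (simp add: edge_point_def)
qed

section \<open>Position of the arcs relative to the axes, and the component containing them\<close>

lemma curve_subset_surface: "curve \<subseteq> real_toric_surface b N"
  unfolding real_mirror_curve_closure_def real_toric_surface_def
  by (intro closure_of_mono image_mono) blast

lemma edge_vec_endpoints: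
  assumes "bedge E v u" "s \<noteq> 0"
  shows "edge_vec E v u s v \<noteq> 0" "edge_vec E v u s u \<noteq> 0"
proof -
  have r: "v \<in> {1..N}" "u \<in> {1..N}" using bedge_range[OF assms(1)] by blast+
  have side: "pt v \<in> E" "pt u \<in> E" using assms(1) unfolding bedge_def by blast+
  show "edge_vec E v u s v \<noteq> 0" "edge_vec E v u s u \<noteq> 0"
    unfolding edge_vec_def using r side a_nonzero[OF r(1)] a_nonzero[OF r(2)] assms(2) by simp_all
qed

lemma edge_point_in_axis:
  assumes "bedge E v u" "edge_point E v u \<in> curve"
  shows "edge_point E v u \<in> toric_axis b N E"
  unfolding toric_axis_def
proof (intro CollectI conjI ballI impI)
  show "edge_point E v u \<in> real_toric_surface b N" using assms(2) curve_subset_surface by blast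
  fix y i assume y: "y \<in> edge_point E v u" and i: "pt i \<notin> E"
  obtain t where "y = (\<lambda>i. t * edge_vec E v u (edge_root E v u) i)"
    using y unfolding edge_point_def proj_class_def by blast
  then show "y i = 0" using i by (simp add: edge_vec_def)
qed

text \<open>The coordinates at \<open>v\<close> and \<open>u\<close> are nonzero, so a side whose
  axis contains the point contains two lattice points of \<open>E\<close> and is
  \<open>E\<close>.\<close>

lemma edge_point_notin_axis:
  assumes E: "bedge E v u" and F: "F \<in> polygon_sides P" "F \<noteq> E"
  shows "edge_point E v u \<notin> toric_axis b N F"
proof
  assume ax: "edge_point E v u \<in> toric_axis b N F"
  have r: "v \<in> {1..N}" "u \<in> {1..N}" using bedge_range[OF E] by blast+
  have side: "E \<in> polygon_sides P" "pt v \<in> E" "pt u \<in> E" "v \<noteq> u" using E unfolding bedge_def by blast+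
  have "edge_root E v u \<noteq> 0" using edge_root(1)[OF E] by auto
  note nz = edge_vec_endpoints[OF E this]
  have "edge_vec E v u (edge_root E v u) i = 0" if "i \<in> {1..N}" "pt i \<notin> F" for i
    using ax that proj_class_self unfolding toric_axis_def edge_point_def by blast
  then have "pt v \<in> F" "pt u \<in> F" using nz r by blast+
  then show False
    using side_unique[OF F(1) side(1) _ _ side(2,3)] F(2) side(4) b_eq_iff[OF r] by auto
qed

lemma torus_point_notin_axis:
  assumes "z \<in> proj_class ` monomial_map b N ` real_torus" and F: "F \<in> polygon_sides P"
  shows "z \<notin> toric_axis b N F"
proof
  assume ax: "z \<in> toric_axis b N F"
  obtain t where t: "t \<in> real_torus" "z = proj_class (monomial_map b N t)" using assms(1) by blast
  have "F \<noteq> {}" using F by (auto simp: polygon_sides_def)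
  then obtain v u where vu: "bedge F v u" using side_covered[OF F] by blast
  obtain w where w: "{v, u, w} \<in> T" "\<bar>det2 (b u - b v) (b w - b v)\<bar> = 1"
    using bedge_triangle[OF vu] .
  have wF: "pt w \<notin> F" using bedge_third_notin[OF vu w] .
  have wN: "w \<in> {1..N}" using triangle_subset[OF w(1)] by blast
  have "monomial_map b N t w = 0"
    using ax wF wN proj_class_self unfolding toric_axis_def t(2) by blast
  then show False using t(1) wN by (auto simp: monomial_map_def real_torus_def)
qed

lemma arc_between_connected:
  assumes "arc_between z z'"
  shows "connected_component_of (subtopology PS curve) z z'"
proof -
  obtain x1 x2 g where g: "x1 < x2" "continuous_map (top_of_set {x1..x2::real}) PS g"
    "g ` {x1..x2} \<subseteq> curve" "g x1 = z" "g x2 = z'"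
    using assms unfolding arc_between_def by blast
  have "connectedin (top_of_set {x1..x2}) {x1..x2}"
    by (simp add: connectedin_subtopology)
  then have "connectedin PS (g ` {x1..x2})"
    using connectedin_continuous_map_image[OF g(2)] by blast
  then have "connectedin (subtopology PS curve) (g ` {x1..x2})"
    using g(3) by (simp add: connectedin_subtopology)
  moreover have "z \<in> g ` {x1..x2}" "z' \<in> g ` {x1..x2}" using g by auto
  ultimately show ?thesis unfolding connected_component_of_def by blast
qed

text \<open>\<open>W\<close> is known only through a point \<open>z\<close> where it meets some
  axis. By \<open>axis_point\<close> this is an edge point; \<open>bedge_induct\<close> then
  connects it to the endpoint of the corner arc at a common vertex of \<open>E\<close> and
  \<open>E'\<close>.\<close>

lemma arc_in_unbounded_component:
  assumes E: "E \<in> polygon_sides P" and E': "E' \<in> polygon_sides P" and adj: "E \<noteq> E'" "E \<inter> E' \<noteq> {}"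
    and W: "W = connected_component_of_set (subtopology PS curve) w"
    and meets: "W \<inter> (\<Union>F\<in>polygon_sides P. toric_axis b N F) \<noteq> {}"
  shows "\<exists>A. A \<subseteq> W \<and> arc_in PS A \<and> A \<inter> toric_axis b N E \<noteq> {} \<and> A \<inter> toric_axis b N E' \<noteq> {} \<and>
    (\<forall>F\<in>polygon_sides P. F \<noteq> E \<and> F \<noteq> E' \<longrightarrow> A \<inter> toric_axis b N F = {})"
proof -
  let ?X = "subtopology PS curve"
  obtain z F0 where z: "z \<in> W" "F0 \<in> polygon_sides P" "z \<in> toric_axis b N F0" using meets by blast
  have wz: "connected_component_of ?X w z" using z(1) W by simp
  have "z \<in> topspace ?X" using wz connected_component_in_topspace by metis
  then have zc: "z \<in> curve" by simp
  obtain v0 u0 where z0: "bedge F0 v0 u0" "z = edge_point F0 v0 u0"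
    using axis_point[OF zc z(2,3)] .
  have all: "connected_component_of ?X z (edge_point F v u)" if "bedge F v u" for F v u
  proof (rule bedge_induct[where Q = "\<lambda>E v u. connected_component_of ?X z (edge_point E v u)", OF z0(1) _ _ _ that])
    show "connected_component_of ?X z (edge_point F0 v0 u0)"
      unfolding z0(2)[symmetric] using \<open>z \<in> topspace ?X\<close> by (simp add: connected_component_of_refl)
    show "connected_component_of ?X z (edge_point E u v)"
      if "bedge E v u" "connected_component_of ?X z (edge_point E v u)" for E v u
      using that edge_point_sym by simp
    show "connected_component_of ?X z (edge_point F v u')"
      if b: "bedge E v u" "bedge F v u'" and c: "connected_component_of ?X z (edge_point E v u)" for E v u F u'
    proof -
      \<comment> \<open>Different boundary edges at \<open>v\<close> lie on different sides, which
        gives a corner arc, or are opposite on one side, which gives a collinear arc.\<close>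
      have "E = F \<and> u = u' \<or> connected_component_of ?X (edge_point E v u) (edge_point F v u')"
        using arc_between_connected[OF corner_arc[OF b(2,1)]] arc_between_connected[OF collinear_arc[of E v u' u]] b
        by blast
      then show ?thesis using c connected_component_of_trans by metis
    qed
  qed
  obtain v u u' where vu: "bedge E v u" "bedge E' v u'"
    using sides_common_vertex[OF E E' adj] .
  obtain x1 x2 g where g: "x1 < x2" "continuous_map (top_of_set {x1..x2::real}) PS g" "inj_on g {x1..x2}"
    "g ` {x1..x2} \<subseteq> curve" "g x1 = edge_point E' v u'" "g x2 = edge_point E v u"
    "\<forall>x\<in>{x1<..<x2}. g x \<in> proj_class ` monomial_map b N ` real_torus"
    using corner_arc[OF vu adj(1)] unfolding arc_between_def by blast
  define A where "A = g ` {x1..x2}"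
  have ends: "g x1 \<in> A" "g x2 \<in> A" using g(1) by (auto simp: A_def)
  have "connectedin (top_of_set {x1..x2}) {x1..x2}"
    by (simp add: connectedin_subtopology)
  then have "connectedin PS A"
    unfolding A_def using connectedin_continuous_map_image[OF g(2)] by blast
  then have cA: "connectedin ?X A"
    using g(4) by (simp add: connectedin_subtopology A_def)
  have AW: "A \<subseteq> W"
  proof
    fix y assume "y \<in> A"
    then have "connected_component_of ?X (g x2) y"
      using cA ends(2) unfolding connected_component_of_def by blast
    moreover have "connected_component_of ?X z (g x2)" unfolding g(6) by (rule all[OF vu(1)])
    ultimately have "connected_component_of ?X w y" using wz connected_component_of_trans by metis
    then show "y \<in> W" unfolding W by simp
  qed
  \<comment> \<open>Affine reparametrisation, since \<open>arc_in\<close> asks for the interval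
    [0, 1].\<close>
  define r where "r t = x1 + t * (x2 - x1)" for t :: real
  have rD: "r ` {0..1} = {x1..x2}"
  proof
    show "r ` {0..1} \<subseteq> {x1..x2}"
    proof
      fix x assume "x \<in> r ` {0..1}"
      then obtain t where t: "0 \<le> t" "t \<le> 1" "x = r t" by auto
      have "0 \<le> t * (x2 - x1)" "t * (x2 - x1) \<le> 1 * (x2 - x1)"
        using t g(1) by (auto intro: mult_right_mono)
      then show "x \<in> {x1..x2}" unfolding t(3) r_def by auto
    qed
    show "{x1..x2} \<subseteq> r ` {0..1}"
    proof
      fix x assume x: "x \<in> {x1..x2}"
      have "x = r ((x - x1) / (x2 - x1))" using g(1) by (simp add: r_def)
      moreover have "(x - x1) / (x2 - x1) \<in> {0..1}" using x g(1) by (auto simp: divide_simps)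
      ultimately show "x \<in> r ` {0..1}" by blast
    qed
  qed
  have rinj: "inj_on r {0..1}" using g(1) by (auto simp: inj_on_def r_def)
  have "continuous_map (top_of_set {0..1}) (top_of_set {x1..x2}) r"
    using rD unfolding r_def by (auto intro!: continuous_intros)
  then have path: "pathin PS (g \<circ> r)"
    unfolding pathin_def using continuous_map_compose g(2) by blast
  have "arc_in PS A"
    unfolding arc_in_def
  proof (intro exI conjI)
    show "inj_on (g \<circ> r) {0..1}" using rinj g(3) rD by (simp add: comp_inj_on)
    show "A = (g \<circ> r) ` {0..1}" unfolding A_def image_comp[symmetric] rD ..
  qed (rule path)
  moreover have "g x2 \<in> toric_axis b N E"
    unfolding g(6) using edge_point_in_axis[OF vu(1)] g(4) ends(2) A_def g(6) by auto
  moreover have "g x1 \<in> toric_axis b N E'"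
    unfolding g(5) using edge_point_in_axis[OF vu(2)] g(4) ends(1) A_def g(5) by auto
  moreover have "A \<inter> toric_axis b N F = {}" if F: "F \<in> polygon_sides P" "F \<noteq> E" "F \<noteq> E'" for F
  proof -
    have "g x \<notin> toric_axis b N F" if x: "x \<in> {x1..x2}" for x
    proof -
      consider "x = x1" | "x = x2" | "x \<in> {x1<..<x2}" using x by fastforce
      then show ?thesis
      proof cases
        case 1
        then show ?thesis using edge_point_notin_axis[OF vu(2) F(1,3)] g(5) by simp
      next
        case 2
        then show ?thesis using edge_point_notin_axis[OF vu(1) F(1,2)] g(6) by simp
      next
        case 3
        then show ?thesis using torus_point_notin_axis[OF bspec[OF g(7) 3] F(1)] by simp
      qed
    qed
    then show ?thesis unfolding A_def by fast
  qed
  ultimately show ?thesis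
    using AW ends by (intro exI[of _ A] conjI ballI impI) blast+
qed

end

section \<open>The coefficients of the mirror curve\<close>

text \<open>Gaussian elimination of one equation with pivot \<open>k0\<close>, whose own coefficient
  \<open>e\<close> is solved for afterwards. It serves to exclude a zero column in a nondegenerate
  square matrix.\<close>

lemma homogeneous_system_nontrivial:
  fixes M :: "'k \<Rightarrow> 'i \<Rightarrow> 'f :: field"
  assumes "finite I" "finite J" "card I < card J"
  shows "\<exists>c. (\<forall>i\<in>I. (\<Sum>k\<in>J. c k * M k i) = 0) \<and> (\<exists>k\<in>J. c k \<noteq> 0)"
  using assms
proof (induction I arbitrary: J M rule: finite_induct)
  case empty
  then have "J \<noteq> {}" by auto
  then show ?case by (intro exI[of _ "\<lambda>_. 1"]) auto
next
  case (insert i I)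
  show ?case
  proof (cases "\<forall>k\<in>J. M k i = 0")
    case True
    have "card I < card J" using insert.hyps insert.prems by simp
    then obtain c where "\<forall>i\<in>I. (\<Sum>k\<in>J. c k * M k i) = 0" "\<exists>k\<in>J. c k \<noteq> 0"
      using insert.IH[OF insert.prems(1)] by blast
    then show ?thesis using True by (intro exI[of _ c]) simp
  next
    case False
    then obtain k0 where k0: "k0 \<in> J" "M k0 i \<noteq> 0" by blast
    define J' where "J' = J - {k0}"
    have fJ': "finite J'" using insert.prems(1) by (simp add: J'_def)
    have J: "J = insert k0 J'" "k0 \<notin> J'" using k0(1) by (auto simp: J'_def)
    have "card I < card J'" using insert.hyps insert.prems fJ' unfolding J(1) using J(2) by simp
    then obtain c where c: "\<forall>x\<in>I. (\<Sum>k\<in>J'. c k * (M k x - M k i / M k0 i * M k0 x)) = 0" "\<exists>k\<in>J'. c k \<noteq> 0"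
      using insert.IH[OF fJ', of "\<lambda>k x. M k x - M k i / M k0 i * M k0 x"] by blast
    define e where "e = - (\<Sum>k\<in>J'. c k * M k i) / M k0 i"
    define c' where "c' = c(k0 := e)"
    have sum: "(\<Sum>k\<in>J. c' k * M k x) = e * M k0 x + (\<Sum>k\<in>J'. c k * M k x)" for x
    proof -
      have "(\<Sum>k\<in>J'. c' k * M k x) = (\<Sum>k\<in>J'. c k * M k x)"
        using J(2) by (intro sum.cong[OF refl]) (auto simp: c'_def)
      then show ?thesis unfolding J(1) using fJ' J(2) by (simp add: c'_def)
    qed
    have "(\<Sum>k\<in>J. c' k * M k i) = 0" unfolding sum using k0(2) by (simp add: e_def)
    moreover have "(\<Sum>k\<in>J. c' k * M k x) = 0" if "x \<in> I" for x
    proof -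
      have "(\<Sum>k\<in>J'. c k * (M k x - M k i / M k0 i * M k0 x))
          = (\<Sum>k\<in>J'. c k * M k x) - (\<Sum>k\<in>J'. c k * M k i) * (M k0 x / M k0 i)"
        unfolding sum_distrib_right sum_subtractf[symmetric]
        by (intro sum.cong[OF refl]) (simp add: algebra_simps)
      also have "\<dots> = e * M k0 x + (\<Sum>k\<in>J'. c k * M k x)" by (simp add: e_def)
      finally show ?thesis unfolding sum using c(1) that by simp
    qed
    moreover have "\<exists>k\<in>J. c' k \<noteq> 0" using c(2) J by (auto simp: c'_def)
    ultimately show ?thesis by blast
  qed
qed

lemma ln_power_int_pos:
  fixes x :: real
  assumes "0 < x"
  shows "ln (x powi n) = of_int n * ln x"
proof (cases "0 \<le> n")
  case True
  then show ?thesis using assms by (simp add: power_int_def ln_realpow)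
next
  case False
  then show ?thesis using assms by (simp add: power_int_def ln_realpow ln_inverse)
qed

context lattice_triangulation
begin

lemma triangle_det:
  assumes "{v, u, w} \<in> T"
  shows "\<bar>det2 (b u - b v) (b w - b v)\<bar> = 1"
proof -
  obtain u' w' where *: "{v, u, w} = {v, u', w'}" "\<bar>det2 (b u' - b v) (b w' - b v)\<bar> = 1"
    using triangleE[OF assms, of v] by blast
  have "u = u' \<and> w = w' \<or> u = w' \<and> w = u'"
    using *(1) triangle_distinct[OF *(2)] by blast
  moreover have "det2 (b w' - b v) (b u' - b v) = - det2 (b u' - b v) (b w' - b v)"
    by (simp add: det2_def)
  ultimately show ?thesis using *(2) by (metis abs_minus_cancel)
qed

lemma lincomb_coeffs:
  assumes "\<bar>det2 d e\<bar> = 1" "z = lincomb d \<alpha> e \<beta>"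
  shows "\<bar>\<alpha>\<bar> = \<bar>det2 z e\<bar>" "\<bar>\<beta>\<bar> = \<bar>det2 d z\<bar>"
proof -
  have "det2 z e = \<alpha> * det2 d e" "det2 d z = \<beta> * det2 d e"
    unfolding assms(2) lincomb_def det2_def fst_conv snd_conv by (simp_all only: algebra_simps)
  then show "\<bar>\<alpha>\<bar> = \<bar>det2 z e\<bar>" "\<bar>\<beta>\<bar> = \<bar>det2 d z\<bar>"
    using assms(1) by (simp_all add: abs_mult)
qed

text \<open>By Cramer's rule each coordinate is, up to sign, a determinant of differences of lattice
  points; these are finitely many, and the sum \<open>m\<close> of their absolute values bounds
  each.\<close>

lemma triangle_coords_bounded:
  obtains K :: nat where "\<And>v u w j \<alpha> \<beta>. {v, u, w} \<in> T \<Longrightarrow> j \<in> {1..N} \<Longrightarrow>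
    b j - b v = lincomb (b u - b v) \<alpha> (b w - b v) \<beta> \<Longrightarrow> \<bar>\<alpha>\<bar> + \<bar>\<beta>\<bar> \<le> int K"
proof -
  define f where "f = (\<lambda>(j, v, w). \<bar>det2 (b j - b v) (b w - b v)\<bar>)"
  define A where "A = {1..N} \<times> {1..N} \<times> {1..N}"
  define m where "m = (\<Sum>t\<in>A. f t)"
  have m: "\<bar>det2 (b j - b v) (b w - b v)\<bar> \<le> m" if "j \<in> {1..N}" "v \<in> {1..N}" "w \<in> {1..N}" for j v w
  proof -
    have "f (j, v, w) \<le> (\<Sum>t\<in>A. f t)"
      using that by (intro member_le_sum) (auto simp: A_def f_def)
    then show ?thesis by (simp add: f_def m_def)
  qed
  show ?thesis
  proof (rule that[of "nat (2 * m)"])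
    fix v u w j \<alpha> \<beta>
    assume T: "{v, u, w} \<in> T" and j: "j \<in> {1..N}" and eq: "b j - b v = lincomb (b u - b v) \<alpha> (b w - b v) \<beta>"
    have r: "v \<in> {1..N}" "u \<in> {1..N}" "w \<in> {1..N}" using triangle_subset[OF T] by blast+
    show "\<bar>\<alpha>\<bar> + \<bar>\<beta>\<bar> \<le> int (nat (2 * m))"
      unfolding lincomb_coeffs[OF triangle_det[OF T] eq]
      using m[OF j r(1,3)] m[OF r(2,1) j] by linarith
  qed
qed

end

text \<open>The relation e_j - \<alpha> e_u - \<beta> e_w - (1 - \<alpha> - \<beta>) e_v lies in
  \<open>charge_lattice\<close>. Expanding \<open>Hk k\<close> on it for {1, 2, 3} gives the
  exponent of \<open>q k\<close> in the quotient of \<open>a j\<close> by the matching powers of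
  \<open>a u\<close>, \<open>a w\<close> and \<open>a v\<close>; expanding it for {v, u, w} leaves
  the single entry at \<open>j\<close>, a natural number. Logarithms turn the products into the sums
  that the expansions provide.\<close>

lemma mirror_coeff_ratio_small:
  fixes b :: "nat \<Rightarrow> int \<times> int" and s :: "nat set \<Rightarrow> nat \<Rightarrow> nat \<Rightarrow> nat" and q :: "nat \<Rightarrow> real"
    and Hk :: "nat \<Rightarrow> (nat \<Rightarrow> int) \<Rightarrow> rat"
  assumes lt: "lattice_triangulation P b (p+3) T"
    and sigma1: "{1, 2, 3} \<in> T"
    and H_expansion: "\<forall>\<sigma>\<in>T. \<forall>k\<in>{1..p}. \<forall>l\<in>charge_lattice b (p+3).
         Hk k l = (\<Sum>j\<in>{1..p+3} - \<sigma>. of_nat (s \<sigma> k j) * of_int (l j))"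
    and H_nondeg: "\<forall>\<sigma>\<in>T. \<forall>c :: nat \<Rightarrow> rat.
         (\<forall>j\<in>{1..p+3} - \<sigma>. (\<Sum>k\<in>{1..p}. c k * of_nat (s \<sigma> k j)) = 0)
           \<longrightarrow> (\<forall>k\<in>{1..p}. c k = 0)"
    and q: "\<forall>k\<in>{1..p}. q k \<noteq> 0 \<and> \<bar>q k\<bar> < \<epsilon>" and \<epsilon>: "0 < \<epsilon>" "\<epsilon> \<le> 1"
    and vuw: "{v, u, w} \<in> T" and j: "j \<in> {1..p+3} - {v, u, w}"
    and lc: "b j - b v = lincomb (b u - b v) \<alpha> (b w - b v) \<beta>"
    and a: "a = mirror_coeff p (s {1, 2, 3}) q"
  shows "\<bar>a j / a v\<bar> \<le> \<epsilon> * \<bar>a u / a v\<bar> powi \<alpha> * \<bar>a w / a v\<bar> powi \<beta>"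
proof -
  interpret lattice_triangulation P b "p + 3" T by (rule lt)
  let ?N = "p + 3"
  let ?\<sigma> = "{v, u, w}"
  note dist = triangle_distinct[OF triangle_det[OF vuw]]
  have r: "v \<in> {1..?N}" "u \<in> {1..?N}" "w \<in> {1..?N}" using triangle_subset[OF vuw] by blast+
  have jN: "j \<in> {1..?N}" "j \<noteq> v" "j \<noteq> u" "j \<noteq> w" using j by auto
  define l where "l i = (if i = j then 1 else 0) - \<alpha> * (if i = u then 1 else 0)
    - \<beta> * (if i = w then 1 else 0) - (1 - \<alpha> - \<beta>) * (if i = v then 1 else 0)" for i
  have l_sum: "(\<Sum>i\<in>{1..?N}. of_int (l i) * f i) = f j - of_int \<alpha> * f u - of_int \<beta> * f w - of_int (1 - \<alpha> - \<beta>) * f v"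
    for f :: "nat \<Rightarrow> 'r :: comm_ring_1"
  proof -
    have pick: "(\<Sum>i\<in>{1..?N}. (if i = x then 1 else 0) * f i) = f x" if "x \<in> {1..?N}" for x
    proof -
      have "(\<Sum>i\<in>{1..?N}. (if i = x then 1 else 0) * f i) = (\<Sum>i\<in>{1..?N}. if i = x then f i else 0)"
        by (intro sum.cong) auto
      then show ?thesis using that by simp
    qed
    have "of_int (l i) * f i = (if i = j then 1 else 0) * f i - of_int \<alpha> * ((if i = u then 1 else 0) * f i)
        - of_int \<beta> * ((if i = w then 1 else 0) * f i) - of_int (1 - \<alpha> - \<beta>) * ((if i = v then 1 else 0) * f i)" for i
      by (simp add: l_def algebra_simps)
    then have "(\<Sum>i\<in>{1..?N}. of_int (l i) * f i) = (\<Sum>i\<in>{1..?N}. (if i = j then 1 else 0) * f i)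
      - of_int \<alpha> * (\<Sum>i\<in>{1..?N}. (if i = u then 1 else 0) * f i)
      - of_int \<beta> * (\<Sum>i\<in>{1..?N}. (if i = w then 1 else 0) * f i)
      - of_int (1 - \<alpha> - \<beta>) * (\<Sum>i\<in>{1..?N}. (if i = v then 1 else 0) * f i)"
      by (simp only: sum_subtractf sum_distrib_left)
    then show ?thesis unfolding pick[OF jN(1)] pick[OF r(1)] pick[OF r(2)] pick[OF r(3)] .
  qed
  have bj: "fst (b j) = fst (b v) + \<alpha> * (fst (b u) - fst (b v)) + \<beta> * (fst (b w) - fst (b v))"
    "snd (b j) = snd (b v) + \<alpha> * (snd (b u) - snd (b v)) + \<beta> * (snd (b w) - snd (b v))"
    using lc by (simp_all add: lincomb_def prod_eq_iff algebra_simps)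
  have lL: "l \<in> charge_lattice b ?N"
  proof -
    have "\<forall>i. i \<notin> {1..?N} \<longrightarrow> l i = 0" using r jN(1) by (auto simp: l_def)
    moreover have "(\<Sum>i\<in>{1..?N}. l i * fst (b i)) = 0"
      using l_sum[of "\<lambda>i. fst (b i)"] bj(1) by (simp add: algebra_simps)
    moreover have "(\<Sum>i\<in>{1..?N}. l i * snd (b i)) = 0"
      using l_sum[of "\<lambda>i. snd (b i)"] bj(2) by (simp add: algebra_simps)
    moreover have "(\<Sum>i\<in>{1..?N}. l i) = 0"
      using l_sum[of "\<lambda>i. 1 :: int"] by simp
    ultimately show ?thesis unfolding charge_lattice_def by blast
  qed
  have exponent: "(\<Sum>i\<in>{1..?N} - {1, 2, 3}. int (s {1, 2, 3} k i) * l i) = int (s ?\<sigma> k j)"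
    if k: "k \<in> {1..p}" for k
  proof -
    have "(of_int (\<Sum>i\<in>{1..?N} - {1, 2, 3}. int (s {1, 2, 3} k i) * l i) :: rat) = Hk k l"
      using H_expansion sigma1 k lL by simp
    also have "\<dots> = (\<Sum>i\<in>{1..?N} - ?\<sigma>. of_nat (s ?\<sigma> k i) * of_int (l i))"
      using H_expansion vuw k lL by blast
    also have "\<dots> = (\<Sum>i\<in>{1..?N} - ?\<sigma>. if i = j then of_nat (s ?\<sigma> k i) else 0)"
      by (intro sum.cong[OF refl]) (auto simp: l_def)
    also have "\<dots> = of_nat (s ?\<sigma> k j)" using j by simp
    finally have "(of_int (\<Sum>i\<in>{1..?N} - {1, 2, 3}. int (s {1, 2, 3} k i) * l i) :: rat) = of_int (int (s ?\<sigma> k j))"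
      by simp
    then show ?thesis unfolding of_int_eq_iff .
  qed
  have qp: "0 < \<bar>q k\<bar>" "\<bar>q k\<bar> < \<epsilon>" if "k \<in> {1..p}" for k using q that by auto
  have ap: "0 < \<bar>a i\<bar>" for i unfolding a mirror_coeff_def using q by (auto simp: prod_zero_iff)
  define L where "L i = ln \<bar>a i\<bar>" for i
  have L: "L i = (if i \<in> {1, 2, 3} then 0 else (\<Sum>k\<in>{1..p}. real (s {1, 2, 3} k i) * ln \<bar>q k\<bar>))"
    if "i \<in> {1..?N}" for i
  proof (cases "i \<le> 3")
    case True
    then have "i \<in> {1, 2, 3}" using that by auto
    then show ?thesis using True by (simp add: L_def a mirror_coeff_def)
  next
    case False
    have "L i = ln (\<Prod>k\<in>{1..p}. \<bar>q k\<bar> ^ s {1, 2, 3} k i)"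
      using False by (simp add: L_def a mirror_coeff_def abs_prod power_abs)
    also have "\<dots> = (\<Sum>k\<in>{1..p}. ln (\<bar>q k\<bar> ^ s {1, 2, 3} k i))"
      using qp by (intro ln_prod) auto
    also have "\<dots> = (\<Sum>k\<in>{1..p}. real (s {1, 2, 3} k i) * ln \<bar>q k\<bar>)"
      using qp by (intro sum.cong[OF refl] ln_realpow)
    finally show ?thesis using False by simp
  qed
  have "(\<Sum>i\<in>{1..?N}. of_int (l i) * L i) = (\<Sum>i\<in>{1..?N} - {1, 2, 3}. of_int (l i) * L i)"
    using L by (intro sum.mono_neutral_right) auto
  also have "\<dots> = (\<Sum>i\<in>{1..?N} - {1, 2, 3}. \<Sum>k\<in>{1..p}. of_int (int (s {1, 2, 3} k i) * l i) * ln \<bar>q k\<bar>)"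
  proof (rule sum.cong[OF refl])
    fix i assume i: "i \<in> {1..?N} - {1, 2, 3}"
    then have "L i = (\<Sum>k\<in>{1..p}. real (s {1, 2, 3} k i) * ln \<bar>q k\<bar>)" using L[of i] by simp
    then show "of_int (l i) * L i = (\<Sum>k\<in>{1..p}. of_int (int (s {1, 2, 3} k i) * l i) * ln \<bar>q k\<bar>)"
      by (simp add: sum_distrib_left mult_ac)
  qed
  also have "\<dots> = (\<Sum>k\<in>{1..p}. \<Sum>i\<in>{1..?N} - {1, 2, 3}. of_int (int (s {1, 2, 3} k i) * l i) * ln \<bar>q k\<bar>)"
    by (rule sum.swap)
  also have "\<dots> = (\<Sum>k\<in>{1..p}. real (s ?\<sigma> k j) * ln \<bar>q k\<bar>)"
  proof (rule sum.cong[OF refl])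
    fix k assume k: "k \<in> {1..p}"
    have "(\<Sum>i\<in>{1..?N} - {1, 2, 3}. of_int (int (s {1, 2, 3} k i) * l i) * ln \<bar>q k\<bar>)
        = of_int (\<Sum>i\<in>{1..?N} - {1, 2, 3}. int (s {1, 2, 3} k i) * l i) * ln \<bar>q k\<bar>"
      unfolding of_int_sum sum_distrib_right ..
    then show "(\<Sum>i\<in>{1..?N} - {1, 2, 3}. of_int (int (s {1, 2, 3} k i) * l i) * ln \<bar>q k\<bar>)
        = real (s ?\<sigma> k j) * ln \<bar>q k\<bar>" unfolding exponent[OF k] by simp
  qed
  finally have rel: "L j - of_int \<alpha> * L u - of_int \<beta> * L w - of_int (1 - \<alpha> - \<beta>) * L v
      = (\<Sum>k\<in>{1..p}. real (s ?\<sigma> k j) * ln \<bar>q k\<bar>)"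
    unfolding l_sum .
  \<comment> \<open>A zero column \<open>j\<close> would leave \<open>p - 1\<close> equations for
    the \<open>p\<close> coefficients of a combination of rows, hence a nontrivial solution, against
    \<open>H_nondeg\<close>.\<close>
  have "\<exists>k\<in>{1..p}. s ?\<sigma> k j \<noteq> 0"
  proof (rule ccontr)
    assume none: "\<not> (\<exists>k\<in>{1..p}. s ?\<sigma> k j \<noteq> 0)"
    let ?I = "{1..?N} - ?\<sigma> - {j}"
    have "card ?\<sigma> = 3" using dist by simp
    then have "card ({1..?N} - ?\<sigma>) = p" using r by (subst card_Diff_subset) auto
    then have cI: "card ?I = p - 1" using j by (subst card_Diff_singleton) auto
    have "p \<noteq> 0" using \<open>card ({1..?N} - ?\<sigma>) = p\<close> j by (metis card_0_eq empty_iff finite_Diff finite_atLeastAtMost)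
    then have "card ?I < card {1..p}" using cI by simp
    then obtain c :: "nat \<Rightarrow> rat" where c: "\<forall>i\<in>?I. (\<Sum>k\<in>{1..p}. c k * of_nat (s ?\<sigma> k i)) = 0"
      "\<exists>k\<in>{1..p}. c k \<noteq> 0"
      using homogeneous_system_nontrivial[of ?I "{1..p}" "\<lambda>k i. of_nat (s ?\<sigma> k i)"] by auto
    have "(\<Sum>k\<in>{1..p}. c k * of_nat (s ?\<sigma> k j)) = 0" using none by (intro sum.neutral) auto
    then have "\<forall>i\<in>{1..?N} - ?\<sigma>. (\<Sum>k\<in>{1..p}. c k * of_nat (s ?\<sigma> k i)) = 0" using c(1) by blast
    then have "\<forall>k\<in>{1..p}. c k = 0" using bspec[OF H_nondeg vuw] by blast
    then show False using c(2) by blast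
  qed
  then obtain k0 where k0: "k0 \<in> {1..p}" "s ?\<sigma> k0 j \<noteq> 0" by blast
  have neg: "ln \<bar>q k\<bar> \<le> 0" if "k \<in> {1..p}" for k using qp[OF that] \<epsilon>(2) by simp
  \<comment> \<open>Every summand is nonpositive because |q k| < 1, so one index \<open>k0\<close>
    with a nonzero exponent already gives the bound.\<close>
  have "(\<Sum>k\<in>{1..p}. real (s ?\<sigma> k j) * ln \<bar>q k\<bar>) \<le> (\<Sum>k\<in>{k0}. real (s ?\<sigma> k j) * ln \<bar>q k\<bar>)"
  proof -
    have "(\<Sum>k\<in>{k0}. - (real (s ?\<sigma> k j) * ln \<bar>q k\<bar>)) \<le> (\<Sum>k\<in>{1..p}. - (real (s ?\<sigma> k j) * ln \<bar>q k\<bar>))"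
    proof (rule sum_mono2)
      show "0 \<le> - (real (s ?\<sigma> k j) * ln \<bar>q k\<bar>)" if "k \<in> {1..p} - {k0}" for k
        using mult_nonneg_nonpos[OF of_nat_0_le_iff neg[of k]] that by simp
    qed (use k0 in auto)
    then show ?thesis by (simp add: sum_negf)
  qed
  also have "\<dots> = real (s ?\<sigma> k0 j) * ln \<bar>q k0\<bar>" by simp
  also have "\<dots> \<le> 1 * ln \<bar>q k0\<bar>"
    using k0 neg[OF k0(1)] by (intro mult_right_mono_neg) auto
  also have "\<dots> \<le> ln \<epsilon>" using qp[OF k0(1)] by simp
  finally have small: "L j - of_int \<alpha> * L u - of_int \<beta> * L w - of_int (1 - \<alpha> - \<beta>) * L v \<le> ln \<epsilon>"
    using rel by simp
  have apz: "a i \<noteq> 0" for i using ap[of i] by auto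
  have Ldiv: "ln \<bar>a i / a v\<bar> = L i - L v" "0 < \<bar>a i / a v\<bar>" for i
    using apz by (simp_all add: L_def abs_divide ln_div)
  have "ln \<bar>a j / a v\<bar> \<le> ln \<epsilon> + of_int \<alpha> * ln \<bar>a u / a v\<bar> + of_int \<beta> * ln \<bar>a w / a v\<bar>"
    using small unfolding Ldiv(1) by (simp add: algebra_simps)
  also have "\<dots> = ln \<epsilon> + ln (\<bar>a u / a v\<bar> powi \<alpha>) + ln (\<bar>a w / a v\<bar> powi \<beta>)"
    using ln_power_int_pos[OF Ldiv(2)] by simp
  also have "\<dots> = ln (\<epsilon> * \<bar>a u / a v\<bar> powi \<alpha> * \<bar>a w / a v\<bar> powi \<beta>)"
  proof -
    have "0 < \<bar>a u / a v\<bar> powi \<alpha>" "0 < \<bar>a w / a v\<bar> powi \<beta>"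
      using Ldiv(2) by (blast intro: zero_less_power_int)+
    moreover have "ln x + ln y + ln z = ln (x * y * z)" if "0 < x" "0 < y" "0 < z" for x y z :: real
      using that by (simp add: ln_mult)
    ultimately show ?thesis using \<epsilon>(1) by blast
  qed
  finally show ?thesis
    using Ldiv(2) \<epsilon>(1) by (subst (asm) ln_le_cancel_iff) (auto intro!: mult_pos_pos zero_less_power_int)
qed

theorem theorem5p3p3:
  fixes P :: "(real \<times> real) set" and p :: nat and b :: "nat \<Rightarrow> int \<times> int"
    and T :: "nat set set" and s :: "nat set \<Rightarrow> nat \<Rightarrow> nat \<Rightarrow> nat"
    and Hk :: "nat \<Rightarrow> (nat \<Rightarrow> int) \<Rightarrow> rat"
  assumes poly: "convex_lattice_polygon P"
    and pts: "bij_betw b {1..p+3} {v. lattice_pt v \<in> P}"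
    and b1: "b 1 = (1, 0)" and b2: "b 2 = (0, 1)" and b3: "b 3 = (0, 0)"
    and tri: "unimodular_triangulation P b (p+3) T"
    and sigma1: "{1, 2, 3} \<in> T"
    and H_expansion: "\<forall>\<sigma>\<in>T. \<forall>k\<in>{1..p}. \<forall>l\<in>charge_lattice b (p+3).
         Hk k l = (\<Sum>j\<in>{1..p+3} - \<sigma>. of_nat (s \<sigma> k j) * of_int (l j))"
    and H_nondeg: "\<forall>\<sigma>\<in>T. \<forall>c :: nat \<Rightarrow> rat.
         (\<forall>j\<in>{1..p+3} - \<sigma>. (\<Sum>k\<in>{1..p}. c k * of_nat (s \<sigma> k j)) = 0)
           \<longrightarrow> (\<forall>k\<in>{1..p}. c k = 0)"
  shows "\<exists>\<epsilon>>0. \<forall>q :: nat \<Rightarrow> real.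
     (\<forall>k\<in>{1..p}. q k \<noteq> 0 \<and> \<bar>q k\<bar> < \<epsilon>) \<longrightarrow>
     (\<forall>i\<in>{1..p+3}. (odd (fst (b i)) \<and> odd (snd (b i)))
                       \<longrightarrow> mirror_coeff p (s {1, 2, 3}) q i < 0) \<longrightarrow>
     (\<forall>i\<in>{1..p+3}. (even (fst (b i)) \<or> even (snd (b i)))
                       \<longrightarrow> mirror_coeff p (s {1, 2, 3}) q i > 0) \<longrightarrow>
     (\<forall>E\<in>polygon_sides P. \<forall>E'\<in>polygon_sides P. E \<noteq> E' \<and> E \<inter> E' \<noteq> {} \<longrightarrow>
       (\<forall>w\<in>real_mirror_curve_closure b (p+3) (mirror_coeff p (s {1, 2, 3}) q).
         let W = connected_component_of_set
                   (subtopology (real_proj_space (p+3))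
                      (real_mirror_curve_closure b (p+3) (mirror_coeff p (s {1, 2, 3}) q))) w
         in W \<inter> (\<Union>F\<in>polygon_sides P. toric_axis b (p+3) F) \<noteq> {} \<longrightarrow>
            (\<exists>A. A \<subseteq> W \<and> arc_in (real_proj_space (p+3)) A \<and>
                 A \<inter> toric_axis b (p+3) E \<noteq> {} \<and> A \<inter> toric_axis b (p+3) E' \<noteq> {} \<and>
                 (\<forall>F\<in>polygon_sides P. F \<noteq> E \<and> F \<noteq> E' \<longrightarrow> A \<inter> toric_axis b (p+3) F = {}))))"
proof -
  have lt: "lattice_triangulation P b (p + 3) T"
    by (rule lattice_triangulation.intro[OF poly pts tri])
  interpret lattice_triangulation P b "p + 3" T by (rule lt)
  obtain K :: nat where K: "\<And>v u w j \<alpha> \<beta>. {v, u, w} \<in> T \<Longrightarrow> j \<in> {1..p+3} \<Longrightarrow>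
    b j - b v = lincomb (b u - b v) \<alpha> (b w - b v) \<beta> \<Longrightarrow> \<bar>\<alpha>\<bar> + \<bar>\<beta>\<bar> \<le> int K"
    by (rule triangle_coords_bounded) blast
  define D where "D = real (p + 3) * (64 * real (K + 1) * 6 ^ (K + 1))"
  have "1 * (1 * 1) \<le> D"
    unfolding D_def by (intro mult_mono one_le_power) auto
  then have D: "1 \<le> D" by simp
  \<comment> \<open>Turns \<open>delta_small\<close> into an equality; \<open>D\<close> being at
    least 1 gives \<epsilon> <= 1, which makes the logarithms of |q k| nonpositive.\<close>
  define \<epsilon> where "\<epsilon> = 1 / D"
  have \<epsilon>: "0 < \<epsilon>" "\<epsilon> \<le> 1" using D by (simp_all add: \<epsilon>_def)
  have \<epsilon>D: "real (p + 3) * \<epsilon> * (64 * real (K + 1) * 6 ^ (K + 1)) \<le> 1"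
  proof -
    have "real (p + 3) * \<epsilon> * (64 * real (K + 1) * 6 ^ (K + 1)) = \<epsilon> * D"
      unfolding D_def by (simp only: mult_ac)
    then show ?thesis using D by (simp add: \<epsilon>_def)
  qed
  show ?thesis
  proof (intro exI[of _ \<epsilon>] conjI \<epsilon>(1) allI impI ballI)
    fix q E E' w
    assume q: "\<forall>k\<in>{1..p}. q k \<noteq> 0 \<and> \<bar>q k\<bar> < \<epsilon>"
      and neg: "\<forall>i\<in>{1..p+3}. odd (fst (b i)) \<and> odd (snd (b i)) \<longrightarrow> mirror_coeff p (s {1, 2, 3}) q i < 0"
      and pos: "\<forall>i\<in>{1..p+3}. even (fst (b i)) \<or> even (snd (b i)) \<longrightarrow> 0 < mirror_coeff p (s {1, 2, 3}) q i"
      and E: "E \<in> polygon_sides P" "E' \<in> polygon_sides P" and adj: "E \<noteq> E' \<and> E \<inter> E' \<noteq> {}"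
    define a where "a = mirror_coeff p (s {1, 2, 3}) q"
    interpret small_patchwork P b "p + 3" T a \<epsilon> K
    proof
      show "a i < 0" if "i \<in> {1..p+3}" "odd (fst (b i)) \<and> odd (snd (b i))" for i
        using neg that unfolding a_def by blast
      show "0 < a i" if "i \<in> {1..p+3}" "even (fst (b i)) \<or> even (snd (b i))" for i
        using pos that unfolding a_def by blast
      show "\<bar>a j / a v\<bar> \<le> \<epsilon> * \<bar>a u / a v\<bar> powi \<alpha> * \<bar>a w / a v\<bar> powi \<beta>"
        if "{v, u, w} \<in> T" "j \<in> {1..p+3} - {v, u, w}" "b j - b v = lincomb (b u - b v) \<alpha> (b w - b v) \<beta>"
        for v u w j \<alpha> \<beta>
        by (rule mirror_coeff_ratio_small[OF lt sigma1 H_expansion H_nondeg q \<epsilon> that a_def])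
    qed (rule K \<epsilon> \<epsilon>D; assumption)+
    show "let W = connected_component_of_set
                   (subtopology (real_proj_space (p+3))
                      (real_mirror_curve_closure b (p+3) (mirror_coeff p (s {1, 2, 3}) q))) w
         in W \<inter> (\<Union>F\<in>polygon_sides P. toric_axis b (p+3) F) \<noteq> {} \<longrightarrow>
            (\<exists>A. A \<subseteq> W \<and> arc_in (real_proj_space (p+3)) A \<and>
                 A \<inter> toric_axis b (p+3) E \<noteq> {} \<and> A \<inter> toric_axis b (p+3) E' \<noteq> {} \<and>
                 (\<forall>F\<in>polygon_sides P. F \<noteq> E \<and> F \<noteq> E' \<longrightarrow> A \<inter> toric_axis b (p+3) F = {}))"
      unfolding Let_def a_def[symmetric]
      using arc_in_unbounded_component[OF E conjunct1[OF adj] conjunct2[OF adj] refl] by (rule impI)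
  qed
qed

end
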